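(* Let $G$ be a locally compact group and let $Y$ be an ergodic $G$-space with a finite invariant measure $\nu$. (i) If $G$ has property $T$, then so does the $G$-action on $(Y,\nu)$. (ii) If $G$ is a countable discrete group and the $G$-action on $(Y,\nu)$ has property $T$, then $G$ has property $T$.
   Context: Conventions: locally compact groups are second countable, Borel spaces are standard, Hilbert spaces are separable and complex. A $G$-space is a standard Borel space $Y$ with a Borel left action of $G$; it is ergodic with respect to $\nu$ if every $G$-invariant Borel set is $\nu$-null or conull. Let $\lambda$ be Haar measure of $G$. The groupoid $Y\rtimes G$ is $Y\times G$ with unit space $Y$, range $r(y,g)=y$, source $s(y,g)=g^{-1}y$, product $(y,g)(g^{-1}y,h)=(y,gh)$ and measure class $[\nu\times\lambda]$; an inessential reduction is the set of $(y,g)$ with $y,g^{-1}y\in U$ for a conull Borel $U\subset Y$. The $G$-action on $(Y,\nu)$ has property $T$ if: for every representation $L$ (a Borel map assigning to $(y,g)$ a Hilbert space isomorphism $L(y,g):\mathcal{H}(g^{-1}y)\to\mathcal{H}(y)$, where $\mathcal{H}$ is a Borel field of Hilbert spaces over $Y$, with $L(y,gh)=L(y,g)L(g^{-1}y,h)$ on some inessential reduction) for which there are Borel unit sections $\xi_n$ (i.e. $\|\xi_n(y)\|=1$ a.e.) with $\|\xi_n(y)-L(y,g)\xi_n(g^{-1}y)\|\to0$ for $\nu\times\lambda$-a.e. $(y,g)$, there is a Borel unit section $\xi$ with $\xi(y)=L(y,g)\xi(g^{-1}y)$ for $\nu\times\lambda$-a.e. $(y,g)$. Property $T$ of the group $G$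 is Kazhdan's property (T). *)

theory Defs
  imports "HOL-Analysis.Analysis"
begin

section \<open>The complex Hilbert space of square-summable sequences\<close>

typedef ell2 = "{x :: nat \<Rightarrow> complex. summable (\<lambda>i. (cmod (x i))\<^sup>2)}"
  morphisms ell2_nth Abs_ell2
  by (rule exI[of _ "\<lambda>_. 0"]) simp

setup_lifting type_definition_ell2

lemma summable_ell2: "summable (\<lambda>i. (cmod (ell2_nth x i))\<^sup>2)"
  using ell2_nth[of x] by simp

lemma ell2_eqI: "(\<And>i. ell2_nth x i = ell2_nth y i) \<Longrightarrow> x = y"
  by (metis ell2_nth_inject ext)

lemma cmod_add_sq_le: "(cmod (a + b))\<^sup>2 \<le> 2 * (cmod a)\<^sup>2 + 2 * (cmod b)\<^sup>2"
proof -
  have "(cmod (a + b))\<^sup>2 \<le> (cmod a + cmod b)\<^sup>2"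
    by (intro power_mono norm_triangle_ineq norm_ge_zero)
  also have "\<dots> \<le> 2 * (cmod a)\<^sup>2 + 2 * (cmod b)\<^sup>2"
    using sum_squares_bound[of "cmod a" "cmod b"] by (simp add: power2_sum)
  finally show ?thesis .
qed

lemma summable_sq_add:
  assumes "summable (\<lambda>i. (cmod (x i))\<^sup>2)" "summable (\<lambda>i. (cmod (y i))\<^sup>2)"
  shows "summable (\<lambda>i. (cmod (x i + y i))\<^sup>2)"
  by (rule summable_comparison_test[OF _ summable_add[OF summable_mult[OF assms(1), of 2]
        summable_mult[OF assms(2), of 2]]]) (auto simp: cmod_add_sq_le)

lemma summable_sq_scale:
  assumes "summable (\<lambda>i. (cmod (x i))\<^sup>2)"
  shows "summable (\<lambda>i. (cmod (c * x i))\<^sup>2)"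
  using summable_mult[OF assms, of "(cmod c)\<^sup>2"] by (simp add: norm_mult power_mult_distrib)

lemma summable_sq_prod:
  assumes "summable (\<lambda>i. (cmod (x i))\<^sup>2)" "summable (\<lambda>i. (cmod (y i))\<^sup>2)"
  shows "summable (\<lambda>i. x i * cnj (y i))"
proof (rule summable_comparison_test[OF _ summable_add[OF assms]], intro exI allI impI)
  fix i
  have "2 * cmod (x i) * cmod (y i) \<le> (cmod (x i))\<^sup>2 + (cmod (y i))\<^sup>2"
    by (rule sum_squares_bound)
  moreover have "0 \<le> cmod (x i) * cmod (y i)" by simp
  ultimately have "cmod (x i) * cmod (y i) \<le> (cmod (x i))\<^sup>2 + (cmod (y i))\<^sup>2"
    by linarith
  then show "norm (x i * cnj (y i)) \<le> (cmod (x i))\<^sup>2 + (cmod (y i))\<^sup>2"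
    by (simp add: norm_mult)
qed

instantiation ell2 :: real_vector
begin

lift_definition zero_ell2 :: ell2 is "\<lambda>_. 0" by simp
lift_definition plus_ell2 :: "ell2 \<Rightarrow> ell2 \<Rightarrow> ell2" is "\<lambda>x y i. x i + y i"
  by (rule summable_sq_add)
lift_definition uminus_ell2 :: "ell2 \<Rightarrow> ell2" is "\<lambda>x i. - x i" by simp
lift_definition minus_ell2 :: "ell2 \<Rightarrow> ell2 \<Rightarrow> ell2" is "\<lambda>x y i. x i - y i"
  using summable_sq_add[of _ "\<lambda>i. - _ i"] by simp
lift_definition scaleR_ell2 :: "real \<Rightarrow> ell2 \<Rightarrow> ell2" is "\<lambda>r x i. complex_of_real r * x i"
  by (rule summable_sq_scale)

instance
  by standard (transfer; simp add: algebra_simps)+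

end

lift_definition scaleC :: "complex \<Rightarrow> ell2 \<Rightarrow> ell2" (infixr "*\<^sub>C" 75) is "\<lambda>c x i. c * x i"
  by (rule summable_sq_scale)

global_interpretation ell2: vector_space scaleC
  by standard (transfer; simp add: algebra_simps)+

definition cinner :: "ell2 \<Rightarrow> ell2 \<Rightarrow> complex" where
  "cinner x y = (\<Sum>i. ell2_nth x i * cnj (ell2_nth y i))"

lemma cinner_sums: "(\<lambda>i. ell2_nth x i * cnj (ell2_nth y i)) sums cinner x y"
  unfolding cinner_def by (intro summable_sums summable_sq_prod summable_ell2)

lemma cinner_add_left: "cinner (x + y) z = cinner x z + cinner y z"
  by (rule sums_unique2[OF cinner_sums])
    (use sums_add[OF cinner_sums[of x z] cinner_sums[of y z]] in
      \<open>simp add: plus_ell2.rep_eq algebra_simps\<close>)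

lemma cinner_scaleC_left: "cinner (c *\<^sub>C x) z = c * cinner x z"
  by (rule sums_unique2[OF cinner_sums])
    (use sums_mult[OF cinner_sums[of x z], of c] in \<open>simp add: scaleC.rep_eq algebra_simps\<close>)

lemma cinner_commute: "cinner x y = cnj (cinner y x)"
  by (rule sums_unique2[OF cinner_sums])
    (use cinner_sums[of y x, THEN sums_cnj[THEN iffD2]] in \<open>simp add: algebra_simps\<close>)

lemma scaleR_scaleC: "r *\<^sub>R (x :: ell2) = complex_of_real r *\<^sub>C x"
  by transfer simp

lemma cinner_self_sums: "(\<lambda>i. (cmod (ell2_nth x i))\<^sup>2) sums Re (cinner x x)"
  using sums_Re[OF cinner_sums[of x x]]
  by (simp add: complex_mult_cnj cmod_power2)

instantiation ell2 :: real_inner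
begin

definition inner_ell2 :: "ell2 \<Rightarrow> ell2 \<Rightarrow> real" where
  "inner_ell2 x y = Re (cinner x y)"
definition norm_ell2 :: "ell2 \<Rightarrow> real" where
  "norm_ell2 x = sqrt (inner x x)"
definition dist_ell2 :: "ell2 \<Rightarrow> ell2 \<Rightarrow> real" where
  "dist_ell2 x y = norm (x - y)"
definition sgn_ell2 :: "ell2 \<Rightarrow> ell2" where
  "sgn_ell2 x = x /\<^sub>R norm x"
definition uniformity_ell2 :: "(ell2 \<times> ell2) filter" where
  "uniformity_ell2 = (INF e\<in>{0<..}. principal {(x, y). dist x y < e})"
definition open_ell2 :: "ell2 set \<Rightarrow> bool" where
  "open_ell2 U = (\<forall>x\<in>U. eventually (\<lambda>(x', y). x' = x \<longrightarrow> y \<in> U) uniformity)"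

instance
proof
  fix x y z :: ell2 and r :: real
  show "inner x y = inner y x"
    unfolding inner_ell2_def by (subst cinner_commute) simp
  show "inner (x + y) z = inner x z + inner y z"
    by (simp add: inner_ell2_def cinner_add_left)
  show "inner (r *\<^sub>R x) y = r * inner x y"
    by (simp add: inner_ell2_def scaleR_scaleC cinner_scaleC_left)
  show "0 \<le> inner x x"
    unfolding inner_ell2_def sums_unique[OF cinner_self_sums]
    by (intro suminf_nonneg summable_ell2) simp
  show "inner x x = 0 \<longleftrightarrow> x = 0"
    unfolding inner_ell2_def sums_unique[OF cinner_self_sums]
    by (subst suminf_eq_zero_iff[OF summable_ell2])
      (auto intro!: ell2_eqI simp: zero_ell2.rep_eq)
qed (simp_all add: norm_ell2_def dist_ell2_def sgn_ell2_def uniformity_ell2_def open_ell2_def)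

end

lemma norm_ell2_sums: "(\<lambda>i. (cmod (ell2_nth x i))\<^sup>2) sums (norm x)\<^sup>2"
  using cinner_self_sums[of x] by (simp add: power2_norm_eq_inner inner_ell2_def)

lemma sum_cmod_le_norm_ell2: "(\<Sum>i<k. (cmod (ell2_nth x i))\<^sup>2) \<le> (norm x)\<^sup>2"
  using sum_le_suminf[OF summable_ell2[of x], of "{..<k}"] sums_unique[OF norm_ell2_sums[of x]]
  by simp

lemma cmod_ell2_nth_le: "cmod (ell2_nth x i) \<le> norm x"
proof (rule power2_le_imp_le)
  have "(cmod (ell2_nth x i))\<^sup>2 \<le> (\<Sum>j<Suc i. (cmod (ell2_nth x j))\<^sup>2)"
    by (rule member_le_sum) auto
  then show "(cmod (ell2_nth x i))\<^sup>2 \<le> (norm x)\<^sup>2"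
    using sum_cmod_le_norm_ell2 order_trans by blast
qed simp

instance ell2 :: complete_space
proof
  fix X :: "nat \<Rightarrow> ell2"
  assume X: "Cauchy X"
  have "Cauchy (\<lambda>n. ell2_nth (X n) i)" for i
  proof (rule metric_CauchyI)
    fix e :: real assume "e > 0"
    then obtain N where N: "\<And>m n. m \<ge> N \<Longrightarrow> n \<ge> N \<Longrightarrow> dist (X m) (X n) < e"
      using metric_CauchyD[OF X] by blast
    have "dist (ell2_nth (X m) i) (ell2_nth (X n) i) < e" if "m \<ge> N" "n \<ge> N" for m n
      using N[OF that] cmod_ell2_nth_le[of "X m - X n" i]
      by (simp add: dist_norm minus_ell2.rep_eq)
    then show "\<exists>M. \<forall>m\<ge>M. \<forall>n\<ge>M. dist (ell2_nth (X m) i) (ell2_nth (X n) i) < e"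
      by blast
  qed
  then have "\<forall>i. \<exists>l. (\<lambda>n. ell2_nth (X n) i) \<longlonglongrightarrow> l"
    by (simp add: Cauchy_convergent_iff convergent_def)
  then obtain y where y: "\<And>i. (\<lambda>n. ell2_nth (X n) i) \<longlonglongrightarrow> y i"
    by metis
  have key: "(\<Sum>i<k. (cmod (ell2_nth (X m) i - y i))\<^sup>2) \<le> e\<^sup>2"
    if e: "\<And>n. n \<ge> N \<Longrightarrow> dist (X m) (X n) < e" for e N m k
  proof (rule LIMSEQ_le_const2)
    show "(\<lambda>n. \<Sum>i<k. (cmod (ell2_nth (X m) i - ell2_nth (X n) i))\<^sup>2)
        \<longlonglongrightarrow> (\<Sum>i<k. (cmod (ell2_nth (X m) i - y i))\<^sup>2)"
      by (intro tendsto_intros y)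
    have "(\<Sum>i<k. (cmod (ell2_nth (X m) i - ell2_nth (X n) i))\<^sup>2) \<le> e\<^sup>2" if "n \<ge> N" for n
    proof -
      have "(norm (X m - X n))\<^sup>2 \<le> e\<^sup>2"
        using e[OF that] by (intro power_mono) (auto simp: dist_norm)
      then show ?thesis
        using sum_cmod_le_norm_ell2[where x = "X m - X n" and k = k]
        by (simp add: minus_ell2.rep_eq)
    qed
    then show "\<exists>N. \<forall>n\<ge>N. (\<Sum>i<k. (cmod (ell2_nth (X m) i - ell2_nth (X n) i))\<^sup>2) \<le> e\<^sup>2"
      by blast
  qed
  have summ: "summable (\<lambda>i. (cmod (ell2_nth (X m) i - y i))\<^sup>2)"
    if "\<And>n. n \<ge> N \<Longrightarrow> dist (X m) (X n) < e" for e N m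
  proof (rule bounded_imp_summable)
    show "(\<Sum>i\<le>k. (cmod (ell2_nth (X m) i - y i))\<^sup>2) \<le> e\<^sup>2" for k
      unfolding lessThan_Suc_atMost[symmetric] by (rule key) (rule that)
  qed simp
  obtain N0 where N0: "\<And>m n. m \<ge> N0 \<Longrightarrow> n \<ge> N0 \<Longrightarrow> dist (X m) (X n) < 1"
    using metric_CauchyD[OF X, of 1] by auto
  have "summable (\<lambda>i. (cmod (ell2_nth (X N0) i + (-1) * (ell2_nth (X N0) i - y i)))\<^sup>2)"
    by (intro summable_sq_add summable_ell2 summable_sq_scale summ[of N0 N0 1] N0) auto
  then have "y \<in> {x. summable (\<lambda>i. (cmod (x i))\<^sup>2)}"
    by simp
  then obtain z where z: "ell2_nth z = y"
    by (metis Abs_ell2_inverse)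
  have "X \<longlonglongrightarrow> z"
  proof (rule metric_LIMSEQ_I)
    fix r :: real assume "r > 0"
    then obtain N where N: "\<And>m n. m \<ge> N \<Longrightarrow> n \<ge> N \<Longrightarrow> dist (X m) (X n) < r / 2"
      using metric_CauchyD[OF X, of "r / 2"] by auto
    have "dist (X m) z < r" if m: "m \<ge> N" for m
    proof -
      have "(norm (X m - z))\<^sup>2 = (\<Sum>i. (cmod (ell2_nth (X m - z) i))\<^sup>2)"
        by (rule sums_unique[OF norm_ell2_sums])
      also have "\<dots> \<le> (r / 2)\<^sup>2"
      proof (intro suminf_le_const summable_ell2)
        show "(\<Sum>i<k. (cmod (ell2_nth (X m - z) i))\<^sup>2) \<le> (r / 2)\<^sup>2" for k
          unfolding minus_ell2.rep_eq z by (rule key) (rule N[OF m])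
      qed
      finally have "norm (X m - z) \<le> r / 2"
        by (rule power2_le_imp_le) (use \<open>r > 0\<close> in simp)
      then show ?thesis
        using \<open>r > 0\<close> by (simp add: dist_norm)
    qed
    then show "\<exists>no. \<forall>n\<ge>no. dist (X n) z < r" by blast
  qed
  then show "convergent X" by (rule convergentI)
qed


section \<open>Hilbert spaces and unitary representations\<close>

text \<open>
  Every separable complex Hilbert space is isometrically isomorphic to a closed subspace
  of \<open>ell2\<close>, so closed subspaces of \<open>ell2\<close> (which may be finite-dimensional or zero) serve as
  the separable Hilbert spaces over which the definitions below quantify.
\<close>

definition hilbert_subspace :: "ell2 set \<Rightarrow> bool" where
  "hilbert_subspace H \<longleftrightarrow> ell2.subspace H \<and> closed H"

definition hilbert_iso :: "ell2 set \<Rightarrow> ell2 set \<Rightarrow> (ell2 \<Rightarrow> ell2) \<Rightarrow> bool" where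
  "hilbert_iso H K T \<longleftrightarrow>
     bij_betw T H K \<and>
     (\<forall>x\<in>H. \<forall>y\<in>H. T (x + y) = T x + T y) \<and>
     (\<forall>c. \<forall>x\<in>H. T (c *\<^sub>C x) = c *\<^sub>C T x) \<and>
     (\<forall>x\<in>H. \<forall>y\<in>H. cinner (T x) (T y) = cinner x y)"

text \<open>
  The type class \<open>topological_group_add\<close> does not require commutativity, so arbitrary (non-abelian)
  topological groups are written additively: \<open>g + h\<close> is the product \<open>gh\<close>, \<open>- g\<close> the inverse and \<open>0\<close>
  the identity.
\<close>

definition unitary_rep :: "ell2 set \<Rightarrow> ('g :: topological_group_add \<Rightarrow> ell2 \<Rightarrow> ell2) \<Rightarrow> bool" where
  "unitary_rep H \<pi> \<longleftrightarrow>
     hilbert_subspace H \<and>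
     (\<forall>g. hilbert_iso H H (\<pi> g)) \<and>
     (\<forall>g h. \<forall>x\<in>H. \<pi> (g + h) x = \<pi> g (\<pi> h x)) \<and>
     (\<forall>x\<in>H. continuous_on UNIV (\<lambda>g. \<pi> g x))"

definition almost_invariant_vectors ::
    "ell2 set \<Rightarrow> ('g :: topological_group_add \<Rightarrow> ell2 \<Rightarrow> ell2) \<Rightarrow> bool" where
  "almost_invariant_vectors H \<pi> \<longleftrightarrow>
     (\<forall>K \<epsilon>. compact K \<and> \<epsilon> > 0 \<longrightarrow>
        (\<exists>x\<in>H. norm x = 1 \<and> (\<forall>k\<in>K. norm (\<pi> k x - x) < \<epsilon>)))"

definition kazhdan_property_T :: "'g :: topological_group_add itself \<Rightarrow> bool" where
  "kazhdan_property_T _ \<longleftrightarrow>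
     (\<forall>H (\<pi> :: 'g \<Rightarrow> ell2 \<Rightarrow> ell2).
        unitary_rep H \<pi> \<and> almost_invariant_vectors H \<pi> \<longrightarrow>
        (\<exists>x\<in>H. x \<noteq> 0 \<and> (\<forall>g. \<pi> g x = x)))"


section \<open>Group actions on standard Borel spaces\<close>

definition left_haar_measure :: "'g :: topological_group_add measure \<Rightarrow> bool" where
  "left_haar_measure \<mu> \<longleftrightarrow>
     sets \<mu> = sets borel \<and>
     emeasure \<mu> UNIV \<noteq> 0 \<and>
     (\<forall>K. compact K \<longrightarrow> emeasure \<mu> K < \<infinity>) \<and>
     (\<forall>g. distr \<mu> \<mu> (\<lambda>h. g + h) = \<mu>)"

definition standard_borel :: "'y measure \<Rightarrow> bool" where
  "standard_borel M \<longleftrightarrow>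
     (\<exists>X. completely_metrizable_space X \<and> second_countable X \<and>
          topspace X = space M \<and> sets M = sigma_sets (topspace X) {U. openin X U})"

definition conull :: "'y measure \<Rightarrow> 'y set \<Rightarrow> bool" where
  "conull M U \<longleftrightarrow> U \<in> sets M \<and> emeasure M (space M - U) = 0"

definition borel_G_space :: "'y measure \<Rightarrow> ('g :: topological_group_add \<Rightarrow> 'y \<Rightarrow> 'y) \<Rightarrow> bool" where
  "borel_G_space \<nu> act \<longleftrightarrow>
     standard_borel \<nu> \<and>
     (\<lambda>(g, y). act g y) \<in> measurable (borel \<Otimes>\<^sub>M \<nu>) \<nu> \<and>
     (\<forall>y\<in>space \<nu>. act 0 y = y) \<and>
     (\<forall>g h. \<forall>y\<in>space \<nu>. act (g + h) y = act g (act h y))"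

definition invariant_measure :: "'y measure \<Rightarrow> ('g \<Rightarrow> 'y \<Rightarrow> 'y) \<Rightarrow> bool" where
  "invariant_measure \<nu> act \<longleftrightarrow> (\<forall>g. distr \<nu> \<nu> (act g) = \<nu>)"

definition ergodic_action :: "'y measure \<Rightarrow> ('g \<Rightarrow> 'y \<Rightarrow> 'y) \<Rightarrow> bool" where
  "ergodic_action \<nu> act \<longleftrightarrow>
     (\<forall>A\<in>sets \<nu>. (\<forall>g. act g ` A = A) \<longrightarrow> emeasure \<nu> A = 0 \<or> conull \<nu> A)"


section \<open>Representations of the groupoid of an action, and property T of the action\<close>

text \<open>
  The Borel structure of the field \<open>H\<close> is given by a fundamental sequence of sections \<open>s\<close>; it is
  unrelated to the Borel structure of \<open>ell2\<close>.  Hence the fibres of an arbitrary Borel field of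
  separable Hilbert spaces may be embedded into \<open>ell2\<close> one at a time, with no measurability
  requirement on the choice of the embeddings, and no Borel field is excluded by
  taking the fibres inside \<open>ell2\<close>.
\<close>

definition borel_hilbert_field ::
    "'y measure \<Rightarrow> ('y \<Rightarrow> ell2 set) \<Rightarrow> (nat \<Rightarrow> 'y \<Rightarrow> ell2) \<Rightarrow> bool" where
  "borel_hilbert_field \<nu> H s \<longleftrightarrow>
     (\<forall>y\<in>space \<nu>. hilbert_subspace (H y)) \<and>
     (\<forall>n. \<forall>y\<in>space \<nu>. s n y \<in> H y) \<and>
     (\<forall>m n. (\<lambda>y. cinner (s m y) (s n y)) \<in> borel_measurable \<nu>) \<and>
     (\<forall>y\<in>space \<nu>. closure (ell2.span (range (\<lambda>n. s n y))) = H y)"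

definition borel_unit_section ::
    "'y measure \<Rightarrow> ('y \<Rightarrow> ell2 set) \<Rightarrow> (nat \<Rightarrow> 'y \<Rightarrow> ell2) \<Rightarrow> ('y \<Rightarrow> ell2) \<Rightarrow> bool" where
  "borel_unit_section \<nu> H s \<xi> \<longleftrightarrow>
     (\<forall>y\<in>space \<nu>. \<xi> y \<in> H y) \<and>
     (\<forall>n. (\<lambda>y. cinner (\<xi> y) (s n y)) \<in> borel_measurable \<nu>) \<and>
     (AE y in \<nu>. norm (\<xi> y) = 1)"

definition action_rep ::
    "'y measure \<Rightarrow> ('g :: topological_group_add \<Rightarrow> 'y \<Rightarrow> 'y) \<Rightarrow>
     ('y \<Rightarrow> ell2 set) \<Rightarrow> (nat \<Rightarrow> 'y \<Rightarrow> ell2) \<Rightarrow> ('y \<Rightarrow> 'g \<Rightarrow> ell2 \<Rightarrow> ell2) \<Rightarrow> bool" where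
  "action_rep \<nu> act H s L \<longleftrightarrow>
     borel_hilbert_field \<nu> H s \<and>
     (\<forall>y\<in>space \<nu>. \<forall>g. hilbert_iso (H (act (- g) y)) (H y) (L y g)) \<and>
     (\<forall>m n. (\<lambda>(y, g). cinner (L y g (s n (act (- g) y))) (s m y))
              \<in> borel_measurable (\<nu> \<Otimes>\<^sub>M borel)) \<and>
     (\<exists>U. conull \<nu> U \<and>
        (\<forall>y g h. y \<in> U \<and> act (- g) y \<in> U \<and> act (- (g + h)) y \<in> U \<longrightarrow>
           (\<forall>v \<in> H (act (- (g + h)) y). L y (g + h) v = L y g (L (act (- g) y) h v))))"

definition action_property_T ::
    "'y measure \<Rightarrow> 'g :: topological_group_add measure \<Rightarrow> ('g \<Rightarrow> 'y \<Rightarrow> 'y) \<Rightarrow> bool" where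
  "action_property_T \<nu> \<mu> act \<longleftrightarrow>
     (\<forall>H s L. action_rep \<nu> act H s L \<longrightarrow>
        (\<exists>\<xi> :: nat \<Rightarrow> 'y \<Rightarrow> ell2.
            (\<forall>n. borel_unit_section \<nu> H s (\<xi> n)) \<and>
            (AE (y, g) in \<nu> \<Otimes>\<^sub>M \<mu>.
               (\<lambda>n. norm (\<xi> n y - L y g (\<xi> n (act (- g) y)))) \<longlonglongrightarrow> 0)) \<longrightarrow>
        (\<exists>\<xi>. borel_unit_section \<nu> H s \<xi> \<and>
            (AE (y, g) in \<nu> \<Otimes>\<^sub>M \<mu>. \<xi> y = L y g (\<xi> (act (- g) y)))))"

end

theory Submission
  imports Defs "HOL-Library.Function_Algebras"
begin

text \<open>
  For (i), let \<open>G\<close> act on the square-integrable sections by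
  \<open>(\<pi> g f) y = L(y, g) f(g\<^sup>-\<^sup>1 y)\<close>.  This unitary representation is weakly measurable, hence
  strongly continuous by Pettis' theorem.  The displacements of \<open>\<xi>\<^sub>n\<close> tend to \<open>0\<close> for almost every
  \<open>g\<close>, hence for every \<open>g\<close> (a conull subgroup is everything), hence uniformly on compact sets (Baire).
  Property (T) gives an invariant section \<open>f \<noteq> 0\<close>; by ergodicity it vanishes almost nowhere, and
  \<open>f / \<parallel>f\<parallel>\<close> is the desired unit section.

  For (ii), suppose \<open>G\<close> fails (T).  Almost invariant vectors of a representation without invariant vectors
  assemble to an unbounded cocycle \<open>b\<close>.  The kernels \<open>exp(- \<parallel>b g - b h\<parallel>\<^sup>2 / k)\<close>, \<open>k \<ge> 1\<close>, define
  a representation \<open>\<sigma>\<close> that has almost invariant vectors and satisfies \<open>\<sigma>(a\<^sub>j) \<rightarrow> 0\<close> weakly whenever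
  \<open>\<parallel>b a\<^sub>j\<parallel> \<rightarrow> \<infinity>\<close>.  Property T of the action, applied to the constant field with \<open>L(y, g) = \<sigma> g\<close>, yields
  a unit section with \<open>\<xi>(y) = \<sigma>(g) \<xi>(g\<^sup>-\<^sup>1 y)\<close>; as \<open>\<nu>\<close> is finite and invariant, \<open>\<xi>\<close> is close to finitely
  many vectors on a set of more than half the measure, which contradicts mixing of \<open>\<sigma>\<close>.
\<close>

section \<open>Sequence-space preliminaries\<close>

text \<open>In (i), property (T) speaks of closed subspaces of \<open>ell2\<close>, while
  square-integrable sections are functions with a degenerate inner product, and \<open>L\<close> is
  multiplicative only on a conull reduction. Gram-Schmidt coefficients with respect to a countable
  total family settle both: they map the sections isometrically onto a closed subspace of
  \<open>ell2\<close> and identify sections that agree almost everywhere, so identities valid off a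
  null set become exact. In (ii), the constant field of the given representation would not do. An
  invariant section is an equivariant map from the space to the Hilbert space, and such maps can
  exist without invariant vectors: evaluation on a finite-dimensional invariant space of functions
  is equivariant into its dual. They are excluded as soon as all matrix coefficients tend to 0 along
  one sequence in the group, which is what the cocycle and its kernels provide. Hilbert spaces on
  that side are built as kernels: a family in \<open>ell2\<close> with prescribed inner products
  stands for a direct sum, a tensor product or a Fock space.\<close>

lemma cinner_add_right: "cinner x (y + z) = cinner x y + cinner x z"
  by (metis cinner_add_left cinner_commute complex_cnj_add)

lemma cinner_scaleC_right: "cinner x (c *\<^sub>C y) = cnj c * cinner x y"
  by (metis cinner_commute cinner_scaleC_left complex_cnj_mult)

lemma cinner_zero [simp]: "cinner 0 y = 0" "cinner x 0 = 0"
  by (simp_all add: cinner_def zero_ell2.rep_eq)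

lemma cinner_minus_left: "cinner (- x) y = - cinner x y"
  using cinner_add_left[of x "- x" y] by (simp add: eq_neg_iff_add_eq_0 add.commute)

lemma cinner_minus_right: "cinner x (- y) = - cinner x y"
  by (metis cinner_commute cinner_minus_left complex_cnj_minus)

lemma cinner_diff_left: "cinner (x - y) z = cinner x z - cinner y z"
  using cinner_add_left[of x "- y" z] by (simp add: cinner_minus_left)

lemma cinner_diff_right: "cinner x (y - z) = cinner x y - cinner x z"
  using cinner_add_right[of x y "- z"] by (simp add: cinner_minus_right)

lemma Re_cinner_self: "Re (cinner x x) = (norm x)\<^sup>2"
  by (simp add: power2_norm_eq_inner inner_ell2_def)

lemma cinner_self: "cinner x x = complex_of_real ((norm x)\<^sup>2)"
proof (rule complex_eqI)
  have "Im (cinner x x) = - Im (cinner x x)"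
    by (metis cinner_commute complex_cnj_cnj cnj.simps(2))
  then show "Im (cinner x x) = Im (complex_of_real ((norm x)\<^sup>2))" by simp
qed (simp add: Re_cinner_self)

lemma norm_diff_sq: "(norm (x - y))\<^sup>2 = (norm x)\<^sup>2 + (norm y)\<^sup>2 - 2 * Re (cinner x y)"
  by (simp add: Re_cinner_self[symmetric] cinner_diff_left cinner_diff_right)
    (subst cinner_commute[of y x], simp)

lemma norm_scaleC: "norm (c *\<^sub>C x) = cmod c * norm x"
proof -
  have "(norm (c *\<^sub>C x))\<^sup>2 = Re (c * cnj c * cinner x x)"
    unfolding Re_cinner_self[symmetric] cinner_scaleC_left cinner_scaleC_right
    by (simp add: mult.assoc mult.left_commute)
  also have "\<dots> = (cmod c * norm x)\<^sup>2"
    by (simp add: cinner_self complex_mult_cnj cmod_power2 power_mult_distrib)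
  finally have "(norm (c *\<^sub>C x))\<^sup>2 = (cmod c * norm x)\<^sup>2" .
  then show ?thesis by simp
qed

lemma cinner_bound: "cmod (cinner x y) \<le> norm x * norm y"
proof (cases "cinner x y = 0")
  case False
  define c where "c = cnj (cinner x y) / cmod (cinner x y)"
  have c: "cmod c = 1" using False by (simp add: c_def norm_divide)
  have "cinner (c *\<^sub>C x) y = cmod (cinner x y)"
    using False by (simp add: c_def cinner_scaleC_left complex_norm_square[symmetric] power2_eq_square
        mult.commute)
  then have "cmod (cinner x y) = inner (c *\<^sub>C x) y" by (simp add: inner_ell2_def)
  also have "\<dots> \<le> norm (c *\<^sub>C x) * norm y" by (rule norm_cauchy_schwarz)
  finally show ?thesis by (simp add: norm_scaleC c)
qed simp

lemma tendsto_cinner: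
  assumes "(f \<longlongrightarrow> a) F" "(g \<longlongrightarrow> b) F"
  shows "((\<lambda>x. cinner (f x) (g x)) \<longlongrightarrow> cinner a b) F"
proof -
  have bd: "bounded_bilinear cinner"
  proof
    show "\<exists>K. \<forall>a b. norm (cinner a b) \<le> norm a * norm b * K"
      by (rule exI[of _ 1]) (simp add: cinner_bound)
  qed (simp_all add: cinner_add_left cinner_add_right scaleR_scaleC cinner_scaleC_left
      cinner_scaleC_right scaleR_conv_of_real)
  show ?thesis by (rule bounded_bilinear.tendsto[OF bd assms])
qed

lemma tendsto_scaleC:
  assumes "(f \<longlongrightarrow> a) F" "(g \<longlongrightarrow> b) F"
  shows "((\<lambda>x. f x *\<^sub>C g x) \<longlongrightarrow> a *\<^sub>C b) F"
proof -
  have bd: "bounded_bilinear scaleC"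
  proof
    show "\<exists>K. \<forall>a b. norm (a *\<^sub>C b) \<le> norm a * norm b * K"
      by (rule exI[of _ 1]) (simp add: norm_scaleC)
  qed (simp_all add: ell2.scale_left_distrib ell2.scale_right_distrib scaleR_scaleC
      scaleR_conv_of_real mult.commute)
  show ?thesis by (rule bounded_bilinear.tendsto[OF bd assms])
qed

section \<open>Closed subspaces and separability of \<open>ell2\<close>\<close>

lemma hilbert_subspaceD:
  assumes "hilbert_subspace H"
  shows "0 \<in> H" "x \<in> H \<Longrightarrow> y \<in> H \<Longrightarrow> x + y \<in> H" "x \<in> H \<Longrightarrow> c *\<^sub>C x \<in> H"
    "x \<in> H \<Longrightarrow> y \<in> H \<Longrightarrow> x - y \<in> H" "x \<in> H \<Longrightarrow> r *\<^sub>R x \<in> H"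
    "(\<And>n. X n \<in> H) \<Longrightarrow> X \<longlonglongrightarrow> x \<Longrightarrow> x \<in> H"
  using assms unfolding hilbert_subspace_def scaleR_scaleC
  by (auto intro: ell2.subspace_0 ell2.subspace_add ell2.subspace_scale ell2.subspace_diff
      closed_sequentially)

abbreviation closed_span :: "ell2 set \<Rightarrow> ell2 set" where
  "closed_span A \<equiv> closure (ell2.span A)"

lemma mult_le_sum_squares:
  fixes a b :: real
  assumes "0 \<le> a" "0 \<le> b"
  shows "a * b \<le> a\<^sup>2 + b\<^sup>2"
  using sum_squares_bound[of a b] mult_nonneg_nonneg[OF assms] by linarith

lemma closure_subspace_ell2:
  assumes "ell2.subspace S"
  shows "hilbert_subspace (closure S)"
  unfolding hilbert_subspace_def
proof
  show "ell2.subspace (closure S)"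
    unfolding ell2.subspace_def
  proof safe
    show "0 \<in> closure S" using ell2.subspace_0[OF assms] closure_subset by blast
  next
    fix x y assume "x \<in> closure S" "y \<in> closure S"
    then obtain X Y where "\<And>n. X n \<in> S" "X \<longlonglongrightarrow> x" "\<And>n. Y n \<in> S" "Y \<longlonglongrightarrow> y"
      by (meson closure_sequential)
    then show "x + y \<in> closure S"
      unfolding closure_sequential
      by (intro exI[of _ "\<lambda>n. X n + Y n"])
        (auto intro: tendsto_intros ell2.subspace_add[OF assms])
  next
    fix c x assume "x \<in> closure S"
    then obtain X where "\<And>n. X n \<in> S" "X \<longlonglongrightarrow> x"
      by (meson closure_sequential)
    then show "c *\<^sub>C x \<in> closure S"
      unfolding closure_sequential
      by (intro exI[of _ "\<lambda>n. c *\<^sub>C X n"])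
        (auto intro: tendsto_intros tendsto_scaleC ell2.subspace_scale[OF assms])
  qed
qed simp

lemma cinner_closure_span_eq_0:
  assumes "\<And>v. v \<in> A \<Longrightarrow> cinner x v = 0" "y \<in> closed_span A"
  shows "cinner x y = 0"
proof -
  have sp: "cinner x w = 0" if "w \<in> ell2.span A" for w
    using that
    by (induction rule: ell2.span_induct_alt)
      (simp_all add: cinner_add_right cinner_scaleC_right assms)
  obtain X where X: "\<And>n. X n \<in> ell2.span A" "X \<longlonglongrightarrow> y"
    using assms(2) by (meson closure_sequential)
  have "(\<lambda>n. cinner x (X n)) \<longlonglongrightarrow> cinner x y"
    by (intro tendsto_cinner X tendsto_const)
  then show ?thesis by (simp add: sp X(1) LIMSEQ_const_iff)
qed

text \<open>The dense set consists of the finitely supported vectors with rational real and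
  imaginary parts, coded by lists of pairs of rationals.\<close>

lemma ell2_countable_dense:
  "\<exists>Q :: ell2 set. countable Q \<and> (\<forall>x. \<forall>e>0. \<exists>q\<in>Q. dist x q < e)"
proof -
  define f where "f l i = (if i < length l
      then Complex (of_rat (fst (l ! i))) (of_rat (snd (l ! i))) else 0)" for l i
  have ev: "summable (\<lambda>i. (cmod (f l i))\<^sup>2)" for l
    by (rule summable_finite[of "{..<length l}"]) (auto simp: f_def)
  then have nthf: "ell2_nth (Abs_ell2 (f l)) = f l" for l
    by (simp add: Abs_ell2_inverse)
  show ?thesis
  proof (intro exI[of _ "range (\<lambda>l. Abs_ell2 (f l))"] conjI allI impI)
    fix x :: ell2 and e :: real assume e: "e > 0"
    have "(\<lambda>n. \<Sum>i. (cmod (ell2_nth x (i + n)))\<^sup>2) \<longlonglongrightarrow> 0"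
      by (rule suminf_exist_split2[OF summable_ell2])
    then have "eventually (\<lambda>n. (\<Sum>i. (cmod (ell2_nth x (i + n)))\<^sup>2) < e\<^sup>2 / 2) sequentially"
      by (rule order_tendstoD) (use e in simp)
    then obtain N where N: "(\<Sum>i. (cmod (ell2_nth x (i + N)))\<^sup>2) < e\<^sup>2 / 2"
      by (auto simp: eventually_sequentially)
    \<comment> \<open>Each of the first \<open>N\<close> coordinates is allowed the error
      \<open>2 * d\<^sup>2 = e\<^sup>2 / (2 * (N + 1))\<close>. Together they cost at most half of
      \<open>e\<^sup>2\<close>, and the tail costs less than the other half; \<open>+ 1\<close>
      covers \<open>N = 0\<close>.\<close>
    define d where "d = e / (2 * sqrt (real N + 1))"
    have d: "d > 0" using e by (simp add: d_def)
    have d2: "2 * d\<^sup>2 = e\<^sup>2 / (2 * (real N + 1))"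
      by (simp add: d_def power_divide power_mult_distrib) (simp add: divide_simps)
    have "\<exists>p :: rat \<times> rat. (cmod (z - Complex (of_rat (fst p)) (of_rat (snd p))))\<^sup>2 \<le> 2 * d\<^sup>2" for z
    proof -
      obtain a where a: "Re z - d < of_rat a" "of_rat a < Re z + d"
        using of_rat_dense[of "Re z - d" "Re z + d"] d by auto
      obtain b where b: "Im z - d < of_rat b" "of_rat b < Im z + d"
        using of_rat_dense[of "Im z - d" "Im z + d"] d by auto
      have "(Re z - of_rat a)\<^sup>2 \<le> d\<^sup>2" "(Im z - of_rat b)\<^sup>2 \<le> d\<^sup>2"
        using a b by (auto simp: abs_le_square_iff[symmetric])
      then show ?thesis
        by (intro exI[of _ "(a, b)"]) (simp add: cmod_power2)
    qed
    then obtain p where p: "\<And>z. (cmod (z - Complex (of_rat (fst (p z))) (of_rat (snd (p z)))))\<^sup>2 \<le> 2 * d\<^sup>2"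
      by metis
    define l where "l = map (\<lambda>i. p (ell2_nth x i)) [0..<N]"
    let ?g = "\<lambda>i. (cmod (ell2_nth (x - Abs_ell2 (f l)) i))\<^sup>2"
    have "(norm (x - Abs_ell2 (f l)))\<^sup>2 = (\<Sum>i. ?g i)"
      by (rule sums_unique[OF norm_ell2_sums])
    also have "\<dots> = (\<Sum>i. ?g (i + N)) + (\<Sum>i<N. ?g i)"
      by (rule suminf_split_initial_segment[OF summable_ell2])
    also have "(\<Sum>i. ?g (i + N)) = (\<Sum>i. (cmod (ell2_nth x (i + N)))\<^sup>2)"
      by (simp add: minus_ell2.rep_eq nthf f_def l_def)
    also have "(\<Sum>i<N. ?g i) \<le> (\<Sum>i<N. 2 * d\<^sup>2)"
      by (rule sum_mono) (use p in \<open>simp add: minus_ell2.rep_eq nthf f_def l_def\<close>)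
    also have "\<dots> = real N * (e\<^sup>2 / (2 * (real N + 1)))"
      using d2 by simp
    also have "\<dots> \<le> e\<^sup>2 / 2"
      using e by (simp add: field_simps)
    finally have "(norm (x - Abs_ell2 (f l)))\<^sup>2 < e\<^sup>2" using N by simp
    then have "dist x (Abs_ell2 (f l)) < e"
      unfolding dist_norm using e by (simp add: power2_less_imp_less)
    then show "\<exists>q\<in>range (\<lambda>l. Abs_ell2 (f l)). dist x q < e" by blast
  qed simp
qed

text \<open>A countable dense set of \<open>ell2\<close> may miss \<open>H\<close> altogether. Each
  of its points within \<open>e / 2\<close> of \<open>H\<close> is therefore replaced by a point of
  \<open>H\<close> that close, which doubles the error.\<close>

lemma ell2_countable_net:
  fixes H :: "ell2 set"
  assumes "e > 0"
  obtains D where "countable D" "D \<subseteq> H" "\<And>x. x \<in> H \<Longrightarrow> \<exists>d\<in>D. norm (x - d) < e"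
proof -
  from ell2_countable_dense obtain Q :: "ell2 set"
    where "countable Q \<and> (\<forall>x. \<forall>e>0. \<exists>q\<in>Q. dist x q < e)" ..
  then have Q: "countable Q" "\<And>x e. e > 0 \<Longrightarrow> \<exists>q\<in>Q. dist x q < e" by auto
  define P where "P = {q\<in>Q. \<exists>h\<in>H. dist h q < e / 2}"
  define c where "c q = (SOME h. h \<in> H \<and> dist h q < e / 2)" for q
  have c: "c q \<in> H \<and> dist (c q) q < e / 2" if "q \<in> P" for q
    unfolding c_def by (rule someI_ex) (use that in \<open>auto simp: P_def\<close>)
  show thesis
  proof (rule that[of "c ` P"])
    show "countable (c ` P)" using Q(1) by (auto simp: P_def)
    show "c ` P \<subseteq> H" using c by auto
    fix x assume "x \<in> H"
    obtain q where q: "q \<in> Q" "dist x q < e / 2" using Q(2)[of "e/2" x] assms by auto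
    then have "q \<in> P" using \<open>x \<in> H\<close> by (auto simp: P_def)
    moreover have "dist x (c q) < e"
      using q(2) c[OF \<open>q \<in> P\<close>] by (metis dist_commute dist_triangle_half_r)
    ultimately show "\<exists>d\<in>c ` P. norm (x - d) < e" by (auto simp: dist_norm)
  qed
qed

lemma cmod_sq_cnj: "z * cnj z = (complex_of_real (cmod z))\<^sup>2"
  by (simp add: complex_norm_square[symmetric])

section \<open>Gram-Schmidt in complete semi-inner product spaces\<close>

text \<open>Positivity without definiteness: a section that vanishes almost everywhere has length 0
  without being 0. The carrier \<open>S\<close> is there because the square-integrable sections form
  only a subspace of the type of all functions, and \<open>ip\<close> is controlled only on
  it.\<close>

locale semi_inner = vector_space scale
  for scale :: "complex \<Rightarrow> 'v \<Rightarrow> 'v :: ab_group_add" +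
  fixes S :: "'v set" and ip :: "'v \<Rightarrow> 'v \<Rightarrow> complex"
  assumes subspace_S: "subspace S"
    and ip_add_left: "x \<in> S \<Longrightarrow> y \<in> S \<Longrightarrow> z \<in> S \<Longrightarrow> ip (x + y) z = ip x z + ip y z"
    and ip_scale_left: "x \<in> S \<Longrightarrow> z \<in> S \<Longrightarrow> ip (scale c x) z = c * ip x z"
    and ip_commute: "x \<in> S \<Longrightarrow> y \<in> S \<Longrightarrow> ip x y = cnj (ip y x)"
    and ip_nonneg: "x \<in> S \<Longrightarrow> 0 \<le> Re (ip x x)"
begin

abbreviation "sqnorm x \<equiv> Re (ip x x)"

lemmas S_add = subspace_add[OF subspace_S]
lemmas S_scale = subspace_scale[OF subspace_S]
lemmas S_diff = subspace_diff[OF subspace_S]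
lemmas S_0 = subspace_0[OF subspace_S]
lemmas S_sum = subspace_sum[OF subspace_S]

lemma ip_add_right: "x \<in> S \<Longrightarrow> y \<in> S \<Longrightarrow> z \<in> S \<Longrightarrow> ip x (y + z) = ip x y + ip x z"
  by (metis S_add ip_add_left ip_commute complex_cnj_add)

lemma ip_scale_right: "x \<in> S \<Longrightarrow> y \<in> S \<Longrightarrow> ip x (scale c y) = cnj c * ip x y"
  by (metis S_scale ip_scale_left ip_commute complex_cnj_mult)

lemma ip_zero_left: "x \<in> S \<Longrightarrow> ip 0 x = 0"
  using ip_scale_left[of 0 x 0] S_0 by simp

lemma ip_zero_right: "x \<in> S \<Longrightarrow> ip x 0 = 0"
  using ip_commute[of x 0] S_0 by (simp add: ip_zero_left)

lemma ip_diff_left: "x \<in> S \<Longrightarrow> y \<in> S \<Longrightarrow> z \<in> S \<Longrightarrow> ip (x - y) z = ip x z - ip y z"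
  using ip_add_left[of "x - y" y z] S_diff[of x y] by simp

lemma ip_diff_right: "x \<in> S \<Longrightarrow> y \<in> S \<Longrightarrow> z \<in> S \<Longrightarrow> ip x (y - z) = ip x y - ip x z"
  using ip_add_right[of x "y - z" z] S_diff[of y z] by simp

lemma ip_sum_left:
  "(\<And>i. i \<in> I \<Longrightarrow> f i \<in> S) \<Longrightarrow> z \<in> S \<Longrightarrow> ip (sum f I) z = (\<Sum>i\<in>I. ip (f i) z)"
  by (induction I rule: infinite_finite_induct) (auto simp: ip_zero_left ip_add_left S_sum)

lemma ip_sum_right:
  "(\<And>i. i \<in> I \<Longrightarrow> f i \<in> S) \<Longrightarrow> z \<in> S \<Longrightarrow> ip z (sum f I) = (\<Sum>i\<in>I. ip z (f i))"
  by (induction I rule: infinite_finite_induct) (auto simp: ip_zero_right ip_add_right S_sum)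

lemma ip_self: "x \<in> S \<Longrightarrow> ip x x = complex_of_real (sqnorm x)"
  by (metis Reals_cnj_iff complex_is_Real_iff complex_eq_iff Re_complex_of_real Im_complex_of_real ip_commute)

text \<open>The degenerate case of the Cauchy-Schwarz inequality: if \<open>y\<close> has length 0,
  the square norm of \<open>x + scale c y\<close> is real-affine in \<open>c\<close>, and being
  nonnegative it must be constant.\<close>

lemma ip_self_zero_left:
  assumes "x \<in> S" "y \<in> S" "sqnorm y = 0"
  shows "ip y x = 0"
proof (rule ccontr)
  assume n: "ip y x \<noteq> 0"
  define a where "a = (cmod (ip y x))\<^sup>2"
  have a: "a > 0" using n by (simp add: a_def)
  \<comment> \<open>With this \<open>t\<close> the square norm of \<open>x + scale ?c y\<close>
    would be \<open>- sqnorm x - 2\<close>.\<close>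
  define t where "t = (sqnorm x + 1) / a"
  let ?c = "- complex_of_real t * cnj (ip y x)"
  have xy: "ip x y = cnj (ip y x)" using ip_commute assms by blast
  have yy: "ip y y = 0" using ip_self[OF assms(2)] assms(3) by simp
  have "ip (x + scale ?c y) (x + scale ?c y)
      = ip x x + cnj ?c * cnj (ip y x) + ?c * ip y x"
    using assms by (simp only: ip_add_left ip_add_right ip_scale_left ip_scale_right S_add S_scale xy yy)
      (simp add: algebra_simps)
  also have "\<dots> = ip x x - 2 * complex_of_real (t * a)"
    unfolding a_def using complex_norm_square[of "ip y x"] by (simp add: algebra_simps)
  finally have "sqnorm (x + scale ?c y) = sqnorm x - 2 * (t * a)"
    by simp
  moreover have "0 \<le> sqnorm (x + scale ?c y)"
    by (intro ip_nonneg S_add S_scale assms)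
  ultimately have "2 * (t * a) \<le> sqnorm x" by simp
  moreover have "t * a = sqnorm x + 1" using a by (simp add: t_def)
  ultimately show False using ip_nonneg[OF assms(1)] by simp
qed

text \<open>Gram-Schmidt without discarding or renumbering: as \<open>inverse 0 = 0\<close>, a
  residual of length 0 is normalised to the vector 0, so each member of the output has square norm 0
  or 1 and keeps the index of its input vector.\<close>

fun gs :: "(nat \<Rightarrow> 'v) \<Rightarrow> nat \<Rightarrow> 'v" where
  "gs d n = (let v = d n - (\<Sum>k<n. scale (ip (d n) (gs d k)) (gs d k))
     in scale (complex_of_real (inverse (sqrt (sqnorm v)))) v)"

declare gs.simps [simp del]

definition ip_complete :: bool where
  "ip_complete \<longleftrightarrow> (\<forall>F. (\<forall>n. F n \<in> S) \<and>
     (\<forall>e>0. \<exists>N. \<forall>m\<ge>N. \<forall>n\<ge>m. sqnorm (F n - F m) < e) \<longrightarrow>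
     (\<exists>f\<in>S. (\<lambda>n. sqnorm (F n - f)) \<longlonglongrightarrow> 0))"

lemma ip_completeD:
  assumes "ip_complete" "\<And>n. F n \<in> S"
    "\<forall>e>0. \<exists>N. \<forall>m\<ge>N. \<forall>n\<ge>m. sqnorm (F n - F m) < e"
  shows "\<exists>f. f \<in> S \<and> (\<lambda>n. sqnorm (F n - f)) \<longlonglongrightarrow> 0"
  using assms(1)[unfolded ip_complete_def, rule_format, of F] assms(2,3) by (simp add: Bex_def)

context
  fixes d :: "nat \<Rightarrow> 'v"
  assumes d: "\<And>n. d n \<in> S"
begin

abbreviation "gr n \<equiv> d n - (\<Sum>k<n. scale (ip (d n) (gs d k)) (gs d k))"

lemma gs_eq: "gs d n = scale (complex_of_real (inverse (sqrt (sqnorm (gr n))))) (gr n)"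
  by (subst gs.simps) (simp add: Let_def)

lemma gs_in_S: "gs d n \<in> S"
proof (induction n rule: less_induct)
  case (less n)
  then show ?case
    by (subst gs_eq) (intro S_scale S_diff S_sum d, auto)
qed

lemma gr_in_S: "gr n \<in> S"
  by (intro S_scale S_diff S_sum d gs_in_S)

lemma gs_in_span: "gs d n \<in> span (range d)"
proof (induction n rule: less_induct)
  case (less n)
  then show ?case
    by (subst gs_eq) (intro span_scale span_diff span_sum span_base[of "d n"], auto)
qed

lemma gs_self: "ip (gs d n) (gs d n) = (if sqnorm (gr n) = 0 then 0 else 1)"
proof -
  let ?r = "sqnorm (gr n)"
  have "ip (gs d n) (gs d n) = complex_of_real ((inverse (sqrt ?r))\<^sup>2 * ?r)"
    by (subst (1 2) gs_eq) (use gr_in_S[of n] ip_self[OF gr_in_S[of n]] in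
      \<open>simp add: ip_scale_left ip_scale_right S_scale power2_eq_square\<close>)
  then show ?thesis
    using ip_nonneg[OF gr_in_S[of n]] by (simp add: power_inverse)
qed

lemma gs_null: "sqnorm (gr n) = 0 \<Longrightarrow> gs d n = 0"
  by (subst gs_eq) simp

lemma gs_orth_less: "j < n \<Longrightarrow> ip (gs d n) (gs d j) = 0"
proof (induction n arbitrary: j rule: less_induct)
  case (less n)
  have orth: "ip (gs d k) (gs d j) = 0" if "k < n" "k \<noteq> j" for k
  proof (cases "k < j")
    case True
    then have "ip (gs d j) (gs d k) = 0" using less by simp
    then show ?thesis using ip_commute[OF gs_in_S gs_in_S] by (metis complex_cnj_zero)
  next
    case False
    then show ?thesis using less.IH[of k j] that by simp
  qed
  have "ip (gr n) (gs d j)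
      = ip (d n) (gs d j) - (\<Sum>k<n. ip (d n) (gs d k) * ip (gs d k) (gs d j))"
    by (simp add: ip_diff_left S_sum d gs_in_S S_scale ip_sum_left ip_scale_left)
  also have "(\<Sum>k<n. ip (d n) (gs d k) * ip (gs d k) (gs d j))
      = (\<Sum>k<n. if k = j then ip (d n) (gs d j) * ip (gs d j) (gs d j) else 0)"
    by (rule sum.cong) (auto simp: orth)
  also have "\<dots> = ip (d n) (gs d j) * ip (gs d j) (gs d j)"
    using less.prems by simp
  also have "\<dots> = ip (d n) (gs d j)"
    using gs_self[of j] gs_null[of j] by (auto simp: ip_zero_right d)
  finally show ?case
    by (subst gs_eq) (simp add: ip_scale_left gr_in_S gs_in_S)
qed

lemma gs_orth: "j \<noteq> k \<Longrightarrow> ip (gs d j) (gs d k) = 0"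
  using gs_orth_less[of j k] gs_orth_less[of k j] ip_commute[OF gs_in_S gs_in_S]
  by (metis complex_cnj_zero linorder_neqE_nat)

lemma ip_gs_self: "x \<in> S \<Longrightarrow> ip x (gs d k) * ip (gs d k) (gs d k) = ip x (gs d k)"
  using gs_self[of k] gs_null[of k] by (auto simp: ip_zero_right)

text \<open>The residual \<open>gr n\<close> may be a nonzero vector of length \<open>0\<close>; then \<open>gs d n = 0\<close>.\<close>

lemma orth_gs_imp_orth:
  assumes "x \<in> S" "\<And>k. ip x (gs d k) = 0"
  shows "ip x (d n) = 0"
proof -
  have "ip x (gr n) = 0"
  proof (cases "sqnorm (gr n) = 0")
    case True
    then have "ip (gr n) x = 0" by (intro ip_self_zero_left assms gr_in_S)
    then show ?thesis using ip_commute[OF assms(1) gr_in_S] by (metis complex_cnj_zero)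
  next
    case False
    then have "gr n = scale (complex_of_real (sqrt (sqnorm (gr n)))) (gs d n)"
      using ip_nonneg[OF gr_in_S[of n]] by (subst (2) gs_eq) simp
    then have "ip x (gr n) = ip x (scale (complex_of_real (sqrt (sqnorm (gr n)))) (gs d n))"
      by (rule arg_cong)
    then show ?thesis using assms by (simp add: ip_scale_right gs_in_S)
  qed
  moreover have "ip x (gr n) = ip x (d n) - (\<Sum>k<n. cnj (ip (d n) (gs d k)) * ip x (gs d k))"
    by (simp add: ip_diff_right S_sum d gs_in_S S_scale ip_sum_right ip_scale_right assms(1))
  ultimately show ?thesis using assms by simp
qed

section \<open>Orthogonal projections, the Bessel inequality and the Parseval identity\<close>

definition pr :: "'v \<Rightarrow> nat \<Rightarrow> 'v" where
  "pr x n = (\<Sum>k<n. scale (ip x (gs d k)) (gs d k))"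

lemma pr_in_S: "pr x n \<in> S"
  unfolding pr_def by (intro S_sum S_scale gs_in_S)

text \<open>Arbitrary finite index sets are allowed so that the computation serves the projections
  \<open>pr x n\<close> as well as the difference of two of them.\<close>

lemma ip_block:
  assumes "x \<in> S" "finite I"
  shows "ip (\<Sum>k\<in>I. scale (ip x (gs d k)) (gs d k)) (gs d j) = (if j \<in> I then ip x (gs d j) else 0)"
proof -
  have "ip (\<Sum>k\<in>I. scale (ip x (gs d k)) (gs d k)) (gs d j)
      = (\<Sum>k\<in>I. ip x (gs d k) * ip (gs d k) (gs d j))"
    by (simp add: ip_sum_left S_scale gs_in_S ip_scale_left)
  also have "\<dots> = (\<Sum>k\<in>I. if k = j then ip x (gs d j) else 0)"
    by (rule sum.cong) (auto simp: gs_orth ip_gs_self[OF assms(1)])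
  finally show ?thesis using assms by simp
qed

lemma ip_block_self:
  assumes "x \<in> S" "finite I"
  shows "sqnorm (\<Sum>k\<in>I. scale (ip x (gs d k)) (gs d k))
    = (\<Sum>k\<in>I. (cmod (ip x (gs d k)))\<^sup>2)"
proof -
  let ?p = "\<Sum>k\<in>I. scale (ip x (gs d k)) (gs d k)"
  have p: "?p \<in> S" by (intro S_sum S_scale gs_in_S)
  have "ip ?p ?p = (\<Sum>k\<in>I. cnj (ip x (gs d k)) * ip ?p (gs d k))"
    by (subst ip_sum_right) (simp_all add: p S_scale gs_in_S ip_scale_right)
  also have "\<dots> = (\<Sum>k\<in>I. complex_of_real ((cmod (ip x (gs d k)))\<^sup>2))"
    by (rule sum.cong) (simp_all add: ip_block assms cmod_sq_cnj mult.commute)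
  finally show ?thesis by simp
qed

lemma ip_pr: "x \<in> S \<Longrightarrow> j < n \<Longrightarrow> ip (pr x n) (gs d j) = ip x (gs d j)"
  unfolding pr_def by (simp add: ip_block)

lemma ip_pr_pr: "x \<in> S \<Longrightarrow> sqnorm (pr x n) = (\<Sum>k<n. (cmod (ip x (gs d k)))\<^sup>2)"
  unfolding pr_def by (simp add: ip_block_self)

lemma ip_pr_diff:
  assumes "x \<in> S" "m \<le> n"
  shows "sqnorm (pr x n - pr x m) = (\<Sum>k=m..<n. (cmod (ip x (gs d k)))\<^sup>2)"
proof -
  have "pr x n - pr x m = (\<Sum>k=m..<n. scale (ip x (gs d k)) (gs d k))"
    unfolding pr_def lessThan_atLeast0 by (rule sum_diff_nat_ivl) (use assms(2) in auto)
  then show ?thesis using assms by (simp add: ip_block_self)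
qed

lemma ip_residual:
  assumes "x \<in> S"
  shows "sqnorm (x - pr x n) = sqnorm x - (\<Sum>k<n. (cmod (ip x (gs d k)))\<^sup>2)"
proof -
  have "ip x (pr x n) = (\<Sum>k<n. cnj (ip x (gs d k)) * ip x (gs d k))"
    unfolding pr_def by (simp add: ip_sum_right S_scale gs_in_S ip_scale_right assms)
  also have "\<dots> = (\<Sum>k<n. complex_of_real ((cmod (ip x (gs d k)))\<^sup>2))"
    by (rule sum.cong) (simp_all add: cmod_sq_cnj mult.commute)
  finally have 1: "Re (ip x (pr x n)) = (\<Sum>k<n. (cmod (ip x (gs d k)))\<^sup>2)" by simp
  then have "Re (ip (pr x n) x) = (\<Sum>k<n. (cmod (ip x (gs d k)))\<^sup>2)"
    using ip_commute[OF assms pr_in_S] by simp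
  with 1 show ?thesis
    using ip_pr_pr[OF assms] by (simp add: ip_diff_left ip_diff_right S_diff assms pr_in_S)
qed

lemma bessel:
  assumes "x \<in> S"
  shows "(\<Sum>k<n. (cmod (ip x (gs d k)))\<^sup>2) \<le> sqnorm x"
  using ip_nonneg[OF S_diff[OF assms pr_in_S[of x n]]] ip_residual[OF assms, of n] by simp

lemma gs_coeff_le:
  assumes "x \<in> S"
  shows "(cmod (ip x (gs d j)))\<^sup>2 \<le> sqnorm x"
proof -
  have "(cmod (ip x (gs d j)))\<^sup>2 \<le> (\<Sum>k<Suc j. (cmod (ip x (gs d k)))\<^sup>2)"
    by (rule member_le_sum) auto
  also note bessel[OF assms]
  finally show ?thesis .
qed

lemma summable_gs:
  assumes "x \<in> S"
  shows "summable (\<lambda>k. (cmod (ip x (gs d k)))\<^sup>2)"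
proof (rule bounded_imp_summable)
  show "(\<Sum>k\<le>n. (cmod (ip x (gs d k)))\<^sup>2) \<le> sqnorm x" for n
    using bessel[OF assms, of "Suc n"] unfolding lessThan_Suc_atMost .
qed simp

text \<open>By the Bessel inequality the projections form a Cauchy sequence. Their limit has the
  same Gram-Schmidt coefficients as \<open>x\<close>, so the difference is orthogonal to every
  \<open>gs d k\<close> and hence to every \<open>d n\<close>.\<close>

lemma pr_limit:
  assumes "ip_complete" "x \<in> S"
  obtains f where "f \<in> S" "(\<lambda>n. sqnorm (pr x n - f)) \<longlonglongrightarrow> 0"
    "\<And>n. ip (x - f) (d n) = 0"
proof -
  have "\<forall>e>0. \<exists>N. \<forall>m\<ge>N. \<forall>n\<ge>m. sqnorm (pr x n - pr x m) < e"
  proof (intro allI impI)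
    fix e :: real assume "e > 0"
    then obtain N where N: "\<And>m n. m \<ge> N \<Longrightarrow> norm (\<Sum>k=m..<n. (cmod (ip x (gs d k)))\<^sup>2) < e"
      using summable_gs[OF assms(2)] unfolding summable_Cauchy by meson
    then show "\<exists>N. \<forall>m\<ge>N. \<forall>n\<ge>m. sqnorm (pr x n - pr x m) < e"
      by (intro exI[of _ N]) (auto simp: ip_pr_diff assms(2) dest: abs_le_D1 intro: le_less_trans[OF abs_ge_self])
  qed
  then obtain f where f: "f \<in> S" "(\<lambda>n. sqnorm (pr x n - f)) \<longlonglongrightarrow> 0"
    using ip_completeD[of "pr x", OF assms(1) pr_in_S] by blast
  have b: "ip (x - f) (gs d j) = 0" for j
  proof -
    \<comment> \<open>Once \<open>n\<close> exceeds \<open>j\<close>, projecting does not change the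
      coefficient at \<open>j\<close>; what remains is bounded by the distance from
      \<open>pr x n\<close> to \<open>f\<close>, which tends to 0.\<close>
    have "ip (x - f) (gs d j) = ip (pr x n - f) (gs d j)" if "n > j" for n
      using that f(1) by (simp add: ip_diff_left assms(2) pr_in_S gs_in_S ip_pr)
    then have "(cmod (ip (x - f) (gs d j)))\<^sup>2 \<le> sqnorm (pr x n - f)" if "n > j" for n
      using that gs_coeff_le[OF S_diff[OF pr_in_S f(1)], of x n j] by simp
    then have "(cmod (ip (x - f) (gs d j)))\<^sup>2 \<le> 0"
      by (intro LIMSEQ_le_const[OF f(2)] exI[of _ "Suc j"]) auto
    then show ?thesis by simp
  qed
  show thesis
    by (rule that[OF f]) (intro orth_gs_imp_orth b S_diff assms f)
qed

text \<open>By totality, \<open>x\<close> differs from the limit of its projections by a vector of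
  length 0. Such a vector is orthogonal to everything, so the distance to the limit and the distance
  to \<open>x\<close> agree.\<close>

lemma gs_residual_tendsto:
  assumes "ip_complete" and total: "\<And>x. x \<in> S \<Longrightarrow> (\<And>n. ip x (d n) = 0) \<Longrightarrow> sqnorm x = 0"
    and x: "x \<in> S"
  shows "(\<lambda>n. sqnorm (x - pr x n)) \<longlonglongrightarrow> 0"
proof -
  obtain f where f: "f \<in> S" "(\<lambda>n. sqnorm (pr x n - f)) \<longlonglongrightarrow> 0"
    "\<And>n. ip (x - f) (d n) = 0"
    using pr_limit[OF assms(1) x] by blast
  let ?u = "x - f"
  have u: "?u \<in> S" using x f by (simp add: S_diff)
  then have u0: "Re (ip ?u ?u) = 0" using total f by blast
  have "sqnorm (x - pr x n) = sqnorm (pr x n - f)" for n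
  proof -
    let ?v = "f - pr x n"
    have v: "?v \<in> S" by (intro S_diff f pr_in_S)
    have uv: "ip ?u ?v = 0" by (rule ip_self_zero_left[OF v u u0])
    then have vu: "ip ?v ?u = 0" using ip_commute[OF v u] by simp
    have "x - pr x n = ?u + ?v" by simp
    then have "ip (x - pr x n) (x - pr x n) = ip (?u + ?v) (?u + ?v)" by (rule arg_cong2) fact
    also have "\<dots> = ip ?u ?u + ip ?v ?v"
      by (simp only: ip_add_left ip_add_right u v S_add uv vu) simp
    also have "ip ?v ?v = ip (pr x n - f) (pr x n - f)"
      by (simp add: ip_diff_left ip_diff_right f pr_in_S S_diff)
    finally show ?thesis using u0 by simp
  qed
  then show ?thesis using f(2) by simp
qed

text \<open>\<open>\<Phi>\<close> takes the sequence of Gram-Schmidt coefficients. It preserves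
  lengths because the residuals tend to 0, and inner products by polarisation; completeness makes
  the image closed. Vectors at distance 0 get the same image, so the embedding also performs the
  quotient by null vectors.\<close>

theorem ell2_embedding:
  assumes "ip_complete" and total: "\<And>x. x \<in> S \<Longrightarrow> (\<And>n. ip x (d n) = 0) \<Longrightarrow> sqnorm x = 0"
  obtains \<Phi> where "hilbert_subspace (\<Phi> ` S)"
    "\<And>x y. x \<in> S \<Longrightarrow> y \<in> S \<Longrightarrow> \<Phi> (x + y) = \<Phi> x + \<Phi> y"
    "\<And>c x. x \<in> S \<Longrightarrow> \<Phi> (scale c x) = c *\<^sub>C \<Phi> x"
    "\<And>x y. x \<in> S \<Longrightarrow> y \<in> S \<Longrightarrow> cinner (\<Phi> x) (\<Phi> y) = ip x y"
proof -
  define \<Phi> where "\<Phi> x = Abs_ell2 (\<lambda>k. ip x (gs d k))" for x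
  have nth: "ell2_nth (\<Phi> x) k = ip x (gs d k)" if "x \<in> S" for x k
    unfolding \<Phi>_def using summable_gs[OF that] by (subst Abs_ell2_inverse) auto
  have add: "\<Phi> (x + y) = \<Phi> x + \<Phi> y" if "x \<in> S" "y \<in> S" for x y
    using that by (intro ell2_eqI) (simp add: nth plus_ell2.rep_eq S_add ip_add_left gs_in_S)
  have scl: "\<Phi> (scale c x) = c *\<^sub>C \<Phi> x" if "x \<in> S" for c x
    using that by (intro ell2_eqI) (simp add: nth scaleC.rep_eq S_scale ip_scale_left gs_in_S)
  have diff: "\<Phi> (x - y) = \<Phi> x - \<Phi> y" if "x \<in> S" "y \<in> S" for x y
    using that by (intro ell2_eqI) (simp add: nth minus_ell2.rep_eq S_diff ip_diff_left gs_in_S)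
  have nrm: "(norm (\<Phi> x))\<^sup>2 = sqnorm x" if x: "x \<in> S" for x
  proof -
    have "(\<lambda>n. sqnorm x - (\<Sum>k<n. (cmod (ip x (gs d k)))\<^sup>2)) \<longlonglongrightarrow> 0"
      using gs_residual_tendsto[OF assms x] unfolding ip_residual[OF x] .
    then have "(\<lambda>n. sqnorm x - (sqnorm x - (\<Sum>k<n. (cmod (ip x (gs d k)))\<^sup>2))) \<longlonglongrightarrow> sqnorm x - 0"
      by (intro tendsto_intros)
    then have "(\<lambda>k. (cmod (ell2_nth (\<Phi> x) k))\<^sup>2) sums sqnorm x"
      by (simp add: nth[OF x] sums_def)
    then show ?thesis by (rule sums_unique2[OF norm_ell2_sums])
  qed
  have re: "Re (cinner (\<Phi> x) (\<Phi> y)) = Re (ip x y)" if "x \<in> S" "y \<in> S" for x y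
  proof -
    have "(norm (\<Phi> x - \<Phi> y))\<^sup>2 = sqnorm (x - y)"
      using that by (simp add: diff[symmetric] nrm S_diff)
    also have "\<dots> = sqnorm x + sqnorm y - Re (ip x y) - Re (ip y x)"
      using that by (simp add: ip_diff_left ip_diff_right S_diff)
    also have "Re (ip y x) = Re (ip x y)" using ip_commute[OF that] by simp
    finally show ?thesis using that by (simp add: norm_diff_sq nrm)
  qed
  have ip: "cinner (\<Phi> x) (\<Phi> y) = ip x y" if "x \<in> S" "y \<in> S" for x y
  proof (rule complex_eqI)
    show "Re (cinner (\<Phi> x) (\<Phi> y)) = Re (ip x y)" by (rule re[OF that])
    \<comment> \<open>Applying the identity of real parts to \<open>\<i>\<close> times
      \<open>y\<close> gives the identity of imaginary parts.\<close>
    have "Re (cinner (\<Phi> x) (\<Phi> (scale \<i> y))) = Re (ip x (scale \<i> y))"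
      by (intro re S_scale that)
    then show "Im (cinner (\<Phi> x) (\<Phi> y)) = Im (ip x y)"
      using that by (simp add: scl ip_scale_right cinner_scaleC_right)
  qed
  have "hilbert_subspace (\<Phi> ` S)"
    unfolding hilbert_subspace_def
  proof
    show "ell2.subspace (\<Phi> ` S)"
    proof (rule ell2.subspaceI)
      have "\<Phi> (scale 0 0) = 0" using scl[OF S_0, of 0] by simp
      then show "0 \<in> \<Phi> ` S" using S_0 by (metis image_eqI scale_zero_left)
    next
      fix x y assume "x \<in> \<Phi> ` S" "y \<in> \<Phi> ` S"
      then show "x + y \<in> \<Phi> ` S" by (auto simp: add[symmetric] S_add)
    next
      fix c x assume "x \<in> \<Phi> ` S"
      then show "c *\<^sub>C x \<in> \<Phi> ` S" by (auto simp: scl[symmetric] S_scale)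
    qed
    show "closed (\<Phi> ` S)"
      unfolding closed_sequential_limits
    proof safe
      fix X l assume X: "\<forall>n. X n \<in> \<Phi> ` S" "X \<longlonglongrightarrow> l"
      then have "\<forall>n. \<exists>f. f \<in> S \<and> X n = \<Phi> f" by blast
      then obtain F where F: "\<And>n. F n \<in> S" "\<And>n. X n = \<Phi> (F n)"
        unfolding choice_iff by blast
      have d: "sqnorm (F n - f) = (dist (X n) (\<Phi> f))\<^sup>2" if "f \<in> S" for n f
        using that F by (simp add: dist_norm diff[symmetric] nrm S_diff)
      have "\<forall>e>0. \<exists>N. \<forall>m\<ge>N. \<forall>n\<ge>m. sqnorm (F n - F m) < e"
      proof (intro allI impI)
        fix e :: real assume e: "e > 0"
        have "Cauchy X" using X(2) by (rule LIMSEQ_imp_Cauchy)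
        then obtain N where N: "\<And>m n. m \<ge> N \<Longrightarrow> n \<ge> N \<Longrightarrow> dist (X m) (X n) < sqrt e"
          using metric_CauchyD[of X "sqrt e"] e by auto
        have "(dist (X n) (X m))\<^sup>2 < e" if "m \<ge> N" "n \<ge> m" for m n
        proof -
          have "(dist (X n) (X m))\<^sup>2 < (sqrt e)\<^sup>2"
            by (rule power_strict_mono) (use N[of n m] that in auto)
          then show ?thesis using e by simp
        qed
        then show "\<exists>N. \<forall>m\<ge>N. \<forall>n\<ge>m. sqnorm (F n - F m) < e"
          by (auto simp: d F)
      qed
      then obtain f where f: "f \<in> S" "(\<lambda>n. sqnorm (F n - f)) \<longlonglongrightarrow> 0"
        using ip_completeD[of F, OF assms(1) F(1)] by blast
      have "X \<longlonglongrightarrow> \<Phi> f"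
        using f(2) by (subst tendsto_dist_iff) (simp add: d f(1))
      then have "l = \<Phi> f" using X(2) LIMSEQ_unique by blast
      then show "l \<in> \<Phi> ` S" using f(1) by blast
    qed
  qed
  then show thesis using that add scl ip by blast
qed

end

end

section \<open>Baire category and measure on locally compact groups\<close>

definition open_dense :: "'a :: topological_space set \<Rightarrow> bool" where
  "open_dense D \<longleftrightarrow> open D \<and> (\<forall>W. open W \<and> W \<noteq> {} \<longrightarrow> D \<inter> W \<noteq> {})"

text \<open>The Baire property of \<open>A\<close>, witnessed by \<open>U\<close>. The meagre set
  where the two may differ is presented through its complement, which contains the intersection of
  the countable family of open dense sets.\<close>

abbreviation open_mod_meagre :: "'a :: topological_space set \<Rightarrow> 'a set \<Rightarrow> 'a set set \<Rightarrow> bool" where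
  "open_mod_meagre A U \<D> \<equiv> open U \<and> countable \<D> \<and> (\<forall>D\<in>\<D>. open_dense D) \<and>
    (\<forall>x. (\<forall>D\<in>\<D>. x \<in> D) \<longrightarrow> (x \<in> A \<longleftrightarrow> x \<in> U))"

lemma Hausdorff_euclidean_t2: "Hausdorff_space (euclidean :: 'a :: t2_space topology)"
  unfolding Hausdorff_space_def by (metis disjnt_def hausdorff open_openin)

lemma baire_closed_cover:
  fixes C :: "nat \<Rightarrow> 'a :: t2_space set"
  assumes lc: "locally_compact_space (euclidean :: 'a topology)"
    and C: "\<And>n. closed (C n)" and sub: "open W" "W \<noteq> {}" "W \<subseteq> (\<Union>n. C n)"
  shows "\<exists>n. interior (C n) \<noteq> {}"
proof (rule ccontr)
  assume "\<not> ?thesis"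
  then have "euclidean interior_of (\<Union>(range C)) = {}"
    by (intro Baire_category_alt disjI2 conjI lc locally_compact_Hausdorff_imp_regular_space
        Hausdorff_euclidean_t2) (use C in auto)
  moreover have "W \<subseteq> interior (\<Union>(range C))" using sub by (intro interior_maximal) auto
  ultimately show False using sub by auto
qed

lemma baire_open_dense:
  fixes W :: "'a :: t2_space set"
  assumes lc: "locally_compact_space (euclidean :: 'a topology)"
    and \<D>: "countable \<D>" "\<And>D. D \<in> \<D> \<Longrightarrow> open_dense D" and W: "open W" "W \<noteq> {}"
  shows "\<exists>x\<in>W. \<forall>D\<in>\<D>. x \<in> D"
proof (rule ccontr)
  assume n: "\<not> ?thesis"
  \<comment> \<open>The set \<open>UNIV\<close> is added to the family so that there is something to
    enumerate even if the family is empty.\<close>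
  define C where "C n = - from_nat_into (insert UNIV \<D>) n" for n
  have D: "open_dense (from_nat_into (insert UNIV \<D>) n)" for n
    using from_nat_into[of "insert UNIV \<D>" n] \<D>(2) by (auto simp: open_dense_def)
  have "\<exists>n. interior (C n) \<noteq> {}"
  proof (rule baire_closed_cover[OF lc _ W])
    show "closed (C n)" for n using D by (auto simp: C_def open_dense_def)
    show "W \<subseteq> (\<Union>n. C n)"
    proof
      fix x assume "x \<in> W"
      then obtain D where "D \<in> \<D>" "x \<notin> D" using n by blast
      moreover obtain k where "from_nat_into (insert UNIV \<D>) k = D"
        using from_nat_into_surj[of "insert UNIV \<D>" D] \<D>(1) \<open>D \<in> \<D>\<close> by auto
      ultimately show "x \<in> (\<Union>n. C n)" by (auto simp: C_def)
    qed
  qed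
  then obtain k where k: "interior (C k) \<noteq> {}" by blast
  have "from_nat_into (insert UNIV \<D>) k \<inter> interior (C k) \<noteq> {}"
    using D[of k] k unfolding open_dense_def by blast
  then show False using interior_subset[of "C k"] by (auto simp: C_def)
qed

text \<open>Sets that agree with an open set off a meagre set form a sigma-algebra that contains the
  open sets.\<close>

lemma borel_baire_property:
  fixes A :: "'a :: topological_space set"
  assumes "A \<in> sets borel"
  shows "\<exists>U \<D>. open_mod_meagre A U \<D>"
proof -
  have "A \<in> sigma_sets UNIV {S. open S}"
    using assms by (simp add: borel_def)
  then show ?thesis
  proof induction
    case (Basic A)
    then show ?case by (intro exI[of _ A] exI[of _ "{}"]) auto
  next
    case Empty
    show ?case by (intro exI[of _ "{}"]) auto
  next
    case (Compl A)
    then obtain U \<D> where U: "open U" "countable \<D>" "\<forall>D\<in>\<D>. open_dense D"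
      "\<And>x. (\<forall>D\<in>\<D>. x \<in> D) \<Longrightarrow> (x \<in> A \<longleftrightarrow> x \<in> U)" by blast
    \<comment> \<open>A complement is approximated by the exterior of \<open>U\<close>. This is
      wrong only on the boundary of \<open>U\<close>, which is nowhere dense, so one more open dense
      set repairs it.\<close>
    have "open_dense (U \<union> - closure U)"
      unfolding open_dense_def
    proof (intro conjI allI impI)
      show "open (U \<union> - closure U)" using U(1) by auto
      fix W :: "'a set" assume "open W \<and> W \<noteq> {}"
      then show "(U \<union> - closure U) \<inter> W \<noteq> {}"
        using open_Int_closure_eq_empty[of W U] by (auto simp: Int_commute)
    qed
    then show ?case
      using U closure_subset[of U]
      by (intro exI[of _ "- closure U"] exI[of _ "insert (U \<union> - closure U) \<D>"]) auto
  next
    case (Union A)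
    then have "\<forall>i. \<exists>U \<D>. open_mod_meagre (A i) U \<D>" by blast
    then obtain U \<D> where "\<And>i :: nat. open_mod_meagre (A i) (U i) (\<D> i)" by metis
    then show ?case
      by (intro exI[of _ "\<Union>(range U)"] exI[of _ "\<Union>(range \<D>)"]) fastforce
  qed
qed

lemma hilbert_isoD:
  assumes "hilbert_iso H K T" "hilbert_subspace H"
  shows "x \<in> H \<Longrightarrow> T x \<in> K" "x \<in> H \<Longrightarrow> y \<in> H \<Longrightarrow> T (x + y) = T x + T y"
    "x \<in> H \<Longrightarrow> T (c *\<^sub>C x) = c *\<^sub>C T x"
    "x \<in> H \<Longrightarrow> y \<in> H \<Longrightarrow> T (x - y) = T x - T y"
    "x \<in> H \<Longrightarrow> y \<in> H \<Longrightarrow> cinner (T x) (T y) = cinner x y"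
    "x \<in> H \<Longrightarrow> norm (T x) = norm x" "T 0 = 0"
proof -
  show *: "x \<in> H \<Longrightarrow> T x \<in> K" "x \<in> H \<Longrightarrow> y \<in> H \<Longrightarrow> T (x + y) = T x + T y"
    "x \<in> H \<Longrightarrow> T (c *\<^sub>C x) = c *\<^sub>C T x"
    "x \<in> H \<Longrightarrow> y \<in> H \<Longrightarrow> cinner (T x) (T y) = cinner x y" for x y c
    using assms unfolding hilbert_iso_def bij_betw_def by auto
  show "x \<in> H \<Longrightarrow> y \<in> H \<Longrightarrow> T (x - y) = T x - T y"
    using *(2)[of "x - y" y] hilbert_subspaceD(4)[OF assms(2)] by simp
  show "x \<in> H \<Longrightarrow> norm (T x) = norm x"
    using *(4)[of x x] by (simp add: norm_ell2_def inner_ell2_def)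
  show "T 0 = 0" using *(3)[of 0 0] hilbert_subspaceD(1)[OF assms(2)] by simp
qed

lemma hilbert_iso_tendsto:
  assumes T: "hilbert_iso H K T" and H: "hilbert_subspace H"
    and X: "\<And>n :: nat. X n \<in> H" "x \<in> H" "X \<longlonglongrightarrow> x"
  shows "(\<lambda>n. T (X n)) \<longlonglongrightarrow> T x"
proof -
  have "dist (T (X n)) (T x) = dist (X n) x" for n
    using hilbert_isoD(4)[OF T H X(1,2)] hilbert_isoD(6)[OF T H hilbert_subspaceD(4)[OF H X(1,2)]]
    by (simp add: dist_norm)
  then show ?thesis using X(3) by (simp add: tendsto_dist_iff[of _ "T x"] tendsto_dist_iff[of X])
qed

text \<open>The operator \<open>\<pi> 0\<close> is idempotent and injective.\<close>

lemma hilbert_iso_rep_zero: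
  fixes \<pi> :: "'g :: group_add \<Rightarrow> ell2 \<Rightarrow> ell2"
  assumes "hilbert_iso K K (\<pi> 0)" "hilbert_subspace K"
    "\<And>g h x. x \<in> K \<Longrightarrow> \<pi> (g + h) x = \<pi> g (\<pi> h x)" "x \<in> K"
  shows "\<pi> 0 x = x"
proof -
  have "\<pi> 0 (\<pi> 0 x) = \<pi> 0 x" using assms(3)[of x 0 0] assms(4) by simp
  then show ?thesis
    using assms(1,4) hilbert_isoD(1)[OF assms(1,2,4)]
    unfolding hilbert_iso_def bij_betw_def by (auto dest: inj_onD)
qed

section \<open>Translation in topological groups and automatic continuity\<close>

lemma open_translate:
  fixes U :: "'g :: topological_group_add set"
  assumes "open U"
  shows "open {g. h + g \<in> U}" "open {g. g + h \<in> U}"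
proof -
  have "open ((\<lambda>g. h + g) -` U)" "open ((\<lambda>g. g + h) -` U)"
    by (intro open_vimage assms continuous_intros)+
  then show "open {g. h + g \<in> U}" "open {g. g + h \<in> U}" by (simp_all add: vimage_def)
qed

lemma open_dense_translate:
  fixes D :: "'g :: topological_group_add set"
  assumes "open_dense D"
  shows "open_dense {k. k + g \<in> D}"
  unfolding open_dense_def
proof (intro conjI allI impI)
  show "open {k. k + g \<in> D}" using assms by (auto simp: open_dense_def intro: open_translate)
  fix W :: "'g set" assume W: "open W \<and> W \<noteq> {}"
  then obtain w where "w \<in> W" by blast
  then have "w + g \<in> {k. k + - g \<in> W}" by (simp add: add.assoc)
  moreover have "open {k. k + - g \<in> W}" using W by (intro open_translate) auto
  ultimately have "D \<inter> {k. k + - g \<in> W} \<noteq> {}"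
    using assms unfolding open_dense_def by blast
  then obtain k where "k \<in> D" "k + - g \<in> W" by blast
  then have "k + - g \<in> {k. k + g \<in> D} \<inter> W" by (simp add: add.assoc)
  then show "{k. k + g \<in> D} \<inter> W \<noteq> {}" by blast
qed

text \<open>Pettis: a nonmeagre Borel set \<open>E\<close> agrees with a nonempty open set \<open>U\<close> up to a meagre set, so
  \<open>- E + E\<close> is a neighbourhood of the identity.\<close>

lemma pettis:
  fixes E :: "nat \<Rightarrow> 'g :: {topological_group_add, t2_space} set"
  assumes lc: "locally_compact_space (euclidean :: 'g topology)"
    and E: "\<And>n. E n \<in> sets borel" and cover: "(\<Union>n. E n) = UNIV"
  shows "\<exists>n V. open V \<and> 0 \<in> V \<and> (\<forall>g\<in>V. \<exists>h\<in>E n. h + g \<in> E n)"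
proof -
  have "\<forall>n. \<exists>U \<D>. open_mod_meagre (E n) U \<D>"
    by (intro allI borel_baire_property E)
  then obtain U \<D> where "\<And>n. open_mod_meagre (E n) (U n) (\<D> n)" by metis
  then have U: "\<And>n. open (U n)" "\<And>n. countable (\<D> n)" "\<And>n D. D \<in> \<D> n \<Longrightarrow> open_dense D"
    "\<And>n x. (\<forall>D\<in>\<D> n. x \<in> D) \<Longrightarrow> (x \<in> E n \<longleftrightarrow> x \<in> U n)"
    by auto
  \<comment> \<open>One point outside all exceptional sets at once: whichever \<open>E n\<close>
    contains it, the corresponding \<open>U n\<close> contains it too and is therefore
    nonempty.\<close>
  have "\<exists>x\<in>UNIV. \<forall>D\<in>(\<Union>(range \<D>)). x \<in> D"
    by (rule baire_open_dense[OF lc]) (use U in auto)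
  then obtain x where x: "\<And>n D. D \<in> \<D> n \<Longrightarrow> x \<in> D" by blast
  obtain n where "x \<in> E n" using cover by blast
  then have xU: "x \<in> U n" using U(4)[of n x] x by blast
  define V where "V = {g. x + g \<in> U n}"
  have "\<exists>h\<in>E n. h + g \<in> E n" if "g \<in> V" for g
  proof -
    \<comment> \<open>The category theorem is applied again, in the open set of \<open>h\<close> for
      which \<open>h\<close> and \<open>h + g\<close> both lie in \<open>U n\<close>, now avoiding
      the exceptional set of \<open>E n\<close> and its translate.\<close>
    have "\<exists>h\<in>U n \<inter> {h. h + g \<in> U n}. \<forall>D\<in>\<D> n \<union> (\<lambda>D. {k. k + g \<in> D}) ` \<D> n. h \<in> D"
    proof (rule baire_open_dense[OF lc])
      show "open (U n \<inter> {h. h + g \<in> U n})" by (intro open_Int open_translate U)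
      show "U n \<inter> {h. h + g \<in> U n} \<noteq> {}" using xU that by (auto simp: V_def)
    qed (use U in \<open>auto intro: open_dense_translate\<close>)
    then obtain h where h: "h \<in> U n" "h + g \<in> U n"
      "\<forall>D\<in>\<D> n \<union> (\<lambda>D. {k. k + g \<in> D}) ` \<D> n. h \<in> D"
      by blast
    then have "\<forall>D\<in>\<D> n. h \<in> D" "\<forall>D\<in>\<D> n. h + g \<in> D" by auto
    then show ?thesis using U(4) h by blast
  qed
  moreover have "open V" "0 \<in> V" using U(1) xU by (auto simp: V_def intro: open_translate)
  ultimately show ?thesis by blast
qed

text \<open>By separability countably many balls of radius \<open>e / 2\<close> cover the orbit of
  \<open>x\<close>. For \<open>g\<close> near the identity some \<open>h\<close> has both
  \<open>\<pi> h x\<close> and \<open>\<pi> (h + g) x\<close> in the same ball, and their distance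
  equals that of \<open>\<pi> g x\<close> and \<open>x\<close>, as \<open>\<pi> h\<close> is
  isometric.\<close>

lemma weakly_measurable_rep_continuous:
  fixes \<pi> :: "'g :: {topological_group_add, t2_space} \<Rightarrow> ell2 \<Rightarrow> ell2"
  assumes lc: "locally_compact_space (euclidean :: 'g topology)"
    and K: "hilbert_subspace K" and iso: "\<And>g. hilbert_iso K K (\<pi> g)"
    and mult: "\<And>g h x. x \<in> K \<Longrightarrow> \<pi> (g + h) x = \<pi> g (\<pi> h x)"
    and meas: "\<And>x y. x \<in> K \<Longrightarrow> y \<in> K \<Longrightarrow> (\<lambda>g. cinner (\<pi> g x) y) \<in> borel_measurable borel"
    and x: "x \<in> K"
  shows "continuous_on UNIV (\<lambda>g. \<pi> g x)"
proof -
  note iD = hilbert_isoD[OF iso K]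
  have nbhd: "\<exists>V. open V \<and> 0 \<in> V \<and> (\<forall>g\<in>V. norm (\<pi> g x - x) < e)" if e: "e > 0" for e
  proof -
    obtain D where D: "countable D" "D \<subseteq> K" "\<And>y. y \<in> K \<Longrightarrow> \<exists>d\<in>D. norm (y - d) < e / 2"
      using ell2_countable_net[of "e/2" K] e by auto
    have "D \<noteq> {}" using D(3)[OF x] by blast
    define E where "E n = {g. norm (\<pi> g x - from_nat_into D n) < e / 2}" for n
    have "\<exists>n V. open V \<and> 0 \<in> V \<and> (\<forall>g\<in>V. \<exists>h\<in>E n. h + g \<in> E n)"
    proof (rule pettis[OF lc])
      fix n
      let ?d = "from_nat_into D n"
      have d: "?d \<in> K" using from_nat_into[OF \<open>D \<noteq> {}\<close>] D(2) by blast
      \<comment> \<open>Since \<open>\<pi> g x\<close> has constant norm, its distance to a fixed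
        vector depends on \<open>g\<close> only through a matrix coefficient. Weak measurability
        thus makes the set \<open>E n\<close> Borel.\<close>
      have "(norm (\<pi> g x - ?d) < e / 2) \<longleftrightarrow> (norm x)\<^sup>2 + (norm ?d)\<^sup>2 - 2 * Re (cinner (\<pi> g x) ?d) < (e/2)\<^sup>2" for g
      proof -
        have "(norm (\<pi> g x - ?d))\<^sup>2 = (norm x)\<^sup>2 + (norm ?d)\<^sup>2 - 2 * Re (cinner (\<pi> g x) ?d)"
          by (simp add: norm_diff_sq iD x)
        moreover have "(norm (\<pi> g x - ?d) < e / 2) \<longleftrightarrow> (norm (\<pi> g x - ?d))\<^sup>2 < (e/2)\<^sup>2"
          using e abs_square_less_1[of "norm (\<pi> g x - ?d) / (e/2)"] by (simp add: power_divide)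
        ultimately show ?thesis by simp
      qed
      then have "E n = {g \<in> space borel. (norm x)\<^sup>2 + (norm ?d)\<^sup>2 - 2 * Re (cinner (\<pi> g x) ?d) < (e/2)\<^sup>2}"
        by (auto simp: E_def)
      also have "\<dots> \<in> sets borel"
        using meas[OF x d] by measurable
      finally show "E n \<in> sets borel" .
    next
      show "(\<Union>n. E n) = UNIV"
      proof (rule sym, rule UNIV_eq_I, rule UN_iff[THEN iffD2])
        fix g
        obtain d where "d \<in> D" "norm (\<pi> g x - d) < e / 2" using D(3)[of "\<pi> g x"] iD(1) x by blast
        then show "\<exists>n\<in>UNIV. g \<in> E n" unfolding E_def using from_nat_into_surj[OF D(1)] by fastforce
      qed
    qed
    then obtain n V where "open V \<and> 0 \<in> V \<and> (\<forall>g\<in>V. \<exists>h\<in>E n. h + g \<in> E n)" by (elim exE)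
    then have V: "open V" "0 \<in> V" "\<And>g. g \<in> V \<Longrightarrow> \<exists>h\<in>E n. h + g \<in> E n" by auto
    have "norm (\<pi> g x - x) < e" if "g \<in> V" for g
    proof -
      from V(3)[OF that] obtain h where h: "h \<in> E n" "h + g \<in> E n" ..
      have "norm (\<pi> g x - x) = norm (\<pi> h (\<pi> g x - x))"
        using hilbert_subspaceD(4)[OF K] iD(1) x iD(6) by metis
      also have "\<pi> h (\<pi> g x - x) = \<pi> (h + g) x - \<pi> h x"
        by (simp add: iD x mult)
      also have "norm (\<pi> (h + g) x - \<pi> h x) < e"
        using h norm_triangle_ineq4[of "\<pi> (h + g) x - from_nat_into D n" "\<pi> h x - from_nat_into D n"]
        by (simp add: E_def)
      finally show ?thesis .
    qed
    then show ?thesis using V by blast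
  qed
  show ?thesis
    unfolding continuous_on_def
  proof (intro ballI tendstoI)
    fix g0 :: 'g and e :: real assume "e > 0"
    from nbhd[OF this] obtain V where "open V \<and> 0 \<in> V \<and> (\<forall>g\<in>V. norm (\<pi> g x - x) < e)" ..
    then have V: "open V" "0 \<in> V" "\<And>g. g \<in> V \<Longrightarrow> norm (\<pi> g x - x) < e" by auto
    have "dist (\<pi> g x) (\<pi> g0 x) < e" if "- g0 + g \<in> V" for g
    proof -
      have "\<pi> g x = \<pi> g0 (\<pi> (- g0 + g) x)" using mult[OF x, of g0 "- g0 + g"] by (simp add: add.assoc[symmetric])
      then have "dist (\<pi> g x) (\<pi> g0 x) = norm (\<pi> g0 (\<pi> (- g0 + g) x) - \<pi> g0 x)"
        by (simp only: dist_norm)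
      also have "\<dots> = norm (\<pi> g0 (\<pi> (- g0 + g) x - x))"
        by (simp add: iD x)
      also have "\<dots> = norm (\<pi> (- g0 + g) x - x)"
        by (intro iD(6) hilbert_subspaceD(4)[OF K] iD(1) x)
      finally show ?thesis using V(3)[OF that] by simp
    qed
    moreover have "open {g. - g0 + g \<in> V}" "g0 \<in> {g. - g0 + g \<in> V}"
      using V by (auto intro: open_translate)
    ultimately show "\<forall>\<^sub>F g in at g0 within UNIV. dist (\<pi> g x) (\<pi> g0 x) < e"
      unfolding eventually_at_topological by (intro exI[of _ "{g. - g0 + g \<in> V}"]) auto
  qed
qed

text \<open>The functions \<open>f n\<close> behave like lengths on the group. By category they are
  uniformly small on some open set from some index on; subadditivity carries this to a neighbourhood
  of the identity, and finitely many translates of that neighbourhood cover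
  \<open>K\<close>.\<close>

lemma uniform_limit_on_compact:
  fixes f :: "nat \<Rightarrow> 'g :: {topological_group_add, t2_space} \<Rightarrow> real"
  assumes lc: "locally_compact_space (euclidean :: 'g topology)"
    and cont: "\<And>n. continuous_on UNIV (f n)"
    and sub: "\<And>n g h. f n (g + h) \<le> f n g + f n h"
    and inv: "\<And>n g. f n (- g) = f n g"
    and lim: "\<And>g. (\<lambda>n. f n g) \<longlonglongrightarrow> 0"
    and K: "compact K" and e: "e > 0"
  shows "\<exists>N. \<forall>n\<ge>N. \<forall>k\<in>K. f n k < e"
proof -
  \<comment> \<open>The budget is \<open>e / 4\<close> at the interior point and
    \<open>e / 4\<close> on the open set, hence \<open>e / 2\<close> near the identity, which leaves
    \<open>e / 2\<close> for the finitely many centres of the cover.\<close>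
  define C where "C N = (\<Inter>n\<in>{N..}. {g. f n g \<le> e / 4})" for N
  have "\<exists>N. interior (C N) \<noteq> {}"
  proof (rule baire_closed_cover[OF lc _ open_UNIV])
    show "closed (C N)" for N
      unfolding C_def by (intro closed_INT ballI closed_Collect_le cont continuous_on_const)
    show "UNIV \<subseteq> (\<Union>N. C N)"
    proof
      fix g
      have "eventually (\<lambda>n. f n g < e / 4) sequentially"
        by (rule order_tendstoD(2)[OF lim]) (use e in simp)
      then obtain N where "\<forall>n\<ge>N. f n g < e / 4" unfolding eventually_sequentially by blast
      then have "g \<in> C N" unfolding C_def by (auto intro: less_imp_le)
      then show "g \<in> (\<Union>N. C N)" by blast
    qed
  qed simp
  then obtain N x where x: "x \<in> interior (C N)" by blast
  define V where "V = {g. x + g \<in> interior (C N)}"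
  have V: "open V" "0 \<in> V" using x by (auto simp: V_def intro: open_translate)
  have fV: "f n g \<le> e / 2" if "g \<in> V" "n \<ge> N" for g n
  proof -
    have "f n g = f n (- x + (x + g))" by (simp add: add.assoc[symmetric])
    also have "\<dots> \<le> f n x + f n (x + g)" using sub[of n "- x" "x + g"] inv by simp
    also have "f n x \<le> e / 4" using x interior_subset[of "C N"] that unfolding C_def by blast
    also have "f n (x + g) \<le> e / 4" using that interior_subset[of "C N"] unfolding C_def V_def by blast
    finally show ?thesis by simp
  qed
  obtain T where T: "T \<subseteq> K" "finite T" "K \<subseteq> (\<Union>k\<in>T. {g. - k + g \<in> V})"
  proof (rule compactE_image[OF K, of K "\<lambda>k. {g. - k + g \<in> V}"])
    show "open {g. - k + g \<in> V}" for k using V(1) by (rule open_translate)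
    show "K \<subseteq> (\<Union>k\<in>K. {g. - k + g \<in> V})" using V(2) by force
  qed blast
  have "eventually (\<lambda>n. \<forall>k\<in>T. f n k < e / 2) sequentially"
    using T(2) by (intro eventually_ball_finite ballI order_tendstoD(2)[OF lim]) (use e in auto)
  then obtain M where M: "\<And>n k. n \<ge> M \<Longrightarrow> k \<in> T \<Longrightarrow> f n k < e / 2"
    unfolding eventually_sequentially by blast
  have "f n g < e" if "n \<ge> max M N" "g \<in> K" for n g
  proof -
    obtain k where k: "k \<in> T" "- k + g \<in> V" using T(3) \<open>g \<in> K\<close> by blast
    have "f n g = f n (k + (- k + g))" by (simp add: add.assoc[symmetric])
    also have "\<dots> \<le> f n k + f n (- k + g)" by (rule sub)
    also have "\<dots> < e" using M[of n k] fV[of "- k + g" n] k that by simp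
    finally show ?thesis .
  qed
  then show ?thesis by blast
qed

section \<open>Null sets of Haar measure\<close>

context
  fixes \<mu> :: "'g :: {topological_group_add, t2_space, second_countable_topology} measure"
  assumes haar: "left_haar_measure \<mu>"
begin

lemma haar_sets [measurable_cong]: "sets \<mu> = sets borel"
  using haar by (simp add: left_haar_measure_def)

lemma haar_space: "space \<mu> = UNIV"
  using sets_eq_imp_space_eq[OF haar_sets] by simp

lemma haar_AE_translate:
  assumes "AE g in \<mu>. P g"
  shows "AE g in \<mu>. P (h + g)"
proof (rule AE_distrD[where M' = \<mu>])
  have "(\<lambda>g. h + g) \<in> borel_measurable borel"
    by (intro borel_measurable_continuous_onI continuous_intros)
  then show "(\<lambda>g. h + g) \<in> measurable \<mu> \<mu>"
    by (simp add: measurable_cong_sets[OF haar_sets haar_sets])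
  show "AE g in distr \<mu> \<mu> (\<lambda>g. h + g). P g"
    using assms haar unfolding left_haar_measure_def by metis
qed

lemma haar_AE_ex:
  assumes "AE g in \<mu>. P g"
  shows "\<exists>g. P g"
proof (rule ccontr)
  assume "\<not> ?thesis"
  then have "AE g in \<mu>. False" using assms by simp
  then have "emeasure \<mu> (space \<mu>) = 0"
    using ae_filter_eq_bot_iff[of \<mu>] by (simp add: eventually_False)
  then show False using haar by (simp add: left_haar_measure_def haar_space)
qed

text \<open>A conull set meets each of its left translates. If \<open>h\<close> and
  \<open>g + h\<close> both lie in a subgroup, then so does \<open>g\<close>.\<close>

lemma haar_conull_subgroup:
  assumes "AE g in \<mu>. P g" "\<And>g h. P g \<Longrightarrow> P h \<Longrightarrow> P (g + h)" "\<And>g. P g \<Longrightarrow> P (- g)"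
  shows "P g"
proof -
  have "AE h in \<mu>. P h \<and> P (g + h)" using assms(1) haar_AE_translate[OF assms(1)] by eventually_elim simp
  then obtain h where "P h" "P (g + h)" using haar_AE_ex by blast
  then have "P (g + h + - h)" using assms by blast
  then show ?thesis by (simp add: add.assoc)
qed

text \<open>Open sets inside compact sets cover the group and have finite measure; by the Lindelof
  property countably many suffice.\<close>

lemma haar_sigma_finite:
  assumes lc: "locally_compact_space (euclidean :: 'g topology)"
  shows "sigma_finite_measure \<mu>"
proof
  have "\<forall>x :: 'g. \<exists>U K. open U \<and> compact K \<and> x \<in> U \<and> U \<subseteq> K"
    using lc unfolding locally_compact_space_def by simp
  then obtain U K where U: "\<And>x :: 'g. open (U x)" "\<And>x. compact (K x)" "\<And>x. x \<in> U x" "\<And>x. U x \<subseteq> K x"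
    by metis
  obtain \<F> where F: "\<F> \<subseteq> range U" "countable \<F>" "\<Union>\<F> = \<Union>(range U)"
    using Lindelof[of "range U"] U(1) by auto
  have "emeasure \<mu> (U x) \<noteq> \<infinity>" for x
  proof -
    have "emeasure \<mu> (U x) \<le> emeasure \<mu> (K x)"
      using U[of x] by (intro emeasure_mono) (auto simp: haar_sets compact_imp_closed)
    also have "\<dots> < \<infinity>" using haar U(2) by (simp add: left_haar_measure_def)
    finally show ?thesis by simp
  qed
  moreover have "\<F> \<subseteq> sets \<mu>" using F(1) U(1) by (auto simp: haar_sets)
  ultimately show "\<exists>A. countable A \<and> A \<subseteq> sets \<mu> \<and> \<Union> A = space \<mu> \<and> (\<forall>a\<in>A. emeasure \<mu> a \<noteq> \<infinity>)"
    using F U(3) by (intro exI[of _ \<F>]) (auto simp: haar_space)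
qed

end

lemma borel_measurable_cnj:
  assumes "f \<in> borel_measurable M"
  shows "(\<lambda>x. cnj (f x)) \<in> borel_measurable M"
  using measurable_compose[OF assms borel_measurable_continuous_onI[of cnj]]
  by (simp add: continuous_on_cnj continuous_on_id)

section \<open>Measurable sections of a Borel Hilbert field\<close>

text \<open>With \<open>ell2\<close> itself as the space, Gram-Schmidt can be run pointwise on the
  values \<open>s n y\<close> of the fundamental sequence.\<close>

global_interpretation ell2_ip: semi_inner scaleC UNIV cinner
  by unfold_locales
    (auto simp: cinner_add_left cinner_scaleC_left Re_cinner_self ell2.scale_right_distrib
      ell2.scale_left_distrib intro: cinner_commute)

lemma ell2_ip_complete: "ell2_ip.ip_complete"
  unfolding ell2_ip.ip_complete_def
proof (intro allI impI, elim conjE)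
  fix F :: "nat \<Rightarrow> ell2"
  assume F: "\<forall>e>0. \<exists>N. \<forall>m\<ge>N. \<forall>n\<ge>m. Re (cinner (F n - F m) (F n - F m)) < e"
  have "Cauchy F"
    unfolding Cauchy_altdef
  proof (intro allI impI)
    fix e :: real assume e: "e > 0"
    then obtain N where N: "\<forall>m\<ge>N. \<forall>n\<ge>m. Re (cinner (F n - F m) (F n - F m)) < e\<^sup>2"
      using F[rule_format, of "e\<^sup>2"] by auto
    have "dist (F m) (F n) < e" if "m \<ge> N" "n > m" for m n
    proof -
      have "(norm (F n - F m))\<^sup>2 < e\<^sup>2" using N that by (simp add: Re_cinner_self)
      then show ?thesis using e by (simp add: dist_norm norm_minus_commute power2_less_imp_less)
    qed
    then show "\<exists>M. \<forall>m\<ge>M. \<forall>n>m. dist (F m) (F n) < e" by blast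
  qed
  then obtain f where "F \<longlonglongrightarrow> f" using Cauchy_convergent_iff convergent_def by blast
  then have "(\<lambda>n. (norm (F n - f))\<^sup>2) \<longlonglongrightarrow> (norm (f - f))\<^sup>2"
    by (intro tendsto_intros)
  then show "\<exists>f\<in>UNIV. (\<lambda>n. Re (cinner (F n - f) (F n - f))) \<longlonglongrightarrow> 0"
    by (auto simp: Re_cinner_self)
qed

text \<open>The difference of \<open>x\<close> and the limit of the projections lies in the closed
  span of \<open>d\<close> and is orthogonal to it. The inner product of \<open>ell2\<close> is
  definite, so the difference is 0.\<close>

lemma pr_tendsto_ell2:
  assumes "x \<in> closed_span (range d)"
  shows "(\<lambda>n. ell2_ip.pr d x n) \<longlonglongrightarrow> x"
proof -
  let ?K = "closed_span (range d)"
  have K: "hilbert_subspace ?K" by (intro closure_subspace_ell2 ell2.subspace_span)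
  obtain f where f: "(\<lambda>n. Re (cinner (ell2_ip.pr d x n - f) (ell2_ip.pr d x n - f))) \<longlonglongrightarrow> 0"
    "\<And>n. cinner (x - f) (d n) = 0"
    by (rule ell2_ip.pr_limit[of d x, OF _ ell2_ip_complete]) auto
  have lim: "(\<lambda>n. ell2_ip.pr d x n) \<longlonglongrightarrow> f"
    using f(1) by (subst tendsto_dist_iff) (simp add: dist_norm Re_cinner_self)
  have "ell2_ip.pr d x n \<in> ell2.span (range d)" for n
    using ell2_ip.pr_def[of d x n] ell2_ip.gs_in_span[of d]
    by (auto intro: ell2.span_sum ell2.span_scale)
  then have "f \<in> ?K" using lim closure_sequential by blast
  then have "x - f \<in> ?K" using assms hilbert_subspaceD(4)[OF K] by blast
  then have "cinner (x - f) (x - f) = 0"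
    by (rule cinner_closure_span_eq_0[rotated]) (use f(2) in auto)
  then have "x = f" by (simp add: cinner_self)
  with lim show ?thesis by simp
qed

locale hilbert_field =
  fixes \<nu> :: "'y measure" and H :: "'y \<Rightarrow> ell2 set" and s :: "nat \<Rightarrow> 'y \<Rightarrow> ell2"
  assumes field: "borel_hilbert_field \<nu> H s"
begin

lemma H_hilbert: "y \<in> space \<nu> \<Longrightarrow> hilbert_subspace (H y)"
  and s_in_H: "y \<in> space \<nu> \<Longrightarrow> s n y \<in> H y"
  and s_meas: "(\<lambda>y. cinner (s m y) (s n y)) \<in> borel_measurable \<nu>"
  and s_total: "y \<in> space \<nu> \<Longrightarrow> closed_span (range (\<lambda>n. s n y)) = H y"
  using field by (auto simp: borel_hilbert_field_def)

definition msection :: "('y \<Rightarrow> ell2) \<Rightarrow> bool" where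
  "msection f \<longleftrightarrow> (\<forall>y\<in>space \<nu>. f y \<in> H y) \<and>
     (\<forall>n. (\<lambda>y. cinner (f y) (s n y)) \<in> borel_measurable \<nu>)"

text \<open>The measurable sections are those generated by the fundamental sequence
  (\<open>msection_iff\<close>), so their properties can be proved by induction.\<close>

inductive gen_section :: "('y \<Rightarrow> ell2) \<Rightarrow> bool" where
  base: "gen_section (s n)"
| add: "gen_section f \<Longrightarrow> gen_section f' \<Longrightarrow> gen_section (\<lambda>y. f y + f' y)"
| scale: "c \<in> borel_measurable \<nu> \<Longrightarrow> gen_section f \<Longrightarrow> gen_section (\<lambda>y. c y *\<^sub>C f y)"
| lim: "(\<And>n. gen_section (F n)) \<Longrightarrow> (\<And>y. y \<in> space \<nu> \<Longrightarrow> (\<lambda>n. F n y) \<longlonglongrightarrow> f y) \<Longrightarrow> gen_section f"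

lemma gen_section_in_H: "gen_section f \<Longrightarrow> y \<in> space \<nu> \<Longrightarrow> f y \<in> H y"
proof (induction rule: gen_section.induct)
  case (lim F f)
  then show ?case using hilbert_subspaceD(6)[OF H_hilbert, of y "\<lambda>n. F n y"] by blast
qed (auto intro: s_in_H hilbert_subspaceD[OF H_hilbert])

text \<open>The induction runs over \<open>g\<close> alone; of \<open>f\<close> only the
  measurability against the fundamental sequence enters, so that \<open>f\<close> may be a section
  not yet known to be generated.\<close>

lemma gen_section_cinner:
  assumes "\<And>n. (\<lambda>y. cinner (f y) (s n y)) \<in> borel_measurable \<nu>" "gen_section g"
  shows "(\<lambda>y. cinner (f y) (g y)) \<in> borel_measurable \<nu>"
  using assms(2)
proof induction
  case (lim F g)
  show ?case
    by (rule borel_measurable_LIMSEQ_metric[of "\<lambda>n y. cinner (f y) (F n y)"])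
      (auto intro: lim tendsto_cinner)
qed (auto simp: cinner_add_right cinner_scaleC_right assms
    intro!: borel_measurable_add borel_measurable_times borel_measurable_cnj)

lemma gen_section_msection: "gen_section f \<Longrightarrow> msection f"
  unfolding msection_def
proof (intro conjI allI ballI gen_section_in_H)
  fix n assume "gen_section f"
  then have "(\<lambda>y. cinner (s n y) (f y)) \<in> borel_measurable \<nu>"
    by (rule gen_section_cinner[OF s_meas])
  then show "(\<lambda>y. cinner (f y) (s n y)) \<in> borel_measurable \<nu>"
    by (subst cinner_commute) (rule borel_measurable_cnj)
qed

lemma gen_section_diff: "gen_section f \<Longrightarrow> gen_section f' \<Longrightarrow> gen_section (\<lambda>y. f y - f' y)"
  using gen_section.add[of f "\<lambda>y. (-1) *\<^sub>C f' y"] gen_section.scale[of "\<lambda>_. -1" f'] by simp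

lemma gen_section_sum:
  fixes n :: nat
  shows "(\<And>k. k < n \<Longrightarrow> gen_section (f k)) \<Longrightarrow> gen_section (\<lambda>y. \<Sum>k<n. f k y)"
proof (induction n)
  case 0
  have "gen_section (\<lambda>y. 0 *\<^sub>C s 0 y)" by (intro gen_section.scale gen_section.base) simp
  then show ?case by simp
qed (auto intro: gen_section.add)

text \<open>Every coefficient in the pointwise Gram-Schmidt process is a measurable function of the
  point, including the normalising factor, which is 0 where the residual vanishes.\<close>

lemma gen_section_gs: "gen_section (\<lambda>y. ell2_ip.gs (\<lambda>n. s n y) n)"
proof (induction n rule: less_induct)
  case (less n)
  let ?g = "\<lambda>y. s n y - (\<Sum>k<n. cinner (s n y) (ell2_ip.gs (\<lambda>n. s n y) k) *\<^sub>C ell2_ip.gs (\<lambda>n. s n y) k)"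
  have g: "gen_section ?g"
    by (intro gen_section_diff gen_section_sum gen_section.base gen_section.scale less
        gen_section_cinner[OF s_meas])
  have "gen_section (\<lambda>y. complex_of_real (inverse (sqrt (Re (cinner (?g y) (?g y))))) *\<^sub>C ?g y)"
  proof (intro gen_section.scale g)
    have "(\<lambda>y. cinner (?g y) (?g y)) \<in> borel_measurable \<nu>"
      by (rule gen_section_cinner[OF _ g]) (use gen_section_msection[OF g] in \<open>simp add: msection_def\<close>)
    then show "(\<lambda>y. complex_of_real (inverse (sqrt (Re (cinner (?g y) (?g y)))))) \<in> borel_measurable \<nu>"
      by measurable
  qed
  then show ?case by (subst ell2_ip.gs_eq) simp_all
qed

text \<open>The pointwise projections of \<open>f\<close> are combinations of Gram-Schmidt sections
  with measurable coefficients. They converge to \<open>f\<close> because the fundamental sequence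
  spans a dense subspace of each fibre.\<close>

theorem msection_gen_section: "msection f \<Longrightarrow> gen_section f"
proof (rule gen_section.lim)
  assume f: "msection f"
  show "gen_section (\<lambda>y. ell2_ip.pr (\<lambda>n. s n y) (f y) n)" for n
  proof -
    have "gen_section (\<lambda>y. \<Sum>k<n. cinner (f y) (ell2_ip.gs (\<lambda>n. s n y) k) *\<^sub>C ell2_ip.gs (\<lambda>n. s n y) k)"
    proof (intro gen_section_sum gen_section.scale gen_section_gs)
      show "(\<lambda>y. cinner (f y) (ell2_ip.gs (\<lambda>n. s n y) k)) \<in> borel_measurable \<nu>" for k
        by (rule gen_section_cinner[OF _ gen_section_gs]) (use f in \<open>simp add: msection_def\<close>)
    qed
    then show ?thesis by (subst ell2_ip.pr_def) simp_all
  qed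
  show "(\<lambda>n. ell2_ip.pr (\<lambda>n. s n y) (f y) n) \<longlonglongrightarrow> f y" if "y \<in> space \<nu>" for y
    using f that s_total[OF that] by (intro pr_tendsto_ell2) (auto simp: msection_def)
qed

lemma msection_iff: "msection f \<longleftrightarrow> gen_section f"
  using msection_gen_section gen_section_msection by blast

lemma msection_add: "msection f \<Longrightarrow> msection g \<Longrightarrow> msection (\<lambda>y. f y + g y)"
  and msection_diff: "msection f \<Longrightarrow> msection g \<Longrightarrow> msection (\<lambda>y. f y - g y)"
  and msection_scale: "c \<in> borel_measurable \<nu> \<Longrightarrow> msection f \<Longrightarrow> msection (\<lambda>y. c y *\<^sub>C f y)"
  and msection_base: "msection (s n)"
  and msection_lim: "(\<And>n. msection (F n)) \<Longrightarrow> (\<And>y. y \<in> space \<nu> \<Longrightarrow> (\<lambda>n. F n y) \<longlonglongrightarrow> f y) \<Longrightarrow> msection f"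
  unfolding msection_iff by (fact gen_section.intros gen_section_diff)+

lemma msection_zero: "msection (\<lambda>y. 0)"
  using msection_diff[OF msection_base msection_base, of 0 0] by simp

lemma msection_in_H: "msection f \<Longrightarrow> y \<in> space \<nu> \<Longrightarrow> f y \<in> H y"
  by (simp add: msection_def)

lemma msection_cinner:
  assumes "msection f" "msection g"
  shows "(\<lambda>y. cinner (f y) (g y)) \<in> borel_measurable \<nu>"
  by (rule gen_section_cinner) (use assms in \<open>simp_all add: msection_def msection_gen_section\<close>)

lemma msection_norm:
  assumes "msection f"
  shows "(\<lambda>y. norm (f y)) \<in> borel_measurable \<nu>"
proof -
  have "(\<lambda>y. sqrt (Re (cinner (f y) (f y)))) \<in> borel_measurable \<nu>"
    using msection_cinner[OF assms assms] by measurable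
  then show ?thesis by (simp add: Re_cinner_self)
qed

end

section \<open>Measure-preserving actions\<close>

text \<open>The total mass is finite but not normalised to 1; its positivity and ergodicity are
  separate hypotheses of the results that use them.\<close>

locale pmp_action =
  fixes act :: "'g :: {topological_group_add, t2_space, second_countable_topology} \<Rightarrow> 'y \<Rightarrow> 'y"
    and \<mu> :: "'g measure" and \<nu> :: "'y measure"
  assumes lc: "locally_compact_space (euclidean :: 'g topology)"
    and haar: "left_haar_measure \<mu>"
    and gspace: "borel_G_space \<nu> act"
    and fin: "finite_measure \<nu>"
    and inv: "invariant_measure \<nu> act"
begin

sublocale finite_measure \<nu> by (rule fin)

lemmas sets_mu = haar_sets[OF haar]

lemma sigma_mu: "sigma_finite_measure \<mu>"
  by (rule haar_sigma_finite[OF haar lc])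

lemma act_joint: "(\<lambda>(g, y). act g y) \<in> measurable (borel \<Otimes>\<^sub>M \<nu>) \<nu>"
  and act_zero: "y \<in> space \<nu> \<Longrightarrow> act 0 y = y"
  and act_add: "y \<in> space \<nu> \<Longrightarrow> act (g + h) y = act g (act h y)"
  using gspace by (auto simp: borel_G_space_def)

lemma uminus_meas: "uminus \<in> borel_measurable (borel :: 'g measure)"
  by (intro borel_measurable_continuous_onI continuous_intros)

lemma act_inv_joint: "(\<lambda>x. act (- snd x) (fst x)) \<in> measurable (\<nu> \<Otimes>\<^sub>M borel) \<nu>"
  using measurable_compose[OF measurable_Pair[OF measurable_compose[OF measurable_snd uminus_meas]
      measurable_fst[of \<nu> borel]] act_joint] by simp

lemma act_meas: "act g \<in> measurable \<nu> \<nu>"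
  using measurable_compose[OF measurable_Pair1'[of g borel \<nu>] act_joint] by simp

lemma act_in_space: "y \<in> space \<nu> \<Longrightarrow> act g y \<in> space \<nu>"
  by (rule measurable_space[OF act_meas])

lemma distr_act: "distr \<nu> \<nu> (act g) = \<nu>"
  using inv by (simp add: invariant_measure_def)

lemma AE_act: "AE y in \<nu>. P y \<Longrightarrow> AE y in \<nu>. P (act g y)"
  by (rule AE_distrD[OF act_meas]) (simp only: distr_act)

lemma integral_act:
  fixes f :: "'y \<Rightarrow> 'a :: {banach, second_countable_topology}"
  assumes "f \<in> borel_measurable \<nu>"
  shows "(\<integral>y. f (act g y) \<partial>\<nu>) = (\<integral>y. f y \<partial>\<nu>)"
  using integral_distr[OF act_meas assms] by (simp add: distr_act)

lemma integrable_act: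
  fixes f :: "'y \<Rightarrow> 'a :: {banach, second_countable_topology}"
  assumes "integrable \<nu> f"
  shows "integrable \<nu> (\<lambda>y. f (act g y))"
  using integrable_distr[OF act_meas[of g], of f] assms by (simp add: distr_act)

text \<open>An almost invariant set \<open>A\<close> agrees almost everywhere with the strictly invariant set of the
  points whose orbit meets \<open>A\<close> in almost every group parameter.\<close>

lemma ergodic_almost_invariant:
  assumes erg: "ergodic_action \<nu> act" and A: "A \<in> sets \<nu>"
    and Ainv: "\<And>g. AE y in \<nu>. act (- g) y \<in> A \<longleftrightarrow> y \<in> A"
  shows "emeasure \<nu> A = 0 \<or> conull \<nu> A"
proof -
  interpret mu: sigma_finite_measure \<mu> by (rule sigma_mu)
  interpret p: pair_sigma_finite \<nu> \<mu> ..
  have aj: "(\<lambda>x. act (- snd x) (fst x)) \<in> measurable (\<nu> \<Otimes>\<^sub>M \<mu>) \<nu>"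
    using act_inv_joint by (simp cong: measurable_cong_sets sets_pair_measure_cong add: sets_mu)
  define B where "B = {x \<in> space (\<nu> \<Otimes>\<^sub>M \<mu>). act (- snd x) (fst x) \<notin> A}"
  have B: "B \<in> sets (\<nu> \<Otimes>\<^sub>M \<mu>)"
    unfolding B_def using aj A by measurable
  define A' where "A' = {y \<in> space \<nu>. emeasure \<mu> (Pair y -` B) = 0}"
  have A': "A' \<in> sets \<nu>"
    unfolding A'_def using mu.measurable_emeasure_Pair[OF B] by measurable
  have A'_iff: "y \<in> A' \<longleftrightarrow> y \<in> space \<nu> \<and> (AE g in \<mu>. act (- g) y \<in> A)" for y
  proof -
    have "emeasure \<mu> (Pair y -` B) = 0 \<longleftrightarrow> (AE g in \<mu>. act (- g) y \<in> A)" if y: "y \<in> space \<nu>"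
    proof (subst AE_iff_measurable[of "Pair y -` B"])
      show "Pair y -` B \<in> sets \<mu>" using B by (rule sets_Pair1)
    qed (use y in \<open>auto simp: B_def space_pair_measure\<close>)
    then show ?thesis by (auto simp: A'_def)
  qed
  have "act h ` A' = A'" for h
  proof -
    have sub: "act h y \<in> A'" if "y \<in> A'" for y h
    proof -
      have y: "y \<in> space \<nu>" "AE g in \<mu>. act (- g) y \<in> A" using that A'_iff by auto
      \<comment> \<open>Left invariance of Haar measure permits replacing \<open>g\<close> by
        \<open>- h + g\<close>, which turns the orbit map of \<open>y\<close> into that of
        \<open>act h y\<close>.\<close>
      have "AE g in \<mu>. act (- (- h + g)) y \<in> A"
        by (rule haar_AE_translate[OF haar y(2)])
      moreover have "act (- (- h + g)) y = act (- g) (act h y)" for g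
        using act_add[OF y(1), of "- g" h] by (simp add: minus_add)
      ultimately show ?thesis using y(1) act_in_space by (simp add: A'_iff)
    qed
    have "y \<in> act h ` A'" if "y \<in> A'" for y
    proof
      have "y \<in> space \<nu>" using that A'_iff by blast
      then show "y = act h (act (- h) y)" using act_add[of y h "- h"] act_zero by simp
    qed (rule sub[OF that])
    with sub show ?thesis by blast
  qed
  then have dich: "emeasure \<nu> A' = 0 \<or> conull \<nu> A'"
    using erg A' unfolding ergodic_action_def by blast
  have "{x \<in> space (\<nu> \<Otimes>\<^sub>M \<mu>). act (- snd x) (fst x) \<in> A \<longleftrightarrow> fst x \<in> A} \<in> sets (\<nu> \<Otimes>\<^sub>M \<mu>)"
    using aj A by measurable
  \<comment> \<open>Fubini exchanges the quantifiers: the exceptional null set of points, which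
    depended on \<open>g\<close>, becomes a null set of parameters for almost every point.\<close>
  then have "AE y in \<nu>. AE g in \<mu>. act (- g) y \<in> A \<longleftrightarrow> y \<in> A"
    by (subst p.AE_commute) (use Ainv in simp_all)
  then have "AE y in \<nu>. y \<in> A' \<longleftrightarrow> y \<in> A"
    using AE_space
  proof eventually_elim
    case (elim y)
    show ?case
    proof
      assume "y \<in> A'"
      then have "AE g in \<mu>. act (- g) y \<in> A" by (simp add: A'_iff)
      with elim(1) have "AE g in \<mu>. y \<in> A" by eventually_elim simp
      then show "y \<in> A" using haar_AE_ex[OF haar, of "\<lambda>g. y \<in> A"] by blast
    next
      assume "y \<in> A"
      with elim(1) have "AE g in \<mu>. act (- g) y \<in> A" by simp
      then show "y \<in> A'" using elim(2) by (simp add: A'_iff)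
    qed
  qed
  then have "emeasure \<nu> A' = emeasure \<nu> A" "emeasure \<nu> (space \<nu> - A') = emeasure \<nu> (space \<nu> - A)"
    using A A' by (auto intro!: emeasure_eq_AE)
  then show ?thesis using dich A by (auto simp: conull_def)
qed

end

section \<open>The Hilbert space of square-integrable sections\<close>

instance ell2 :: banach ..

text \<open>The finite intersections of a countable base form a countable pi-system. It serves to
  detect the vanishing of a function almost everywhere by countably many integrals.\<close>

lemma standard_borel_generator:
  assumes "standard_borel M"
  shows "\<exists>A :: nat \<Rightarrow> 'y set. Int_stable (range A) \<and> range A \<subseteq> sets M \<and>
    sets M = sigma_sets (space M) (range A)"
proof -
  obtain X where X: "second_countable X" "topspace X = space M"
    "sets M = sigma_sets (topspace X) {U. openin X U}"
    using assms unfolding standard_borel_def by blast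
  obtain \<B> where B: "countable \<B>" "\<forall>V\<in>\<B>. openin X V"
    "\<forall>U x. openin X U \<and> x \<in> U \<longrightarrow> (\<exists>V\<in>\<B>. x \<in> V \<and> V \<subseteq> U)"
    using X(1) unfolding second_countable_def by (elim exE conjE)
  define \<G> where "\<G> = (\<lambda>F. topspace X \<inter> \<Inter>F) ` {F. finite F \<and> F \<subseteq> \<B>}"
  have cG: "countable \<G>" "\<G> \<noteq> {}"
    unfolding \<G>_def using countable_Collect_finite_subset[OF B(1)] by auto
  have opG: "openin X U" if U: "U \<in> \<G>" for U
  proof -
    obtain F where F: "finite F" "F \<subseteq> \<B>" "U = topspace X \<inter> \<Inter>F" using U by (auto simp: \<G>_def)
    show ?thesis
    proof (cases "F = {}")
      case False
      then have "openin X (\<Inter>F)" using F B(2) by (intro openin_Inter) auto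
      then show ?thesis using F(3) by (auto intro: openin_Int)
    qed (use F in auto)
  qed
  have int: "Int_stable \<G>"
  proof (rule Int_stableI)
    fix a b assume "a \<in> \<G>" "b \<in> \<G>"
    then obtain F F' where "finite F" "F \<subseteq> \<B>" "a = topspace X \<inter> \<Inter>F"
      "finite F'" "F' \<subseteq> \<B>" "b = topspace X \<inter> \<Inter>F'" by (auto simp: \<G>_def)
    then show "a \<inter> b \<in> \<G>"
      unfolding \<G>_def by (intro image_eqI[of _ _ "F \<union> F'"]) auto
  qed
  have BG: "\<B> \<subseteq> \<G>"
  proof
    fix V assume V: "V \<in> \<B>"
    then have "V \<subseteq> topspace X" using B(2) openin_subset by blast
    then show "V \<in> \<G>" unfolding \<G>_def using V by (intro image_eqI[of _ _ "{V}"]) auto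
  qed
  have "sigma_sets (topspace X) {U. openin X U} = sigma_sets (topspace X) \<G>"
  proof (rule sigma_sets_eqI)
    fix U assume "U \<in> {U. openin X U}"
    then have "U = \<Union>{V\<in>\<B>. V \<subseteq> U}" using B(3) by blast
    also have "\<dots> \<in> sigma_sets (topspace X) \<G>"
      by (rule sigma_sets_UNION) (use B(1) BG in auto)
    finally show "U \<in> sigma_sets (topspace X) \<G>" .
  qed (auto intro: opG)
  moreover have "range (from_nat_into \<G>) = \<G>" by (rule range_from_nat_into[OF cG(2,1)])
  ultimately show ?thesis
    using int X opG by (intro exI[of _ "from_nat_into \<G>"]) auto
qed

text \<open>The sets over which \<open>h\<close> integrates to 0 form a Dynkin system containing the
  generator, hence include all measurable sets, in particular those where \<open>h\<close> is
  positive or negative.\<close>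

lemma AE_zero_if_integrals_zero_real:
  fixes h :: "'y \<Rightarrow> real" and A :: "nat \<Rightarrow> 'y set"
  assumes h: "integrable M h" and A: "Int_stable (range A)" "range A \<subseteq> sets M"
    "sets M = sigma_sets (space M) (range A)"
    and z: "\<And>k. (LINT y:A k|M. h y) = 0" "(\<integral>y. h y \<partial>M) = 0"
  shows "AE y in M. h y = 0"
proof -
  have si: "set_integrable M B h" if "B \<in> sets M" for B
    unfolding set_integrable_def using that h by (rule integrable_mult_indicator)
  have zero: "(LINT y:B|M. h y) = 0" if "B \<in> sets M" for B
  proof -
    have B: "B \<in> sigma_sets (space M) (range A)" using that A(3) by simp
    show ?thesis
    proof (induction rule: sigma_sets_induct_disjoint[OF A(1) _ B])
      case 1
      show ?case using A(2) sets.space_closed by blast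
    next
      case (2 B)
      then show ?case using z(1) by auto
    next
      case 3
      show ?case by (simp add: set_lebesgue_integral_def)
    next
      case (4 B)
      then have Bs: "B \<in> sets M" using A(3) by simp
      have "(LINT y:space M - B|M. h y) = (\<integral>y. h y - indicator B y *\<^sub>R h y \<partial>M)"
        unfolding set_lebesgue_integral_def
        by (rule Bochner_Integration.integral_cong) (auto simp: indicator_def)
      also have "\<dots> = (\<integral>y. h y \<partial>M) - (LINT y:B|M. h y)"
        unfolding set_lebesgue_integral_def using h si[OF Bs]
        by (subst Bochner_Integration.integral_diff) (auto simp: set_integrable_def)
      finally show ?case using 4 z(2) by simp
    next
      case (5 B)
      then have Bs: "B i \<in> sets M" for i using A(3) by auto
      have "(LINT y:(\<Union>i. B i)|M. h y) = (\<Sum>i. (LINT y:B i|M. h y))"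
        by (rule lebesgue_integral_countable_add) (use Bs 5(1) in \<open>auto intro!: si simp: disjoint_family_on_def\<close>)
      then show ?case using 5 by simp
    qed
  qed
  have le: "AE y in M. g y \<le> 0" if g: "integrable M g" "\<And>B. B \<in> sets M \<Longrightarrow> (LINT y:B|M. g y) = 0"
    for g :: "'y \<Rightarrow> real"
  proof -
    have [measurable]: "g \<in> borel_measurable M" using g(1) by simp
    let ?B = "{y \<in> space M. g y > 0}"
    have B: "?B \<in> sets M" by measurable
    have "AE y in M. indicator ?B y *\<^sub>R g y = 0"
      using g(2)[OF B] unfolding set_lebesgue_integral_def
      by (subst (asm) integral_nonneg_eq_0_iff_AE[OF integrable_mult_indicator[OF B g(1)]])
        (auto simp: indicator_def)
    then show ?thesis using AE_space by eventually_elim (auto simp: indicator_def split: if_splits)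
  qed
  have "AE y in M. h y \<le> 0" by (rule le[OF h zero])
  moreover have "AE y in M. - h y \<le> 0"
    by (rule le) (use h zero in \<open>auto simp: set_lebesgue_integral_def\<close>)
  ultimately show ?thesis by eventually_elim simp
qed

lemma AE_zero_if_integrals_zero:
  fixes h :: "'y \<Rightarrow> complex" and A :: "nat \<Rightarrow> 'y set"
  assumes h: "integrable M h" and A: "Int_stable (range A)" "range A \<subseteq> sets M"
    "sets M = sigma_sets (space M) (range A)"
    and z: "\<And>k. (\<integral>y. indicator (A k) y *\<^sub>R h y \<partial>M) = 0" "(\<integral>y. h y \<partial>M) = 0"
  shows "AE y in M. h y = 0"
proof -
  have i: "integrable M (\<lambda>y. indicator (A k) y *\<^sub>R h y)" for k
    by (rule integrable_mult_indicator[OF _ h]) (use A in auto)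
  have "(LINT y:A k|M. Re (h y)) = 0" "(LINT y:A k|M. Im (h y)) = 0" for k
    using integral_Re[OF i[of k]] integral_Im[OF i[of k]] z(1)[of k]
    by (simp_all add: set_lebesgue_integral_def)
  then have "AE y in M. Re (h y) = 0" "AE y in M. Im (h y) = 0"
    using z(2) h by (intro AE_zero_if_integrals_zero_real[OF _ A]; simp)+
  then show ?thesis by eventually_elim (simp add: complex_eq_iff)
qed

section \<open>Square-integrable sections: completeness and a countable total family\<close>

definition vscale :: "complex \<Rightarrow> ('y \<Rightarrow> ell2) \<Rightarrow> 'y \<Rightarrow> ell2" where
  "vscale c f = (\<lambda>y. c *\<^sub>C f y)"

locale l2_field = hilbert_field \<nu> H s + finite_measure \<nu>
  for \<nu> :: "'y measure" and H s
begin

definition L2 :: "('y \<Rightarrow> ell2) set" where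
  "L2 = {f. msection f \<and> integrable \<nu> (\<lambda>y. (norm (f y))\<^sup>2)}"

definition ip :: "('y \<Rightarrow> ell2) \<Rightarrow> ('y \<Rightarrow> ell2) \<Rightarrow> complex" where
  "ip f g = (\<integral>y. cinner (f y) (g y) \<partial>\<nu>)"

lemma L2_msection: "f \<in> L2 \<Longrightarrow> msection f"
  and L2_integrable: "f \<in> L2 \<Longrightarrow> integrable \<nu> (\<lambda>y. (norm (f y))\<^sup>2)"
  by (simp_all add: L2_def)

lemma L2_cinner_integrable:
  assumes "f \<in> L2" "g \<in> L2"
  shows "integrable \<nu> (\<lambda>y. cinner (f y) (g y))"
proof (rule Bochner_Integration.integrable_bound)
  show "integrable \<nu> (\<lambda>y. (norm (f y))\<^sup>2 + (norm (g y))\<^sup>2)"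
    using assms by (simp add: L2_integrable)
  show "(\<lambda>y. cinner (f y) (g y)) \<in> borel_measurable \<nu>"
    using assms by (intro msection_cinner L2_msection)
  have "cmod (cinner a b) \<le> (norm a)\<^sup>2 + (norm b)\<^sup>2" for a b
    by (rule order_trans[OF cinner_bound mult_le_sum_squares]) auto
  then show "AE y in \<nu>. norm (cinner (f y) (g y)) \<le> norm ((norm (f y))\<^sup>2 + (norm (g y))\<^sup>2)"
    by (auto intro: order_trans[OF _ abs_ge_self])
qed

lemma norm_add_sq_le: "(norm (a + b :: ell2))\<^sup>2 \<le> 2 * (norm a)\<^sup>2 + 2 * (norm b)\<^sup>2"
  using zero_le_power2[of "norm (a - b)"]
  by (simp add: power2_norm_eq_inner inner_add_left inner_add_right inner_diff_left inner_diff_right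
      inner_commute del: zero_le_power2)

lemma L2_add:
  assumes "f \<in> L2" "g \<in> L2"
  shows "(\<lambda>y. f y + g y) \<in> L2"
proof -
  have m: "msection (\<lambda>y. f y + g y)" using assms by (intro msection_add L2_msection)
  have "integrable \<nu> (\<lambda>y. (norm (f y + g y))\<^sup>2)"
  proof (rule Bochner_Integration.integrable_bound)
    show "integrable \<nu> (\<lambda>y. 2 * (norm (f y))\<^sup>2 + 2 * (norm (g y))\<^sup>2)"
      using assms by (simp add: L2_integrable)
    show "(\<lambda>y. (norm (f y + g y))\<^sup>2) \<in> borel_measurable \<nu>"
      using msection_norm[OF m] by measurable
    show "AE y in \<nu>. norm ((norm (f y + g y))\<^sup>2) \<le> norm (2 * (norm (f y))\<^sup>2 + 2 * (norm (g y))\<^sup>2)"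
      by (auto intro!: norm_add_sq_le)
  qed
  with m show ?thesis by (simp add: L2_def)
qed

lemma L2_scale: "f \<in> L2 \<Longrightarrow> vscale c f \<in> L2"
  by (auto simp: L2_def vscale_def norm_scaleC power_mult_distrib intro!: msection_scale)

lemma L2_zero: "(\<lambda>y. 0) \<in> L2"
  by (simp add: L2_def msection_zero)

sublocale l2: semi_inner vscale L2 ip
proof -
  interpret vs: vector_space "vscale :: complex \<Rightarrow> ('y \<Rightarrow> ell2) \<Rightarrow> _"
    by unfold_locales (auto simp: vscale_def fun_eq_iff ell2.scale_right_distrib ell2.scale_left_distrib)
  show "semi_inner vscale L2 ip"
  proof
    show "vs.subspace L2"
      using L2_zero L2_add L2_scale
      by (auto simp: vs.subspace_def plus_fun_def zero_fun_def)
  next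
    fix f g h assume "f \<in> L2" "g \<in> L2" "h \<in> L2"
    then show "ip (f + g) h = ip f h + ip g h"
      unfolding ip_def by (simp add: cinner_add_left L2_cinner_integrable)
  next
    fix f g c assume "f \<in> L2" "g \<in> L2"
    then show "ip (vscale c f) g = c * ip f g"
      unfolding ip_def by (simp add: vscale_def cinner_scaleC_left)
  next
    fix f g assume "f \<in> L2" "g \<in> L2"
    have "ip f g = (\<integral>y. cnj (cinner (g y) (f y)) \<partial>\<nu>)"
      unfolding ip_def by (subst cinner_commute) simp
    then show "ip f g = cnj (ip g f)" by (simp add: ip_def)
  next
    fix f assume "f \<in> L2"
    have "ip f f = complex_of_real (\<integral>y. (norm (f y))\<^sup>2 \<partial>\<nu>)"
      unfolding ip_def cinner_self by (rule integral_complex_of_real)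
    then show "0 \<le> Re (ip f f)" by simp
  qed
qed

lemma ip_self_eq: "ip f f = complex_of_real (\<integral>y. (norm (f y))\<^sup>2 \<partial>\<nu>)"
  unfolding ip_def cinner_self by (rule integral_complex_of_real)

lemma ip_self_zero_AE:
  assumes "f \<in> L2"
  shows "l2.sqnorm f = 0 \<longleftrightarrow> (AE y in \<nu>. f y = 0)"
  using integral_nonneg_eq_0_iff_AE[OF L2_integrable[OF assms]] by (simp add: ip_self_eq)

lemma l2_norm_add_le:
  assumes "f \<in> L2" "g \<in> L2"
  shows "l2.sqnorm (f + g) \<le> 2 * l2.sqnorm f + 2 * l2.sqnorm g"
proof -
  have "(\<integral>y. (norm (f y + g y))\<^sup>2 \<partial>\<nu>) \<le> (\<integral>y. 2 * (norm (f y))\<^sup>2 + 2 * (norm (g y))\<^sup>2 \<partial>\<nu>)"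
    using assms L2_add[OF assms]
    by (intro integral_mono norm_add_sq_le Bochner_Integration.integrable_add
        integrable_mult_right L2_integrable) auto
  also have "\<dots> = 2 * (\<integral>y. (norm (f y))\<^sup>2 \<partial>\<nu>) + 2 * (\<integral>y. (norm (g y))\<^sup>2 \<partial>\<nu>)"
    using assms by (simp add: L2_integrable)
  finally show ?thesis by (simp add: ip_self_eq)
qed

text \<open>Riesz--Fischer for a rapidly Cauchy sequence: \<open>a \<le> \<delta> + a\<^sup>2 / \<delta>\<close> with \<open>\<delta> = 2\<^sup>-\<^sup>j\<close> makes the
  increments summable almost everywhere.\<close>

lemma rapid_limit:
  assumes G: "\<And>j. G j \<in> L2"
    and rapid: "\<And>i j. j \<le> i \<Longrightarrow> l2.sqnorm (G i - G j) \<le> (1/4)^j"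
  shows "\<exists>f\<in>L2. \<forall>j. l2.sqnorm (G j - f) \<le> (1/4)^j"
proof -
  have Gd: "G i - G j \<in> L2" for i j by (intro l2.S_diff G)
  define D where "D j y = norm (G (Suc j) y - G j y)" for j y
  have Dm [measurable]: "D j \<in> borel_measurable \<nu>" for j
    unfolding D_def using msection_norm[OF msection_diff[OF L2_msection[OF G] L2_msection[OF G]]] .
  have D2: "integrable \<nu> (\<lambda>y. (D j y)\<^sup>2)" "(\<integral>y. (D j y)\<^sup>2 \<partial>\<nu>) \<le> (1/4)^j" for j
    using L2_integrable[OF Gd, of "Suc j" j] rapid[of j "Suc j"] by (simp_all add: D_def ip_self_eq)
  have bound: "D j y \<le> (1/2)^j + 2^j * (D j y)\<^sup>2" for j y
  proof (cases "D j y \<le> (1/2)^j")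
    case True
    then show ?thesis by (simp add: add_increasing2)
  next
    case False
    then have "1 * D j y \<le> (2^j * D j y) * D j y"
      by (intro mult_right_mono) (auto simp: D_def field_simps)
    moreover have "0 \<le> (1/2::real)^j" by simp
    ultimately show ?thesis unfolding power2_eq_square mult.assoc by linarith
  qed
  have nnD: "(\<integral>\<^sup>+y. ennreal (D j y) \<partial>\<nu>) \<le> ennreal ((1/2)^j * (measure \<nu> (space \<nu>) + 1))" for j
  proof -
    have "(\<integral>\<^sup>+y. ennreal (D j y) \<partial>\<nu>) \<le> (\<integral>\<^sup>+y. ennreal ((1/2)^j + 2^j * (D j y)\<^sup>2) \<partial>\<nu>)"
      by (intro nn_integral_mono ennreal_leI bound)
    also have "\<dots> = ennreal (\<integral>y. (1/2)^j + 2^j * (D j y)\<^sup>2 \<partial>\<nu>)"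
      using D2(1) by (intro nn_integral_eq_integral) auto
    also have "\<dots> \<le> ennreal ((1/2)^j * (measure \<nu> (space \<nu>) + 1))"
    proof (rule ennreal_leI)
      have "(\<integral>y. (1/2)^j + 2^j * (D j y)\<^sup>2 \<partial>\<nu>) = (1/2)^j * measure \<nu> (space \<nu>) + 2^j * (\<integral>y. (D j y)\<^sup>2 \<partial>\<nu>)"
        using D2(1) by simp
      also have "\<dots> \<le> (1/2)^j * measure \<nu> (space \<nu>) + 2^j * (1/4)^j"
        using D2(2) by simp
      also have "(2::real)^j * (1/4)^j = (1/2)^j"
        by (simp add: power_mult_distrib[symmetric])
      finally show "(\<integral>y. (1/2)^j + 2^j * (D j y)\<^sup>2 \<partial>\<nu>) \<le> (1/2)^j * (measure \<nu> (space \<nu>) + 1)"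
        by (simp add: ring_distribs)
    qed
    finally show ?thesis .
  qed
  have "(\<integral>\<^sup>+y. (\<Sum>j. ennreal (D j y)) \<partial>\<nu>) = (\<Sum>j. \<integral>\<^sup>+y. ennreal (D j y) \<partial>\<nu>)"
    by (intro nn_integral_suminf) measurable
  also have "\<dots> \<le> (\<Sum>j. ennreal ((1/2)^j * (measure \<nu> (space \<nu>) + 1)))"
    by (intro suminf_le nnD) auto
  also have "\<dots> < \<infinity>"
  proof -
    have "summable (\<lambda>j. (1/2)^j * (measure \<nu> (space \<nu>) + 1))"
      by (intro summable_mult2 summable_geometric) simp
    then have "(\<Sum>j. ennreal ((1/2)^j * (measure \<nu> (space \<nu>) + 1))) \<noteq> top"
      by (rule ennreal_suminf_neq_top) simp
    then show ?thesis by (simp only: infinity_ennreal_def less_top)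
  qed
  finally have AEfin: "AE y in \<nu>. (\<Sum>j. ennreal (D j y)) \<noteq> \<infinity>"
    by (intro nn_integral_PInf_AE) auto
  \<comment> \<open>The conull set on which the increments are summable. Off it the limit is set to
    0, which keeps \<open>f\<close> a measurable section.\<close>
  define C where "C = {y \<in> space \<nu>. (\<Sum>j. ennreal (D j y)) \<noteq> \<infinity>}"
  have C [measurable]: "C \<in> sets \<nu>" unfolding C_def by measurable
  have conv: "convergent (\<lambda>j. G j y)" if "y \<in> C" for y
  proof -
    have "summable (\<lambda>j. D j y)"
      using that by (intro summable_suminf_not_top) (auto simp: C_def D_def)
    then have "summable (\<lambda>j. G (Suc j) y - G j y)"
      unfolding D_def by (rule summable_norm_cancel)
    then have "convergent (\<lambda>n. \<Sum>j<n. G (Suc j) y - G j y)"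
      by (simp add: summable_iff_convergent)
    then have "convergent (\<lambda>n. (\<Sum>j<n. G (Suc j) y - G j y) + G 0 y)"
      by (intro convergent_add convergent_const)
    then show ?thesis using sum_lessThan_telescope[of "\<lambda>j. G j y"] by simp
  qed
  define f where "f y = (if y \<in> C then lim (\<lambda>j. G j y) else 0)" for y
  have limf: "(\<lambda>j. G j y) \<longlonglongrightarrow> f y" if "y \<in> C" for y
    using conv[OF that] that by (simp add: f_def convergent_LIMSEQ_iff)
  have fm: "msection f"
  proof (rule msection_lim)
    show "msection (\<lambda>y. (indicator C y :: complex) *\<^sub>C G j y)" for j
      by (intro msection_scale L2_msection G) measurable
    show "(\<lambda>j. (indicator C y :: complex) *\<^sub>C G j y) \<longlonglongrightarrow> f y" for y
      using limf[of y] by (auto simp: indicator_def f_def)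
  qed
  have "(\<lambda>y. f y - G j y) \<in> L2 \<and> (\<integral>y. (norm (f y - G j y))\<^sup>2 \<partial>\<nu>) \<le> (1/4)^j" for j
  proof -
    have dm: "msection (\<lambda>y. f y - G j y)" by (intro msection_diff fm L2_msection G)
    have meas: "(\<lambda>y. (norm (G i y - G j y))\<^sup>2) \<in> borel_measurable \<nu>" for i
      using msection_norm[OF msection_diff[OF L2_msection[OF G] L2_msection[OF G]], of i j] by measurable
    \<comment> \<open>Fatou's lemma transfers the bound on \<open>G i - G j\<close> to
      \<open>f - G j\<close>.\<close>
    have "(\<integral>\<^sup>+y. ennreal ((norm (f y - G j y))\<^sup>2) \<partial>\<nu>)
        = (\<integral>\<^sup>+y. liminf (\<lambda>i. ennreal ((norm (G i y - G j y))\<^sup>2)) \<partial>\<nu>)"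
    proof (rule nn_integral_cong_AE)
      show "AE y in \<nu>. ennreal ((norm (f y - G j y))\<^sup>2) = liminf (\<lambda>i. ennreal ((norm (G i y - G j y))\<^sup>2))"
        using AEfin AE_space
      proof eventually_elim
        case (elim y)
        then have "(\<lambda>i. G i y) \<longlonglongrightarrow> f y" by (intro limf) (simp add: C_def)
        then have "(\<lambda>i. ennreal ((norm (G i y - G j y))\<^sup>2)) \<longlonglongrightarrow> ennreal ((norm (f y - G j y))\<^sup>2)"
          by (intro tendsto_intros)
        then show ?case by (intro lim_imp_Liminf[symmetric]) auto
      qed
    qed
    also have "\<dots> \<le> liminf (\<lambda>i. \<integral>\<^sup>+y. ennreal ((norm (G i y - G j y))\<^sup>2) \<partial>\<nu>)"
      using meas by (intro nn_integral_liminf) auto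
    also have "\<dots> \<le> ennreal ((1/4)^j)"
    proof (rule Liminf_le)
      have "(\<integral>\<^sup>+y. ennreal ((norm (G i y - G j y))\<^sup>2) \<partial>\<nu>) \<le> ennreal ((1/4)^j)" if "j \<le> i" for i
        using rapid[OF that] L2_integrable[OF Gd, of i j]
        by (subst nn_integral_eq_integral) (auto simp: ip_self_eq intro!: ennreal_leI)
      then show "\<forall>\<^sub>F i in sequentially. (\<integral>\<^sup>+y. ennreal ((norm (G i y - G j y))\<^sup>2) \<partial>\<nu>) \<le> ennreal ((1/4)^j)"
        by (auto simp: eventually_sequentially)
    qed simp
    finally have le: "(\<integral>\<^sup>+y. ennreal ((norm (f y - G j y))\<^sup>2) \<partial>\<nu>) \<le> ennreal ((1/4)^j)" .
    have int: "integrable \<nu> (\<lambda>y. (norm (f y - G j y))\<^sup>2)"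
      by (rule integrableI_nonneg) (use msection_norm[OF dm] le in \<open>auto intro: le_less_trans\<close>)
    moreover have "(\<integral>y. (norm (f y - G j y))\<^sup>2 \<partial>\<nu>) \<le> (1/4)^j"
      using le nn_integral_eq_integral[OF int] by (simp add: ennreal_le_iff)
    ultimately show ?thesis using dm by (simp add: L2_def)
  qed
  then have L: "(\<lambda>y. f y - G j y) \<in> L2" "(\<integral>y. (norm (f y - G j y))\<^sup>2 \<partial>\<nu>) \<le> (1/4)^j" for j by auto
  have "(\<lambda>y. (f y - G 0 y) + G 0 y) \<in> L2" by (intro L2_add L G)
  then have "f \<in> L2" by simp
  then show ?thesis
    using L(2) by (intro bexI[of _ f]) (auto simp: ip_self_eq norm_minus_commute)
qed

text \<open>A Cauchy sequence has a rapidly Cauchy subsequence, and the limit of the subsequence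
  attracts the whole sequence.\<close>

theorem l2_complete: "l2.ip_complete"
  unfolding l2.ip_complete_def
proof (intro allI impI, elim conjE)
  fix F :: "nat \<Rightarrow> 'y \<Rightarrow> ell2"
  assume FL: "\<forall>n. F n \<in> L2"
    and F: "\<forall>e>0. \<exists>N. \<forall>m\<ge>N. \<forall>n\<ge>m. l2.sqnorm (F n - F m) < e"
  have "\<forall>j :: nat. \<exists>N. \<forall>m\<ge>N. \<forall>n\<ge>m. l2.sqnorm (F n - F m) < (1/4)^j"
    using F by simp
  then obtain M :: "nat \<Rightarrow> nat" where M: "\<forall>j :: nat. \<forall>m\<ge>M j. \<forall>n\<ge>m. l2.sqnorm (F n - F m) < (1/4)^j"
    by (rule choice[THEN exE])
  \<comment> \<open>Summing the thresholds gives indices that are monotone and still lie beyond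
    \<open>M j\<close>.\<close>
  define r where "r j = (\<Sum>i\<le>j. M i)" for j :: nat
  have rM: "M j \<le> r j" for j unfolding r_def by (intro member_le_sum) auto
  have rmono: "r j \<le> r i" if "j \<le> i" for i j unfolding r_def using that by (intro sum_mono2) auto
  have "\<exists>f\<in>L2. \<forall>j. l2.sqnorm (F (r j) - f) \<le> (1/4)^j"
    by (rule rapid_limit[of "\<lambda>j. F (r j)"]) (use FL M rM rmono in \<open>auto intro: less_imp_le\<close>)
  then obtain f where f: "f \<in> L2" "\<And>j. l2.sqnorm (F (r j) - f) \<le> (1/4)^j" by auto
  have le: "l2.sqnorm (F n - f) \<le> 4 * (1/4)^j" if "n \<ge> r j" for n j
  proof -
    have "l2.sqnorm ((F n - F (r j)) + (F (r j) - f))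
        \<le> 2 * l2.sqnorm (F n - F (r j)) + 2 * l2.sqnorm (F (r j) - f)"
      using FL f(1) by (intro l2_norm_add_le l2.S_diff) auto
    also have "l2.sqnorm (F n - F (r j)) \<le> (1/4)^j"
      using M rM[of j] that by (auto intro: less_imp_le)
    also note f(2)[of j]
    finally show ?thesis by simp
  qed
  have "(\<lambda>n. l2.sqnorm (F n - f)) \<longlonglongrightarrow> 0"
  proof (rule LIMSEQ_I)
    fix e :: real assume e: "e > 0"
    obtain j where j: "(1/4)^j < e / 4" using real_arch_pow_inv[of "e/4" "1/4"] e by auto
    have "norm (l2.sqnorm (F n - f) - 0) < e" if "n \<ge> r j" for n
      using le[OF that] j l2.ip_nonneg[OF l2.S_diff, of "F n" f] FL f(1) by auto
    then show "\<exists>N. \<forall>n\<ge>N. norm (l2.sqnorm (F n - f) - 0) < e" by blast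
  qed
  with f(1) show "\<exists>f\<in>L2. (\<lambda>n. l2.sqnorm (F n - f)) \<longlonglongrightarrow> 0" by blast
qed

text \<open>The fundamental sections may fail to be square-integrable. Dividing by a nonvanishing
  factor brings their norms below 1, which is integrable for a finite measure, and keeps the span in
  each fibre.\<close>

definition unit_s :: "nat \<Rightarrow> 'y \<Rightarrow> ell2" where
  "unit_s n y = complex_of_real (1 / (1 + norm (s n y))) *\<^sub>C s n y"

lemma unit_s_L2: "A \<in> sets \<nu> \<Longrightarrow> (\<lambda>y. (indicator A y :: complex) *\<^sub>C unit_s n y) \<in> L2"
proof -
  assume [measurable]: "A \<in> sets \<nu>"
  have [measurable]: "(\<lambda>y. norm (s n y)) \<in> borel_measurable \<nu>"
    by (rule msection_norm[OF msection_base])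
  have m: "msection (\<lambda>y. (indicator A y :: complex) *\<^sub>C unit_s n y)"
    unfolding unit_s_def by (intro msection_scale msection_base) measurable
  have le: "norm ((indicator A y :: complex) *\<^sub>C unit_s n y) \<le> 1" for y
  proof -
    have "norm (s n y) / (1 + norm (s n y)) \<le> 1" using norm_ge_zero[of "s n y"] by (subst divide_le_eq_1_pos) linarith+
    then show ?thesis
      by (auto simp: norm_scaleC unit_s_def indicator_def norm_divide simp flip: of_real_add)
  qed
  have "integrable \<nu> (\<lambda>y. (norm ((indicator A y :: complex) *\<^sub>C unit_s n y))\<^sup>2)"
    by (rule integrable_const_bound[of _ 1])
      (use msection_norm[OF m] le in \<open>auto intro!: power_le_one\<close>)
  with m show ?thesis by (simp add: L2_def)
qed

text \<open>The total family consists of the bounded sections \<open>unit_s n\<close> cut off to the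
  sets of a countable generator. Orthogonality to all of them makes the pointwise inner products
  with \<open>s n\<close> vanish almost everywhere, and the fundamental sequence is total in each
  fibre.\<close>

lemma l2_total:
  assumes "standard_borel \<nu>"
  shows "\<exists>d :: nat \<Rightarrow> 'y \<Rightarrow> ell2. (\<forall>n. d n \<in> L2) \<and>
    (\<forall>f\<in>L2. (\<forall>n. ip f (d n) = 0) \<longrightarrow> l2.sqnorm f = 0)"
proof -
  obtain A :: "nat \<Rightarrow> 'y set" where "Int_stable (range A) \<and> range A \<subseteq> sets \<nu> \<and>
    sets \<nu> = sigma_sets (space \<nu>) (range A)"
    using standard_borel_generator[OF assms] ..
  then have A: "Int_stable (range A)" "range A \<subseteq> sets \<nu>" "sets \<nu> = sigma_sets (space \<nu>) (range A)"
    by auto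
  \<comment> \<open>Index 0 is reserved for the whole space, because the Dynkin argument also needs
    the total integral to vanish.\<close>
  define B where "B k = (case k of 0 \<Rightarrow> space \<nu> | Suc k \<Rightarrow> A k)" for k
  have B: "B k \<in> sets \<nu>" for k using A(2) by (auto simp: B_def split: nat.split)
  define d where "d m = (case prod_decode m of (k, n) \<Rightarrow> \<lambda>y. (indicator (B k) y :: complex) *\<^sub>C unit_s n y)" for m
  show ?thesis
  proof (intro exI[of _ d] conjI allI ballI impI)
    show "d n \<in> L2" for n unfolding d_def using unit_s_L2[OF B] by (auto split: prod.split)
  next
    fix f assume f: "f \<in> L2" and z: "\<forall>n. ip f (d n) = 0"
    have z': "(\<integral>y. indicator (B k) y *\<^sub>R cinner (f y) (unit_s n y) \<partial>\<nu>) = 0" for k n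
    proof -
      have "ip f (d (prod_encode (k, n))) = (\<integral>y. indicator (B k) y *\<^sub>R cinner (f y) (unit_s n y) \<partial>\<nu>)"
        unfolding ip_def d_def
        by (rule Bochner_Integration.integral_cong) (auto simp: cinner_scaleC_right indicator_def)
      then show ?thesis using z by simp
    qed
    have int: "integrable \<nu> (\<lambda>y. cinner (f y) (unit_s n y))" for n
      using L2_cinner_integrable[OF f unit_s_L2[of "space \<nu>" n]]
      by (simp cong: Bochner_Integration.integrable_cong)
    have "AE y in \<nu>. cinner (f y) (unit_s n y) = 0" for n
    proof (rule AE_zero_if_integrals_zero[OF int A])
      show "(\<integral>y. indicator (A k) y *\<^sub>R cinner (f y) (unit_s n y) \<partial>\<nu>) = 0" for k
        using z'[of "Suc k" n] by (simp add: B_def)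
      show "(\<integral>y. cinner (f y) (unit_s n y) \<partial>\<nu>) = 0"
        using z'[of 0 n] by (simp add: B_def cong: Bochner_Integration.integral_cong)
    qed
    then have "AE y in \<nu>. \<forall>n. cinner (f y) (unit_s n y) = 0"
      by (simp add: AE_all_countable)
    then have "AE y in \<nu>. f y = 0"
      using AE_space
    proof eventually_elim
      case (elim y)
      have "cinner (f y) (s n y) = 0" for n
      proof -
        have "1 + norm (s n y) \<noteq> 0" using norm_ge_zero[of "s n y"] by linarith
        then show ?thesis
          using elim(1)[rule_format, of n] by (simp add: unit_s_def cinner_scaleC_right flip: of_real_add)
      qed
      then have "cinner (f y) v = 0" if "v \<in> range (\<lambda>n. s n y)" for v
        using that by auto
      then have "cinner (f y) (f y) = 0"
        by (rule cinner_closure_span_eq_0[of "range (\<lambda>n. s n y)"])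
          (use elim(2) s_total msection_in_H[OF L2_msection[OF f]] in auto)
      then show ?case by (simp add: cinner_self)
    qed
    then show "l2.sqnorm f = 0" by (simp add: ip_self_zero_AE[OF f])
  qed
qed

theorem l2_embedding:
  assumes "standard_borel \<nu>"
  obtains \<Phi> where "hilbert_subspace (\<Phi> ` L2)"
    "\<And>f g. f \<in> L2 \<Longrightarrow> g \<in> L2 \<Longrightarrow> \<Phi> (f + g) = \<Phi> f + \<Phi> g"
    "\<And>c f. f \<in> L2 \<Longrightarrow> \<Phi> (vscale c f) = c *\<^sub>C \<Phi> f"
    "\<And>f g. f \<in> L2 \<Longrightarrow> g \<in> L2 \<Longrightarrow> cinner (\<Phi> f) (\<Phi> g) = ip f g"
proof -
  obtain d :: "nat \<Rightarrow> 'y \<Rightarrow> ell2" where d: "(\<forall>n. d n \<in> L2) \<and>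
    (\<forall>f\<in>L2. (\<forall>n. ip f (d n) = 0) \<longrightarrow> l2.sqnorm f = 0)"
    using l2_total[OF assms] ..
  then have d1: "\<And>n. d n \<in> L2" and d2: "\<And>f. f \<in> L2 \<Longrightarrow> (\<And>n. ip f (d n) = 0) \<Longrightarrow> l2.sqnorm f = 0"
    by simp_all
  show thesis
  proof (rule l2.ell2_embedding[OF d1 l2_complete])
    show "l2.sqnorm f = 0" if "f \<in> L2" "\<And>n. ip f (d n) = 0" for f
      using that by (rule d2)
  qed (rule that)
qed

end

section \<open>The unitary representation on square-integrable sections\<close>

text \<open>Surjectivity comes from the group law: \<open>\<pi> 0\<close> is the identity, as an
  idempotent injective map, so \<open>\<pi> (- g)\<close> inverts \<open>\<pi> g\<close>. The
  continuity obligation may already use that the operators are unitary.\<close>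

lemma unitary_repI:
  fixes \<pi> :: "'g :: topological_group_add \<Rightarrow> ell2 \<Rightarrow> ell2"
  assumes K: "hilbert_subspace K" and in_K: "\<And>g x. x \<in> K \<Longrightarrow> \<pi> g x \<in> K"
    and add: "\<And>g x y. x \<in> K \<Longrightarrow> y \<in> K \<Longrightarrow> \<pi> g (x + y) = \<pi> g x + \<pi> g y"
    and scale: "\<And>g c x. x \<in> K \<Longrightarrow> \<pi> g (c *\<^sub>C x) = c *\<^sub>C \<pi> g x"
    and cinner: "\<And>g x y. x \<in> K \<Longrightarrow> y \<in> K \<Longrightarrow> cinner (\<pi> g x) (\<pi> g y) = cinner x y"
    and mult: "\<And>g h x. x \<in> K \<Longrightarrow> \<pi> (g + h) x = \<pi> g (\<pi> h x)"
    and cont: "(\<And>g. hilbert_iso K K (\<pi> g)) \<Longrightarrow> (\<And>x. x \<in> K \<Longrightarrow> continuous_on UNIV (\<lambda>g. \<pi> g x))"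
  shows "unitary_rep K \<pi>"
proof -
  have diff: "\<pi> g (x - y) = \<pi> g x - \<pi> g y" if "x \<in> K" "y \<in> K" for g x y
    using add[of "x - y" y g] that hilbert_subspaceD(4)[OF K] by simp
  have nrm: "norm (\<pi> g x) = norm x" if "x \<in> K" for g x
    using cinner[OF that that] by (simp add: norm_ell2_def inner_ell2_def)
  have inj: "x = y" if "x \<in> K" "y \<in> K" "\<pi> g x = \<pi> g y" for g x y
    using nrm[of "x - y" g] diff[of x y g] that hilbert_subspaceD(4)[OF K] by simp
  have zero: "\<pi> 0 x = x" if "x \<in> K" for x
    by (rule inj[of _ _ 0]) (use that in_K mult[of x 0 0] in auto)
  have iso: "hilbert_iso K K (\<pi> g)" for g
    unfolding hilbert_iso_def
  proof (intro conjI ballI allI)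
    show "bij_betw (\<pi> g) K K"
      unfolding bij_betw_def
    proof
      show "inj_on (\<pi> g) K" using inj by (auto intro: inj_onI)
      show "\<pi> g ` K = K"
      proof
        show "K \<subseteq> \<pi> g ` K"
        proof
          fix x assume "x \<in> K"
          then show "x \<in> \<pi> g ` K"
            using mult[of x g "- g"] zero[of x] in_K[of x "- g"]
            by (intro image_eqI[of _ _ "\<pi> (- g) x"]) auto
        qed
      qed (use in_K in auto)
    qed
  qed (use add scale cinner in auto)
  with K mult cont[OF iso] show ?thesis unfolding unitary_rep_def by auto
qed

lemma AE_pair_swap:
  assumes "sigma_finite_measure M" "sigma_finite_measure N" "AE (x, y) in M \<Otimes>\<^sub>M N. P x y"
  shows "AE y in N. AE x in M. P x y"
proof -
  interpret M: sigma_finite_measure M by fact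
  interpret N: sigma_finite_measure N by fact
  interpret MN: pair_sigma_finite M N ..
  interpret NM: pair_sigma_finite N M ..
  have "AE z in N \<Otimes>\<^sub>M M. case (case z of (y, x) \<Rightarrow> (x, y)) of (x, y) \<Rightarrow> P x y"
    by (rule AE_distrD[OF measurable_pair_swap', of "case_prod P"])
      (use assms(3) in \<open>simp only: MN.distr_pair_swap[symmetric]\<close>)
  then have "AE z in N \<Otimes>\<^sub>M M. P (snd z) (fst z)"
    by (simp add: split_beta')
  from NM.AE_pair[OF this] show ?thesis by simp
qed

section \<open>The operators of a groupoid representation on square-integrable sections\<close>

locale action_field = pmp_action act \<mu> \<nu> + l2_field \<nu> H s
  for act :: "'g :: {topological_group_add, t2_space, second_countable_topology} \<Rightarrow> 'y \<Rightarrow> 'y"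
    and \<mu> :: "'g measure" and \<nu> :: "'y measure" and H s +
  fixes L :: "'y \<Rightarrow> 'g \<Rightarrow> ell2 \<Rightarrow> ell2"
  assumes rep: "action_rep \<nu> act H s L"
begin

lemma L_iso: "y \<in> space \<nu> \<Longrightarrow> hilbert_iso (H (act (- g) y)) (H y) (L y g)"
  using rep by (simp add: action_rep_def)

lemmas L_isoD = hilbert_isoD[OF L_iso H_hilbert[OF act_in_space]]

abbreviation pull :: "('y \<Rightarrow> ell2) \<Rightarrow> 'y \<times> 'g \<Rightarrow> ell2" where
  "pull f x \<equiv> L (fst x) (snd x) (f (act (- snd x) (fst x)))"

text \<open>A representation is required to have Borel coefficients for the fundamental sections
  only. Linearity and continuity of \<open>L y g\<close> extend this along the generation of
  measurable sections, here in the argument \<open>f\<close> and afterwards in the second argument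
  of the inner product.\<close>

lemma L_joint_base:
  assumes "gen_section f"
  shows "(\<lambda>x. cinner (pull f x) (s m (fst x)))
    \<in> borel_measurable (\<nu> \<Otimes>\<^sub>M borel)"
  using assms
proof induction
  case (base n)
  show ?case using rep by (simp add: action_rep_def split_beta')
next
  case (add f f')
  have "(\<lambda>x. cinner (pull f x) (s m (fst x)) +
      cinner (pull f' x) (s m (fst x)))
    \<in> borel_measurable (\<nu> \<Otimes>\<^sub>M borel)"
    using add.IH by (rule borel_measurable_add)
  then show ?case
    by (rule measurable_cong[THEN iffD1, rotated])
      (auto simp: space_pair_measure L_isoD cinner_add_left gen_section_in_H add.hyps act_in_space)
next
  case (scale c f)
  have "(\<lambda>x. c (act (- snd x) (fst x)) *
      cinner (pull f x) (s m (fst x)))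
    \<in> borel_measurable (\<nu> \<Otimes>\<^sub>M borel)"
    by (intro borel_measurable_times scale.IH measurable_compose[OF act_inv_joint scale.hyps(1)])
  then show ?case
    by (rule measurable_cong[THEN iffD1, rotated])
      (auto simp: space_pair_measure L_isoD cinner_scaleC_left gen_section_in_H scale.hyps act_in_space)
next
  case (lim F f)
  show ?case
  proof (rule borel_measurable_LIMSEQ_metric)
    fix x assume "x \<in> space (\<nu> \<Otimes>\<^sub>M (borel :: 'g measure))"
    then have y: "fst x \<in> space \<nu>" by (auto simp: space_pair_measure)
    let ?z = "act (- snd x) (fst x)"
    have z: "?z \<in> space \<nu>" by (rule act_in_space[OF y])
    have F: "F n ?z \<in> H ?z" for n using lim.hyps(1) z by (rule gen_section_in_H)
    have f: "f ?z \<in> H ?z" using lim.hyps z by (intro gen_section_in_H[OF gen_section.lim])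
    have "(\<lambda>n. L (fst x) (snd x) (F n ?z)) \<longlonglongrightarrow> L (fst x) (snd x) (f ?z)"
      by (rule hilbert_iso_tendsto[OF L_iso[OF y] H_hilbert[OF z] F f lim.hyps(2)[OF z]])
    then show "(\<lambda>n. cinner (L (fst x) (snd x) (F n ?z)) (s m (fst x)))
        \<longlonglongrightarrow> cinner (L (fst x) (snd x) (f ?z)) (s m (fst x))"
      by (intro tendsto_cinner tendsto_const)
  qed (rule lim.IH)
qed

lemma L_joint:
  assumes "gen_section f" "gen_section h"
  shows "(\<lambda>x. cinner (pull f x) (h (fst x)))
    \<in> borel_measurable (\<nu> \<Otimes>\<^sub>M borel)"
  using assms(2)
proof induction
  case (base n)
  show ?case by (rule L_joint_base[OF assms(1)])
next
  case (scale c h)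
  have "(\<lambda>x. cnj (c (fst x))) \<in> borel_measurable (\<nu> \<Otimes>\<^sub>M borel)"
    by (rule borel_measurable_cnj[OF measurable_compose[OF measurable_fst scale.hyps(1)]])
  then show ?case unfolding cinner_scaleC_right using scale.IH by (rule borel_measurable_times)
next
  case (lim F h)
  show ?case
    by (rule borel_measurable_LIMSEQ_metric[OF lim.IH])
      (auto simp: space_pair_measure intro!: tendsto_cinner lim.hyps)
qed (simp add: cinner_add_right)

definition trans :: "'g \<Rightarrow> ('y \<Rightarrow> ell2) \<Rightarrow> 'y \<Rightarrow> ell2" where
  "trans g f y = L y g (f (act (- g) y))"

lemma trans_cinner_joint:
  assumes "msection f" "msection h"
  shows "(\<lambda>(g, y). cinner (trans g f y) (h y)) \<in> borel_measurable (borel \<Otimes>\<^sub>M \<nu>)"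
  using measurable_compose[OF measurable_pair_swap' L_joint[of f h]] assms
  by (simp add: msection_iff trans_def split_beta')

lemma trans_msection:
  assumes "msection f"
  shows "msection (trans g f)"
  unfolding msection_def
proof (intro conjI ballI allI)
  fix y assume y: "y \<in> space \<nu>"
  then show "trans g f y \<in> H y"
    unfolding trans_def using assms by (intro L_isoD(1) msection_in_H act_in_space)
next
  fix n
  show "(\<lambda>y. cinner (trans g f y) (s n y)) \<in> borel_measurable \<nu>"
    using measurable_compose[OF measurable_Pair1'[of g borel \<nu>]
        trans_cinner_joint[OF assms msection_base[of n]]] by simp
qed

lemma trans_cinner:
  assumes "msection f" "msection h" "y \<in> space \<nu>"
  shows "cinner (trans g f y) (trans g h y) = cinner (f (act (- g) y)) (h (act (- g) y))"
  unfolding trans_def using assms by (intro L_isoD(5) msection_in_H act_in_space)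

lemma trans_norm:
  assumes "msection f" "y \<in> space \<nu>"
  shows "norm (trans g f y) = norm (f (act (- g) y))"
  unfolding trans_def using assms by (intro L_isoD(6) msection_in_H act_in_space)

lemma trans_L2:
  assumes "f \<in> L2"
  shows "trans g f \<in> L2"
proof -
  have "integrable \<nu> (\<lambda>y. (norm (trans g f y))\<^sup>2)
      \<longleftrightarrow> integrable \<nu> (\<lambda>y. (norm (f (act (- g) y)))\<^sup>2)"
    by (rule Bochner_Integration.integrable_cong) (auto simp: trans_norm L2_msection[OF assms])
  then show ?thesis
    using integrable_act[OF L2_integrable[OF assms]] trans_msection[OF L2_msection[OF assms]]
    by (simp add: L2_def)
qed

lemma ip_trans:
  assumes "f \<in> L2" "h \<in> L2"
  shows "ip (trans g f) (trans g h) = ip f h"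
proof -
  have "ip (trans g f) (trans g h) = (\<integral>y. cinner (f (act (- g) y)) (h (act (- g) y)) \<partial>\<nu>)"
    unfolding ip_def
    by (rule Bochner_Integration.integral_cong) (auto simp: trans_cinner L2_msection assms)
  also have "\<dots> = ip f h"
    unfolding ip_def
    by (rule integral_act) (use assms in \<open>intro msection_cinner L2_msection\<close>)
  finally show ?thesis .
qed

text \<open>Multiplicativity of \<open>L\<close> is available only while all three base points lie
  in \<open>U\<close>. For fixed \<open>g\<close> and \<open>h\<close> this holds for almost every
  \<open>y\<close>, since the translates of the conull set \<open>U\<close> are conull by invariance
  of \<nu>.\<close>

lemma trans_mult:
  assumes "f \<in> L2"
  shows "AE y in \<nu>. trans (g + h) f y = trans g (trans h f) y"
proof -
  obtain U where U: "conull \<nu> U" "\<forall>y g h. y \<in> U \<and> act (- g) y \<in> U \<and> act (- (g + h)) y \<in> U \<longrightarrow>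
      (\<forall>v \<in> H (act (- (g + h)) y). L y (g + h) v = L y g (L (act (- g) y) h v))"
    using rep unfolding action_rep_def by (elim conjE exE)
  have AEU: "AE y in \<nu>. y \<in> U"
    by (rule AE_I[of _ _ "space \<nu> - U"]) (use U(1) in \<open>auto simp: conull_def\<close>)
  show ?thesis
    using AEU AE_act[OF AEU, of "- g"] AE_act[OF AEU, of "- (g + h)"] AE_space
  proof eventually_elim
    case (elim y)
    have "act (- (g + h)) y = act (- h) (act (- g) y)"
      using act_add[OF elim(4), of "- h" "- g"] by (simp add: minus_add)
    moreover have "f (act (- (g + h)) y) \<in> H (act (- (g + h)) y)"
      by (rule msection_in_H[OF L2_msection[OF assms] act_in_space[OF elim(4)]])
    then have "L y (g + h) (f (act (- (g + h)) y)) = L y g (L (act (- g) y) h (f (act (- (g + h)) y)))"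
      using U(2) elim(1-3) by blast
    ultimately show ?case unfolding trans_def by simp
  qed
qed

lemma AE_trans_cong:
  assumes "AE y in \<nu>. f y = h y"
  shows "AE y in \<nu>. trans g f y = trans g h y"
  using AE_act[OF assms, of "- g"] by eventually_elim (simp add: trans_def)

lemma unit_section_L2:
  assumes "borel_unit_section \<nu> H s \<xi>"
  shows "\<xi> \<in> L2" "ip \<xi> \<xi> = complex_of_real (measure \<nu> (space \<nu>))"
proof -
  have \<xi>: "msection \<xi>" "AE y in \<nu>. norm (\<xi> y) = 1"
    using assms by (auto simp: borel_unit_section_def msection_def)
  have "integrable \<nu> (\<lambda>y. (norm (\<xi> y))\<^sup>2)"
    by (rule integrable_const_bound[of _ 1])
      (use \<xi> msection_norm[OF \<xi>(1)] in auto)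
  with \<xi> show "\<xi> \<in> L2" by (simp add: L2_def)
  have "(\<integral>y. (norm (\<xi> y))\<^sup>2 \<partial>\<nu>) = (\<integral>y. 1 \<partial>\<nu>)"
    by (rule integral_cong_AE) (use \<xi> msection_norm[OF \<xi>(1)] in auto)
  then show "ip \<xi> \<xi> = complex_of_real (measure \<nu> (space \<nu>))"
    by (simp add: ip_self_eq)
qed

text \<open>Dominated convergence: both sections have norm 1 almost everywhere, so the squared norm
  of their difference is at most 4.\<close>

lemma trans_defect_tendsto:
  assumes \<xi>: "\<And>n. borel_unit_section \<nu> H s (\<xi> n)"
    and lim: "AE y in \<nu>. (\<lambda>n. norm (\<xi> n y - trans g (\<xi> n) y)) \<longlonglongrightarrow> 0"
  shows "(\<lambda>n. l2.sqnorm (trans g (\<xi> n) - \<xi> n)) \<longlonglongrightarrow> 0"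
proof -
  have ms: "msection (\<xi> n)" for n using unit_section_L2[OF \<xi>] by (simp add: L2_def)
  have md: "msection (\<lambda>y. trans g (\<xi> n) y - \<xi> n y)" for n
    by (intro msection_diff trans_msection ms)
  have one: "AE y in \<nu>. norm (\<xi> n y) = 1" for n using \<xi> by (simp add: borel_unit_section_def)
  have "(\<lambda>n. \<integral>y. (norm (trans g (\<xi> n) y - \<xi> n y))\<^sup>2 \<partial>\<nu>) \<longlonglongrightarrow> (\<integral>y. 0 \<partial>\<nu>)"
  proof (rule integral_dominated_convergence[where w = "\<lambda>_. 4"])
    show "(\<lambda>y. (norm (trans g (\<xi> n) y - \<xi> n y))\<^sup>2) \<in> borel_measurable \<nu>" for n
      using msection_norm[OF md] by measurable
    show "AE y in \<nu>. (\<lambda>n. (norm (trans g (\<xi> n) y - \<xi> n y))\<^sup>2) \<longlonglongrightarrow> 0"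
      using lim
    proof eventually_elim
      case (elim y)
      then have "(\<lambda>n. (norm (\<xi> n y - trans g (\<xi> n) y))\<^sup>2) \<longlonglongrightarrow> 0\<^sup>2" by (intro tendsto_intros)
      then show ?case by (simp add: norm_minus_commute)
    qed
    show "AE y in \<nu>. norm ((norm (trans g (\<xi> n) y - \<xi> n y))\<^sup>2) \<le> 4" for n
      using one[of n] AE_act[OF one[of n], of "- g"] AE_space
    proof eventually_elim
      case (elim y)
      then have "norm (trans g (\<xi> n) y - \<xi> n y) \<le> 2"
        using norm_triangle_ineq4[of "trans g (\<xi> n) y" "\<xi> n y"] trans_norm[OF ms elim(3)] by simp
      then have "(norm (trans g (\<xi> n) y - \<xi> n y))\<^sup>2 \<le> 2\<^sup>2" by (intro power_mono) auto
      then show ?case by simp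
    qed
  qed auto
  then show ?thesis by (simp add: ip_self_eq)
qed

theorem property_T_invariant_section:
  assumes T: "kazhdan_property_T TYPE('g)"
    and erg: "ergodic_action \<nu> act" and nz: "emeasure \<nu> (space \<nu>) \<noteq> 0"
    and \<xi>: "\<And>n. borel_unit_section \<nu> H s (\<xi> n)"
    and lim: "AE (y, g) in \<nu> \<Otimes>\<^sub>M \<mu>. (\<lambda>n. norm (\<xi> n y - L y g (\<xi> n (act (- g) y)))) \<longlonglongrightarrow> 0"
  shows "\<exists>\<xi>. borel_unit_section \<nu> H s \<xi> \<and>
    (AE (y, g) in \<nu> \<Otimes>\<^sub>M \<mu>. \<xi> y = L y g (\<xi> (act (- g) y)))"
proof -
  have "standard_borel \<nu>" using gspace by (simp add: borel_G_space_def)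
  then obtain \<Phi> where K: "hilbert_subspace (\<Phi> ` L2)"
    and \<Phi>_add: "\<And>f g. f \<in> L2 \<Longrightarrow> g \<in> L2 \<Longrightarrow> \<Phi> (f + g) = \<Phi> f + \<Phi> g"
    and \<Phi>_scale: "\<And>c f. f \<in> L2 \<Longrightarrow> \<Phi> (vscale c f) = c *\<^sub>C \<Phi> f"
    and \<Phi>_ip: "\<And>f g. f \<in> L2 \<Longrightarrow> g \<in> L2 \<Longrightarrow> cinner (\<Phi> f) (\<Phi> g) = ip f g"
    by (rule l2_embedding) (rule that)
  have \<Phi>_diff: "\<Phi> f - \<Phi> h = \<Phi> (f - h)" if "f \<in> L2" "h \<in> L2" for f h
    using \<Phi>_add[of "f - h" h] that l2.S_diff[of f h] by simp
  have \<Phi>_norm: "(norm (\<Phi> f))\<^sup>2 = l2.sqnorm f" if "f \<in> L2" for f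
    using \<Phi>_ip[OF that that] by (simp add: Re_cinner_self[symmetric])
  have \<Phi>_eq: "\<Phi> f = \<Phi> h \<longleftrightarrow> (AE y in \<nu>. f y = h y)" if fh: "f \<in> L2" "h \<in> L2" for f h
  proof -
    have "\<Phi> f = \<Phi> h \<longleftrightarrow> l2.sqnorm (f - h) = 0"
      using \<Phi>_norm[OF l2.S_diff[OF fh]] \<Phi>_diff[OF fh]
      by (metis eq_iff_diff_eq_0 norm_eq_zero zero_eq_power2)
    then show ?thesis using ip_self_zero_AE[OF l2.S_diff[OF fh]] by simp
  qed
  \<comment> \<open>Any preimage under \<open>\<Phi>\<close> will do: another choice changes the
    section, and therefore its translate, only on a null set.\<close>
  define \<rho> where "\<rho> g x = \<Phi> (trans g (inv_into L2 \<Phi> x))" for g x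
  have \<rho>: "\<rho> g (\<Phi> f) = \<Phi> (trans g f)" if f: "f \<in> L2" for g f
  proof -
    let ?f = "inv_into L2 \<Phi> (\<Phi> f)"
    have f': "?f \<in> L2" "\<Phi> ?f = \<Phi> f"
      using inv_into_into[of "\<Phi> f" \<Phi> L2] f_inv_into_f[of "\<Phi> f" \<Phi> L2] f by auto
    then have "AE y in \<nu>. ?f y = f y" using \<Phi>_eq f by blast
    then have "AE y in \<nu>. trans g ?f y = trans g f y" by (rule AE_trans_cong)
    then show ?thesis unfolding \<rho>_def using \<Phi>_eq[OF trans_L2[OF f'(1)] trans_L2[OF f]] by blast
  qed
  have U: "unitary_rep (\<Phi> ` L2) \<rho>"
  proof (rule unitary_repI[OF K])
    show in_K: "\<rho> g x \<in> \<Phi> ` L2" if "x \<in> \<Phi> ` L2" for g x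
      using that by (auto simp: \<rho> trans_L2)
    show "\<rho> g (x + y) = \<rho> g x + \<rho> g y" if xy: "x \<in> \<Phi> ` L2" "y \<in> \<Phi> ` L2" for g x y
    proof -
      obtain f h where f: "f \<in> L2" "x = \<Phi> f" "h \<in> L2" "y = \<Phi> h" using xy by blast
      have "AE z in \<nu>. trans g (f + h) z = (trans g f + trans g h) z"
        using AE_space
      proof eventually_elim
        case (elim z)
        then show ?case
          using f by (simp add: trans_def L_isoD msection_in_H L2_msection act_in_space)
      qed
      then have "\<Phi> (trans g (f + h)) = \<Phi> (trans g f + trans g h)"
        using f by (subst \<Phi>_eq) (auto intro: trans_L2 l2.S_add)
      then show ?thesis
        using f by (simp add: \<Phi>_add[symmetric] \<rho> l2.S_add trans_L2)
    qed
    show "\<rho> g (c *\<^sub>C x) = c *\<^sub>C \<rho> g x" if x: "x \<in> \<Phi> ` L2" for g c x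
    proof -
      obtain f where f: "f \<in> L2" "x = \<Phi> f" using x by blast
      have "AE z in \<nu>. trans g (vscale c f) z = vscale c (trans g f) z"
        using AE_space
      proof eventually_elim
        case (elim z)
        then show ?case
          using f by (simp add: trans_def vscale_def L_isoD msection_in_H L2_msection act_in_space)
      qed
      then have "\<Phi> (trans g (vscale c f)) = \<Phi> (vscale c (trans g f))"
        using f by (subst \<Phi>_eq) (auto intro: trans_L2 L2_scale)
      then show ?thesis
        using f by (simp add: \<Phi>_scale[symmetric] \<rho> L2_scale trans_L2)
    qed
    show cin: "cinner (\<rho> g x) (\<rho> g y) = cinner x y" if "x \<in> \<Phi> ` L2" "y \<in> \<Phi> ` L2" for g x y
      using that by (auto simp: \<rho> \<Phi>_ip trans_L2 ip_trans)
    show mult: "\<rho> (g + h) x = \<rho> g (\<rho> h x)" if x: "x \<in> \<Phi> ` L2" for g h x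
    proof -
      obtain f where f: "f \<in> L2" "x = \<Phi> f" using x by blast
      then show ?thesis
        by (simp add: \<rho> trans_L2 \<Phi>_eq trans_mult)
    qed
    show "continuous_on UNIV (\<lambda>g. \<rho> g x)"
      if iso: "\<And>g. hilbert_iso (\<Phi> ` L2) (\<Phi> ` L2) (\<rho> g)" and x: "x \<in> \<Phi> ` L2" for x
    proof (rule weakly_measurable_rep_continuous[OF lc K iso mult _ x])
      fix x y assume "x \<in> \<Phi> ` L2" "y \<in> \<Phi> ` L2"
      then obtain f h where f: "f \<in> L2" "x = \<Phi> f" "h \<in> L2" "y = \<Phi> h" by blast
      have "(\<lambda>g. \<integral>y. cinner (trans g f y) (h y) \<partial>\<nu>) \<in> borel_measurable borel"
        by (intro borel_measurable_lebesgue_integral trans_cinner_joint L2_msection f)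
      then show "(\<lambda>g. cinner (\<rho> g x) y) \<in> borel_measurable borel"
        using f by (simp add: \<rho> \<Phi>_ip trans_L2 ip_def)
    qed
  qed
  have iso: "hilbert_iso (\<Phi> ` L2) (\<Phi> ` L2) (\<rho> g)" and mult: "x \<in> \<Phi> ` L2 \<Longrightarrow> \<rho> (g + h) x = \<rho> g (\<rho> h x)"
    and cont: "x \<in> \<Phi> ` L2 \<Longrightarrow> continuous_on UNIV (\<lambda>g. \<rho> g x)" for g h x
    using U by (auto simp: unitary_rep_def)
  note rD = hilbert_isoD[OF iso K]
  define v where "v n = \<Phi> (\<xi> n)" for n
  have v: "v n \<in> \<Phi> ` L2" for n using unit_section_L2[OF \<xi>] by (simp add: v_def)
  define F where "F n g = norm (\<rho> g (v n) - v n)" for n g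
  have r0: "\<rho> 0 (v n) = v n" for n
    by (rule hilbert_iso_rep_zero[OF iso K mult v])
  have F_sub: "F n (g + h) \<le> F n g + F n h" for n g h
  proof -
    have "\<rho> (g + h) (v n) - v n = \<rho> g (\<rho> h (v n) - v n) + (\<rho> g (v n) - v n)"
      by (simp add: rD v mult)
    also have "norm \<dots> \<le> norm (\<rho> g (\<rho> h (v n) - v n)) + norm (\<rho> g (v n) - v n)"
      by (rule norm_triangle_ineq)
    also have "norm (\<rho> g (\<rho> h (v n) - v n)) = norm (\<rho> h (v n) - v n)"
      by (intro rD(6) hilbert_subspaceD(4)[OF K] rD(1) v)
    finally show ?thesis by (simp add: F_def)
  qed
  have F_inv: "F n (- g) = F n g" for n g
  proof -
    have "F n (- g) = norm (\<rho> g (\<rho> (- g) (v n) - v n))"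
      unfolding F_def by (rule sym, intro rD(6) hilbert_subspaceD(4)[OF K] rD(1) v)
    also have "\<rho> g (\<rho> (- g) (v n) - v n) = \<rho> (g + - g) (v n) - \<rho> g (v n)"
      by (simp only: rD v mult)
    finally show ?thesis by (simp add: r0 F_def norm_minus_commute)
  qed
  have F_sq: "(F n g)\<^sup>2 = l2.sqnorm (trans g (\<xi> n) - \<xi> n)" for n g
    using unit_section_L2(1)[OF \<xi>]
    by (simp add: F_def v_def \<rho> trans_L2 \<Phi>_diff \<Phi>_norm l2.S_diff)
  have AEg: "AE g in \<mu>. AE y in \<nu>. (\<lambda>n. norm (\<xi> n y - L y g (\<xi> n (act (- g) y)))) \<longlonglongrightarrow> 0"
    by (rule AE_pair_swap[OF _ sigma_mu lim]) unfold_locales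
  have "AE g in \<mu>. (\<lambda>n. F n g) \<longlonglongrightarrow> 0"
    using AEg
  proof eventually_elim
    case (elim g)
    have "(\<lambda>n. (F n g)\<^sup>2) \<longlonglongrightarrow> 0"
      unfolding F_sq by (intro trans_defect_tendsto \<xi>) (use elim in \<open>simp add: trans_def\<close>)
    then show ?case by simp
  qed
  then have F_lim: "(\<lambda>n. F n g) \<longlonglongrightarrow> 0" for g
  proof (rule haar_conull_subgroup[OF haar])
    fix g h assume "(\<lambda>n. F n g) \<longlonglongrightarrow> 0" "(\<lambda>n. F n h) \<longlonglongrightarrow> 0"
    then have s: "(\<lambda>n. F n g + F n h) \<longlonglongrightarrow> 0 + 0" by (rule tendsto_add)
    show "(\<lambda>n. F n (g + h)) \<longlonglongrightarrow> 0"
      by (rule tendsto_sandwich[OF _ _ tendsto_const s[simplified]]) (auto simp: F_sub, simp add: F_def)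
  qed (simp add: F_inv)
  have F_cont: "continuous_on UNIV (F n)" for n
    unfolding F_def by (intro continuous_intros cont v)
  define m where "m = sqrt (measure \<nu> (space \<nu>))"
  have m: "m > 0"
    using nz by (simp add: m_def zero_less_measure_iff emeasure_eq_measure)
  have norm_v: "norm (v n) = m" for n
  proof -
    have "(norm (v n))\<^sup>2 = measure \<nu> (space \<nu>)"
      using unit_section_L2[OF \<xi>] by (simp add: v_def \<Phi>_norm)
    then show ?thesis by (simp add: m_def real_sqrt_unique)
  qed
  have "almost_invariant_vectors (\<Phi> ` L2) \<rho>"
    unfolding almost_invariant_vectors_def
  proof (intro allI impI, elim conjE)
    fix C :: "'g set" and e :: real assume C: "compact C" and e: "e > 0"
    \<comment> \<open>All \<open>v n\<close> have the same norm \<open>m\<close>, so the tolerance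
      \<open>e * m\<close> becomes \<open>e\<close> after normalisation.\<close>
    obtain N where N: "\<forall>n\<ge>N. \<forall>k\<in>C. F n k < e * m"
      using uniform_limit_on_compact[of F, OF lc F_cont F_sub F_inv F_lim C, of "e * m"] e m by auto
    let ?x = "complex_of_real (1 / m) *\<^sub>C v N"
    have "norm (\<rho> k ?x - ?x) = F N k / m" for k
    proof -
      have "\<rho> k ?x - ?x = complex_of_real (1 / m) *\<^sub>C (\<rho> k (v N) - v N)"
        by (simp add: rD v ell2.scale_right_diff_distrib)
      then show ?thesis using m by (simp add: norm_scaleC F_def norm_divide)
    qed
    then have "\<forall>k\<in>C. norm (\<rho> k ?x - ?x) < e" using N m by (simp add: divide_less_eq)
    moreover have "norm ?x = 1" using m by (simp add: norm_scaleC norm_v norm_divide)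
    moreover have "?x \<in> \<Phi> ` L2" by (intro hilbert_subspaceD(3)[OF K] v)
    ultimately show "\<exists>x\<in>\<Phi> ` L2. norm x = 1 \<and> (\<forall>k\<in>C. norm (\<rho> k x - x) < e)" by blast
  qed
  then obtain x where x: "x \<in> \<Phi> ` L2" "x \<noteq> 0" "\<And>g. \<rho> g x = x"
    using T U unfolding kazhdan_property_T_def by blast
  then obtain f where f: "f \<in> L2" "x = \<Phi> f" by blast
  note fm = L2_msection[OF f(1)]
  have f_inv: "AE y in \<nu>. trans g f y = f y" for g
    using x(3)[of g] f \<Phi>_eq[OF trans_L2[OF f(1)] f(1), of g] by (simp add: \<rho>)
  have [measurable]: "(\<lambda>y. norm (f y)) \<in> borel_measurable \<nu>" by (rule msection_norm[OF fm])
  define A where "A = {y \<in> space \<nu>. norm (f y) \<noteq> 0}"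
  have A: "A \<in> sets \<nu>" unfolding A_def by measurable
  have "emeasure \<nu> A = 0 \<or> conull \<nu> A"
  proof (rule ergodic_almost_invariant[OF erg A])
    fix g
    show "AE y in \<nu>. act (- g) y \<in> A \<longleftrightarrow> y \<in> A"
      using f_inv[of g] AE_space
    proof eventually_elim
      case (elim y)
      then have "norm (f (act (- g) y)) = norm (f y)" using trans_norm[OF fm elim(2), of g] by simp
      then show ?case using elim(2) act_in_space[OF elim(2)] by (simp add: A_def del: norm_eq_zero)
    qed
  qed
  moreover have "emeasure \<nu> A \<noteq> 0"
  proof
    assume "emeasure \<nu> A = 0"
    then have "AE y in \<nu>. f y = 0"
      by (intro AE_I[of _ _ A]) (use A in \<open>auto simp: A_def\<close>)
    then have "l2.sqnorm f = 0" by (simp add: ip_self_zero_AE f)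
    then have "x = 0" using \<Phi>_norm[OF f(1)] f(2) by simp
    then show False using x(2) by simp
  qed
  ultimately have f_nz: "AE y in \<nu>. f y \<noteq> 0"
    by (intro AE_I[of _ _ "space \<nu> - A"]) (auto simp: conull_def A_def)
  define \<eta> where "\<eta> y = complex_of_real (inverse (norm (f y))) *\<^sub>C f y" for y
  have "msection \<eta>" unfolding \<eta>_def by (intro msection_scale fm) measurable
  moreover have "AE y in \<nu>. norm (\<eta> y) = 1"
    using f_nz by eventually_elim (simp add: \<eta>_def norm_scaleC norm_inverse)
  ultimately have "borel_unit_section \<nu> H s \<eta>"
    by (simp add: borel_unit_section_def msection_def)
  moreover have "AE (y, g) in \<nu> \<Otimes>\<^sub>M \<mu>. \<eta> y = L y g (\<eta> (act (- g) y))"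
  proof -
    interpret mu: sigma_finite_measure \<mu> by (rule sigma_mu)
    interpret p: pair_sigma_finite \<nu> \<mu> ..
    note sp = sets_pair_measure_cong[OF refl[of "sets \<nu>"] sets_mu]
    \<comment> \<open>The squared length of \<open>trans g f y - f y\<close>, expanded into jointly
      measurable terms. This yields the measurable set needed to pass from almost every
      \<open>y\<close> for each \<open>g\<close> to almost every pair.\<close>
    define q where "q x = (norm (f (act (- snd x) (fst x))))\<^sup>2 + (norm (f (fst x)))\<^sup>2
      - 2 * Re (cinner (pull f x) (f (fst x)))" for x
    have "q \<in> borel_measurable (\<nu> \<Otimes>\<^sub>M borel)"
      unfolding q_def
      using L_joint[of f f] fm measurable_compose[OF act_inv_joint msection_norm[OF fm]]
      by (simp add: msection_iff)
    then have [measurable]: "q \<in> borel_measurable (\<nu> \<Otimes>\<^sub>M \<mu>)"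
      by (simp add: measurable_cong_sets[OF sp refl])
    have q: "q (y, g) = (norm (trans g f y - f y))\<^sup>2" if "y \<in> space \<nu>" for y g
      using trans_norm[OF fm that, of g] by (simp add: q_def norm_diff_sq trans_def)
    have qset: "{x \<in> space (\<nu> \<Otimes>\<^sub>M \<mu>). q x = 0} \<in> sets (\<nu> \<Otimes>\<^sub>M \<mu>)" by measurable
    have "AE y in \<nu>. AE g in \<mu>. q (y, g) = 0"
    proof (subst p.AE_commute)
      show "{x \<in> space (\<nu> \<Otimes>\<^sub>M \<mu>). q (fst x, snd x) = 0} \<in> sets (\<nu> \<Otimes>\<^sub>M \<mu>)" using qset by simp
      have "AE y in \<nu>. q (y, g) = 0" for g
        using f_inv[of g] AE_space by eventually_elim (simp add: q)
      then show "AE g in \<mu>. AE y in \<nu>. q (y, g) = 0" by simp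
    qed
    then have "AE x in \<nu> \<Otimes>\<^sub>M \<mu>. q x = 0" by (rule p.AE_pair_measure[OF qset])
    then show ?thesis
      using AE_space
    proof eventually_elim
      case (elim x)
      obtain y g where x: "x = (y, g)" by (cases x)
      have y: "y \<in> space \<nu>" using elim(2) by (simp add: x space_pair_measure)
      have "trans g f y = f y" using elim(1) q[OF y] by (simp add: x)
      moreover have "norm (f (act (- g) y)) = norm (f y)"
        using calculation trans_norm[OF fm y, of g] by simp
      ultimately have "L y g (\<eta> (act (- g) y)) = \<eta> y"
        using y by (simp add: \<eta>_def L_isoD msection_in_H[OF fm] act_in_space trans_def)
      then show ?case by (simp add: x)
    qed
  qed
  ultimately show ?thesis by blast
qed

end

theorem kazhdan_imp_action_property_T:
  fixes act :: "'g :: {topological_group_add, t2_space, second_countable_topology} \<Rightarrow> 'y \<Rightarrow> 'y"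
  assumes "pmp_action act \<mu> \<nu>" "emeasure \<nu> (space \<nu>) \<noteq> 0" "ergodic_action \<nu> act"
    and T: "kazhdan_property_T TYPE('g)"
  shows "action_property_T \<nu> \<mu> act"
  unfolding action_property_T_def
proof (intro allI impI, elim exE conjE)
  fix H s L \<xi> assume rep: "action_rep \<nu> act H s L"
    and \<xi>: "\<forall>n. borel_unit_section \<nu> H s (\<xi> n)"
    "AE (y, g) in \<nu> \<Otimes>\<^sub>M \<mu>. (\<lambda>n. norm (\<xi> n y - L y g (\<xi> n (act (- g) y)))) \<longlonglongrightarrow> 0"
  interpret pmp_action act \<mu> \<nu> by fact
  interpret action_field act \<mu> \<nu> H s L
    by unfold_locales (use rep in \<open>auto simp: action_rep_def\<close>)
  show "\<exists>\<xi>. borel_unit_section \<nu> H s \<xi> \<and>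
      (AE (y, g) in \<nu> \<Otimes>\<^sub>M \<mu>. \<xi> y = L y g (\<xi> (act (- g) y)))"
    by (rule property_T_invariant_section[OF T assms(3,2) _ \<xi>(2)]) (use \<xi>(1) in blast)
qed

section \<open>Direct sums and Gaussian kernels\<close>

text \<open>\<open>U x\<close> is the vector with components \<open>u j x\<close> in a countable
  direct sum of copies of \<open>ell2\<close>, realised in \<open>ell2\<close> itself by a bijection
  of pairs of naturals with naturals. Only its inner products matter later.\<close>

theorem ell2_direct_sum:
  fixes u :: "nat \<Rightarrow> 'i \<Rightarrow> ell2"
  assumes sm: "\<And>x. summable (\<lambda>j. (norm (u j x))\<^sup>2)"
  shows "\<exists>U. \<forall>x y. (\<lambda>j. cinner (u j x) (u j y)) sums cinner (U x) (U y)"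
proof -
  define c where "c x p = ell2_nth (u (fst p) x) (snd p)" for x p
  have pairs: "(\<lambda>p. (cmod (c x p))\<^sup>2) summable_on UNIV" for x
  proof -
    have "(\<lambda>p. (cmod (c x p))\<^sup>2) summable_on (UNIV \<times> UNIV)"
    proof (rule summable_on_SigmaI)
      show "((\<lambda>i. (cmod (c x (j, i)))\<^sup>2) has_sum (norm (u j x))\<^sup>2) UNIV" for j
        unfolding c_def by (rule sums_nonneg_imp_has_sum) (simp_all add: norm_ell2_sums)
      show "(\<lambda>j. (norm (u j x))\<^sup>2) summable_on UNIV"
        using sm by (subst summable_on_UNIV_nonneg_real_iff) auto
    qed auto
    then show ?thesis by simp
  qed
  define U where "U x = Abs_ell2 (\<lambda>m. c x (prod_decode m))" for x
  have "summable (\<lambda>m. (cmod (c x (prod_decode m)))\<^sup>2)" for x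
    using pairs[of x] summable_on_reindex_bij_betw[OF bij_prod_decode, of "\<lambda>p. (cmod (c x p))\<^sup>2"]
    by (intro summable_on_imp_summable) simp
  then have U: "ell2_nth (U x) m = c x (prod_decode m)" for x m
    by (simp add: U_def Abs_ell2_inverse)
  have "(\<lambda>j. cinner (u j x) (u j y)) sums cinner (U x) (U y)" for x y
  proof -
    have cmp: "norm (c x p * cnj (c y p)) \<le> (cmod (c x p))\<^sup>2 + (cmod (c y p))\<^sup>2" for p
      using mult_le_sum_squares[of "cmod (c x p)" "cmod (c y p)"] by (simp add: norm_mult)
    have "(\<lambda>p. norm (c x p * cnj (c y p))) summable_on UNIV"
      by (rule Infinite_Sum.abs_summable_on_comparison_test'[OF summable_on_add[OF pairs[of x] pairs[of y]]]) (rule cmp)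
    then have "(\<lambda>m. norm (c x (prod_decode m) * cnj (c y (prod_decode m)))) summable_on UNIV"
      using summable_on_reindex_bij_betw[OF bij_prod_decode, of "\<lambda>p. norm (c x p * cnj (c y p))"] by simp
    then have "summable (\<lambda>m. norm (c x (prod_decode m) * cnj (c y (prod_decode m))))"
      by (rule summable_on_imp_summable)
    moreover have "(\<lambda>m. c x (prod_decode m) * cnj (c y (prod_decode m))) sums cinner (U x) (U y)"
      using cinner_sums[of "U x" "U y"] by (simp add: U)
    ultimately have "((\<lambda>m. c x (prod_decode m) * cnj (c y (prod_decode m))) has_sum cinner (U x) (U y)) UNIV"
      by (rule norm_summable_imp_has_sum)
    then have hs: "((\<lambda>p. c x p * cnj (c y p)) has_sum cinner (U x) (U y)) (UNIV \<times> UNIV)"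
      using has_sum_reindex_bij_betw[OF bij_prod_decode, of "\<lambda>p. c x p * cnj (c y p)"] by simp
    have "((\<lambda>j. cinner (u j x) (u j y)) has_sum cinner (U x) (U y)) UNIV"
    proof (rule has_sum_SigmaD[OF hs])
      fix j
      have "summable (\<lambda>i. norm (c x (j, i) * cnj (c y (j, i))))"
      proof (rule summable_comparison_test[OF _ summable_add[OF summable_ell2[of "u j x"] summable_ell2[of "u j y"]]])
        show "\<exists>N. \<forall>n\<ge>N. norm (norm (c x (j, n) * cnj (c y (j, n))))
            \<le> (cmod (ell2_nth (u j x) n))\<^sup>2 + (cmod (ell2_nth (u j y) n))\<^sup>2"
          using cmp[of "(j, _)"] by (simp add: c_def)
      qed
      moreover have "(\<lambda>i. c x (j, i) * cnj (c y (j, i))) sums cinner (u j x) (u j y)"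
        using cinner_sums by (simp add: c_def)
      ultimately show "((\<lambda>i. c x (j, i) * cnj (c y (j, i))) has_sum cinner (u j x) (u j y)) UNIV"
        by (rule norm_summable_imp_has_sum)
    qed
    then show ?thesis by (rule has_sum_imp_sums)
  qed
  then show ?thesis by blast
qed

text \<open>The tensor product of \<open>u x\<close> and \<open>v x\<close>, written as the direct
  sum over \<open>j\<close> of \<open>u x\<close> scaled by the coordinate \<open>j\<close> of
  \<open>v x\<close>.\<close>

lemma ell2_tensor:
  fixes u v :: "'i \<Rightarrow> ell2"
  shows "\<exists>W. \<forall>x y. cinner (W x) (W y) = cinner (u x) (u y) * cinner (v x) (v y)"
proof -
  define w where "w j x = ell2_nth (v x) j *\<^sub>C u x" for j x
  have "summable (\<lambda>j. (norm (w j x))\<^sup>2)" for x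
    using summable_mult2[OF summable_ell2[of "v x"], of "(norm (u x))\<^sup>2"]
    by (simp add: w_def norm_scaleC power_mult_distrib)
  from ell2_direct_sum[OF this] obtain W where W: "\<forall>x y. (\<lambda>j. cinner (w j x) (w j y)) sums cinner (W x) (W y)" ..
  have "(\<lambda>j. cinner (w j x) (w j y)) sums (cinner (u x) (u y) * cinner (v x) (v y))" for x y
    using sums_mult[OF cinner_sums[of "v x" "v y"], of "cinner (u x) (u y)"]
    by (simp add: w_def cinner_scaleC_left cinner_scaleC_right mult_ac)
  then have "cinner (W x) (W y) = cinner (u x) (u y) * cinner (v x) (v y)" for x y
    using W sums_unique2 by blast
  then show ?thesis by blast
qed

lemma ell2_power_kernel:
  fixes u :: "'i \<Rightarrow> ell2"
  shows "\<exists>W. \<forall>x y. cinner (W x) (W y) = cinner (u x) (u y) ^ m"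
proof (induction m)
  case 0
  define e where "e = Abs_ell2 (\<lambda>i. if i = 0 then 1 else 0)"
  have e: "ell2_nth e i = (if i = 0 then 1 else 0)" for i
    unfolding e_def by (subst Abs_ell2_inverse) (auto intro!: summable_finite[of "{0}"] split: if_splits)
  have "(\<lambda>i. ell2_nth e i * cnj (ell2_nth e i)) = (\<lambda>i. if i = 0 then 1 else 0)"
    by (auto simp: e)
  then have "cinner e e = 1"
    using sums_unique2[OF cinner_sums[of e e]] sums_single[of 0 "\<lambda>_. 1 :: complex"] by simp
  then show ?case by (intro exI[of _ "\<lambda>_. e"]) simp
next
  case (Suc m)
  then obtain W where W: "\<forall>x y. cinner (W x) (W y) = cinner (u x) (u y) ^ m" ..
  show ?case using ell2_tensor[of u W] by (simp add: W)
qed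

text \<open>The exponential vector in Fock space: the direct sum of the tensor powers of
  \<open>u x\<close>, each divided by \<open>sqrt (fact m)\<close>, so that the inner products add
  up to the exponential series.\<close>

lemma ell2_exp_kernel:
  fixes u :: "'i \<Rightarrow> ell2"
  shows "\<exists>W. \<forall>x y. cinner (W x) (W y) = exp (cinner (u x) (u y))"
proof -
  have "\<forall>m. \<exists>W. \<forall>x y. cinner (W x) (W y) = cinner (u x) (u y) ^ m"
    using ell2_power_kernel by blast
  then obtain P where P: "\<forall>m. \<forall>x y. cinner (P m x) (P m y) = cinner (u x) (u y) ^ m"
    by (rule choice[THEN exE])
  define w where "w m x = of_real (1 / sqrt (fact m)) *\<^sub>C P m x" for m x
  have w: "cinner (w m x) (w m y) = cinner (u x) (u y) ^ m /\<^sub>R fact m" for m x y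
  proof -
    have "complex_of_real (sqrt (fact m)) * complex_of_real (sqrt (fact m)) = fact m"
      by (metis of_real_fact of_real_mult real_sqrt_mult_self abs_of_nonneg fact_ge_zero)
    then show ?thesis
      by (simp add: w_def cinner_scaleC_left cinner_scaleC_right P scaleR_conv_of_real divide_simps)
  qed
  have "(norm (w m x))\<^sup>2 = Re (cinner (u x) (u x)) ^ m /\<^sub>R fact m" for m x
  proof -
    have "(norm (w m x))\<^sup>2 = Re (cinner (u x) (u x) ^ m /\<^sub>R fact m)"
      using w[of m x x] by (simp add: Re_cinner_self[symmetric])
    also have "cinner (u x) (u x) ^ m = of_real (Re (cinner (u x) (u x)) ^ m)"
      by (simp add: cinner_self)
    finally show ?thesis by simp
  qed
  then have "summable (\<lambda>m. (norm (w m x))\<^sup>2)" for x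
    using summable_exp_generic[of "Re (cinner (u x) (u x))"] by simp
  from ell2_direct_sum[OF this] obtain W where W: "\<forall>x y. (\<lambda>m. cinner (w m x) (w m y)) sums cinner (W x) (W y)" ..
  have "cinner (W x) (W y) = exp (cinner (u x) (u y))" for x y
    using W[rule_format, of x y] exp_converges[of "cinner (u x) (u y)"]
    unfolding w by (rule sums_unique2)
  then show ?thesis by blast
qed

lemma ell2_conj_kernel:
  fixes u :: "'i \<Rightarrow> ell2"
  shows "\<exists>W. \<forall>x y. cinner (W x) (W y) = cnj (cinner (u x) (u y))"
proof -
  define W where "W x = Abs_ell2 (\<lambda>i. cnj (ell2_nth (u x) i))" for x
  have W: "ell2_nth (W x) i = cnj (ell2_nth (u x) i)" for x i
    unfolding W_def by (subst Abs_ell2_inverse) (simp_all add: summable_ell2)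
  have "cinner (W x) (W y) = cnj (cinner (u x) (u y))" for x y
    using cinner_sums[of "W x" "W y"] sums_cnj[THEN iffD2, OF cinner_sums[of "u x" "u y"]]
    unfolding W by (intro sums_unique2) auto
  then show ?thesis by blast
qed

text \<open>Tensoring the exponential vectors with their conjugates gives the kernel
  \<open>exp (2 * Re (cinner (u x) (u y)))\<close>; rescaling each vector by
  \<open>exp (- (norm (u x))\<^sup>2)\<close> completes the square.\<close>

theorem ell2_gauss_kernel:
  fixes u :: "'i \<Rightarrow> ell2"
  shows "\<exists>W. \<forall>x y. cinner (W x) (W y) = of_real (exp (- (norm (u x - u y))\<^sup>2))"
proof -
  obtain E where E: "\<forall>x y. cinner (E x) (E y) = exp (cinner (u x) (u y))"
    using ell2_exp_kernel ..
  obtain E' where E': "\<forall>x y. cinner (E' x) (E' y) = cnj (cinner (E x) (E y))"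
    using ell2_conj_kernel ..
  obtain F where F: "\<forall>x y. cinner (F x) (F y) = cinner (E x) (E y) * cinner (E' x) (E' y)"
    using ell2_tensor ..
  have "cinner (F x) (F y) = of_real (exp (2 * Re (cinner (u x) (u y))))" for x y
    by (simp add: F E' E cmod_sq_cnj norm_exp_eq_Re exp_double flip: of_real_power)
  then have "cinner (of_real (exp (- (norm (u x))\<^sup>2)) *\<^sub>C F x)
      (of_real (exp (- (norm (u y))\<^sup>2)) *\<^sub>C F y)
    = of_real (exp (- (norm (u x))\<^sup>2) * (exp (- (norm (u y))\<^sup>2) * exp (2 * Re (cinner (u x) (u y)))))"
    for x y by (simp add: cinner_scaleC_left cinner_scaleC_right)
  also have "\<dots> x y = of_real (exp (- (norm (u x - u y))\<^sup>2))" for x y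
    by (simp add: norm_diff_sq exp_add[symmetric] algebra_simps)
  finally show ?thesis
    by (intro exI[of _ "\<lambda>x. of_real (exp (- (norm (u x))\<^sup>2)) *\<^sub>C F x"]) blast
qed

section \<open>Extending isometries\<close>

text \<open>The graph of the linear extension of \<open>v i \<mapsto> w i\<close> to finite
  combinations. As a relation it can be formed before the extension is known to be well
  defined.\<close>

inductive span_graph :: "('i \<Rightarrow> ell2) \<Rightarrow> ('i \<Rightarrow> ell2) \<Rightarrow> ell2 \<Rightarrow> ell2 \<Rightarrow> bool" for v w where
  zero: "span_graph v w 0 0"
| step: "span_graph v w x y \<Longrightarrow> span_graph v w (c *\<^sub>C v i + x) (c *\<^sub>C w i + y)"

lemma span_graph_add:
  "span_graph v w x y \<Longrightarrow> span_graph v w x' y' \<Longrightarrow> span_graph v w (x + x') (y + y')"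
  by (induction rule: span_graph.induct) (auto simp: add.assoc intro: span_graph.step)

lemma span_graph_scale: "span_graph v w x y \<Longrightarrow> span_graph v w (c *\<^sub>C x) (c *\<^sub>C y)"
proof (induction rule: span_graph.induct)
  case (step x y a i)
  then show ?case
    using span_graph.step[of v w "c *\<^sub>C x" "c *\<^sub>C y" "c * a" i]
    by (simp add: ell2.scale_right_distrib)
qed (auto intro: span_graph.zero)

lemma span_graph_swap: "span_graph v w x y \<Longrightarrow> span_graph w v y x"
  by (induction rule: span_graph.induct) (auto intro: span_graph.intros)

lemma span_graph_cinner:
  assumes gram: "\<And>i j. cinner (v i) (v j) = cinner (w i) (w j)"
  shows "span_graph v w x y \<Longrightarrow> span_graph v w x' y' \<Longrightarrow> cinner x x' = cinner y y'"
proof (induction rule: span_graph.induct)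
  case (step x y c i)
  have "cinner (v i) x' = cinner (w i) y'"
    using step.prems
    by (induction rule: span_graph.induct)
      (simp_all add: cinner_add_right cinner_scaleC_right gram)
  with step show ?case by (simp add: cinner_add_left cinner_scaleC_left)
qed simp

lemma span_graph_dom:
  assumes "x \<in> ell2.span (range v)"
  shows "\<exists>y. span_graph v w x y"
  using assms
proof (induction rule: ell2.span_induct_alt)
  case base
  show ?case using span_graph.zero by blast
next
  case (step c x y)
  then obtain i z where "x = v i" "span_graph v w y z" by blast
  then show ?case using span_graph.step[of v w y z c i] by blast
qed

lemma span_graph_in_span: "span_graph v w x y \<Longrightarrow> x \<in> ell2.span (range v)"
  by (induction rule: span_graph.induct)
    (auto intro!: ell2.span_add ell2.span_scale ell2.span_base[OF rangeI] ell2.span_zero)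

text \<open>\<open>R\<close> is the sequential closure of the linear graph. Equal Gram matrices make
  it preserve inner products, hence single-valued and injective; Cauchy sequences correspond on both
  sides, so it is defined on the whole closed span.\<close>

theorem gram_extension:
  fixes v w :: "'i \<Rightarrow> ell2"
  assumes gram: "\<And>i j. cinner (v i) (v j) = cinner (w i) (w j)"
  shows "\<exists>T. hilbert_iso (closed_span (range v)) (closed_span (range w)) T \<and>
    (\<forall>i. T (v i) = w i)"
proof -
  let ?K = "closed_span (range v)" and ?M = "closed_span (range w)"
  define R where "R x y \<longleftrightarrow> (\<exists>X Y. (\<forall>n :: nat. span_graph v w (X n) (Y n)) \<and> X \<longlonglongrightarrow> x \<and> Y \<longlonglongrightarrow> y)" for x y
  have R_add: "R (x + x') (y + y')" if "R x y" "R x' y'" for x y x' y'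
  proof -
    obtain X Y X' Y' where "\<forall>n :: nat. span_graph v w (X n) (Y n)" "X \<longlonglongrightarrow> x" "Y \<longlonglongrightarrow> y"
      "\<forall>n :: nat. span_graph v w (X' n) (Y' n)" "X' \<longlonglongrightarrow> x'" "Y' \<longlonglongrightarrow> y'"
      using \<open>R x y\<close> \<open>R x' y'\<close> unfolding R_def by (elim exE conjE)
    then show ?thesis unfolding R_def
      by (intro exI[of _ "\<lambda>n. X n + X' n"] exI[of _ "\<lambda>n. Y n + Y' n"])
        (auto intro: tendsto_add span_graph_add)
  qed
  have R_scale: "R (c *\<^sub>C x) (c *\<^sub>C y)" if "R x y" for c x y
  proof -
    obtain X Y where "\<forall>n :: nat. span_graph v w (X n) (Y n)" "X \<longlonglongrightarrow> x" "Y \<longlonglongrightarrow> y"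
      using \<open>R x y\<close> unfolding R_def by (elim exE conjE)
    then show ?thesis unfolding R_def
      by (intro exI[of _ "\<lambda>n. c *\<^sub>C X n"] exI[of _ "\<lambda>n. c *\<^sub>C Y n"])
        (auto intro: tendsto_scaleC span_graph_scale)
  qed
  have R_ip: "cinner x x' = cinner y y'" if "R x y" "R x' y'" for x y x' y'
  proof -
    obtain X Y X' Y' where l: "\<forall>n :: nat. span_graph v w (X n) (Y n)" "X \<longlonglongrightarrow> x" "Y \<longlonglongrightarrow> y"
      "\<forall>n :: nat. span_graph v w (X' n) (Y' n)" "X' \<longlonglongrightarrow> x'" "Y' \<longlonglongrightarrow> y'"
      using \<open>R x y\<close> \<open>R x' y'\<close> unfolding R_def by (elim exE conjE)
    have "(\<lambda>n. cinner (X n) (X' n)) \<longlonglongrightarrow> cinner x x'" by (intro tendsto_cinner l)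
    moreover have "cinner (X n) (X' n) = cinner (Y n) (Y' n)" for n
      using span_graph_cinner[of v w, OF gram] l by blast
    moreover have "(\<lambda>n. cinner (Y n) (Y' n)) \<longlonglongrightarrow> cinner y y'" by (intro tendsto_cinner l)
    ultimately show ?thesis using LIMSEQ_unique by simp
  qed
  have R_norm: "norm x = norm y" if "R x y" for x y
    using R_ip[OF that that] by (simp add: norm_ell2_def inner_ell2_def)
  have R_diff: "R (x - x') (y - y')" if "R x y" "R x' y'" for x y x' y'
    using R_add[OF that(1) R_scale[OF that(2), of "-1"]] by simp
  have R_fun: "y = y'" if "R x y" "R x y'" for x y y'
    using R_norm[OF R_diff[OF that]] by simp
  have R_inj: "x = x'" if "R x y" "R x' y" for x x' y
    using R_norm[OF R_diff[OF that]] by simp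
  \<comment> \<open>Stated for arbitrary \<open>v\<close> and \<open>w\<close>, in order to be
    applied a second time with the two families exchanged, which gives surjectivity.\<close>
  have dom: "\<exists>y. (\<exists>X Y. (\<forall>n :: nat. span_graph v w (X n) (Y n)) \<and> X \<longlonglongrightarrow> x \<and> Y \<longlonglongrightarrow> y)"
    if gr: "\<And>i j. cinner (v i) (v j) = cinner (w i) (w j)" and x: "x \<in> closed_span (range v)"
    for v w :: "'i \<Rightarrow> ell2" and x
  proof -
    obtain X where X: "\<forall>n. X n \<in> ell2.span (range v)" "X \<longlonglongrightarrow> x"
      using x unfolding closure_sequential by blast
    then have "\<forall>n. \<exists>y. span_graph v w (X n) y" using span_graph_dom by blast
    then obtain Y where Y: "\<forall>n. span_graph v w (X n) (Y n)" by (rule choice[THEN exE])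
    have "dist (Y m) (Y n) = dist (X m) (X n)" for m n
    proof -
      have "span_graph v w (X m - X n) (Y m - Y n)"
        using span_graph_add[of v w "X m" "Y m" "(-1) *\<^sub>C X n" "(-1) *\<^sub>C Y n"]
          span_graph_scale[of v w "X n" "Y n" "-1"] Y by simp
      from span_graph_cinner[of v w, OF gr this this] show ?thesis
        by (simp add: dist_norm norm_ell2_def inner_ell2_def)
    qed
    then have "Cauchy Y" using LIMSEQ_imp_Cauchy[OF X(2)] by (simp add: Cauchy_def)
    then obtain y where "Y \<longlonglongrightarrow> y" using Cauchy_convergent_iff convergent_def by blast
    then show ?thesis using Y X by blast
  qed
  have R_dom: "\<exists>y. R x y" if "x \<in> ?K" for x
    unfolding R_def by (rule dom[OF gram that])
  have R_ran: "\<exists>x. R x y" if "y \<in> ?M" for y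
    using dom[OF gram[symmetric] that] span_graph_swap[of w v] unfolding R_def by meson
  have R_mem: "x \<in> ?K" "y \<in> ?M" if "R x y" for x y
    using that span_graph_in_span[of v w] span_graph_in_span[OF span_graph_swap[of v w]]
    unfolding R_def closure_sequential by blast+
  define T where "T x = (THE y. R x y)" for x
  have T: "R x (T x)" if "x \<in> ?K" for x
    unfolding T_def using R_dom[OF that] R_fun by (metis the_equality)
  have Teq: "T x = y" if "R x y" for x y
    using T[OF R_mem(1)[OF that]] that R_fun by blast
  have "hilbert_iso (?K) (?M) T"
    unfolding hilbert_iso_def
  proof (intro conjI ballI allI)
    show "bij_betw T (?K) (?M)"
      unfolding bij_betw_def
    proof
      show "inj_on T (?K)"
      proof (rule inj_onI)
        fix x y assume xy: "x \<in> ?K" "y \<in> ?K" "T x = T y"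
        have "R y (T x)" using T[OF xy(2)] xy(3) by simp
        then show "x = y" using R_inj[OF T[OF xy(1)]] by simp
      qed
      show "T ` ?K = ?M"
      proof
        show "T ` ?K \<subseteq> ?M"
          using T R_mem by blast
        show "?M \<subseteq> T ` ?K"
        proof
          fix y assume "y \<in> ?M"
          then obtain x where "R x y" using R_ran by blast
          then show "y \<in> T ` ?K" using Teq R_mem by blast
        qed
      qed
    qed
  next
    fix x y assume xy: "x \<in> ?K" "y \<in> ?K"
    show "T (x + y) = T x + T y" by (rule Teq[OF R_add[OF T[OF xy(1)] T[OF xy(2)]]])
    show "cinner (T x) (T y) = cinner x y" by (rule R_ip[OF T[OF xy(1)] T[OF xy(2)], symmetric])
  next
    fix c x assume x: "x \<in> ?K"
    show "T (c *\<^sub>C x) = c *\<^sub>C T x" by (rule Teq[OF R_scale[OF T[OF x]]])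
  qed
  moreover have "T (v i) = w i" for i
  proof (rule Teq)
    have "span_graph v w (v i) (w i)" using span_graph.step[OF span_graph.zero, of v w 1 i] by simp
    then show "R (v i) (w i)" unfolding R_def
      by (intro exI[of _ "\<lambda>_. v i"] exI[of _ "\<lambda>_. w i"]) auto
  qed
  ultimately show ?thesis by blast
qed

lemma hilbert_iso_eq_on_closure:
  assumes S: "hilbert_iso (closed_span A) K S" and T: "hilbert_iso (closed_span A) K' T"
    and eq: "\<And>v. v \<in> A \<Longrightarrow> S v = T v" and x: "x \<in> closed_span A"
  shows "S x = T x"
proof -
  let ?K = "closed_span A"
  have K: "hilbert_subspace ?K" by (intro closure_subspace_ell2 ell2.subspace_span)
  note SD = hilbert_isoD[OF S K] and TD = hilbert_isoD[OF T K]
  have sub: "ell2.span A \<subseteq> ?K" by (rule closure_subset)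
  have "y \<in> ?K \<and> S y = T y" if "y \<in> ell2.span A" for y
    using that
  proof (induction rule: ell2.span_induct_alt)
    case base
    show ?case by (simp add: SD TD hilbert_subspaceD[OF K])
  next
    case (step c v y)
    have "v \<in> ?K" using subsetD[OF sub] ell2.span_base[OF step(1)] by auto
    then show ?case using step eq by (simp add: SD TD hilbert_subspaceD[OF K])
  qed
  then have sp: "S y = T y" if "y \<in> ell2.span A" for y using that by blast
  obtain X where X: "\<forall>n. X n \<in> ell2.span A" "X \<longlonglongrightarrow> x"
    using x unfolding closure_sequential by blast
  have XK: "X n \<in> ?K" for n using X(1) sub by auto
  have "(\<lambda>n. S (X n)) \<longlonglongrightarrow> S x" "(\<lambda>n. T (X n)) \<longlonglongrightarrow> T x"
    by (rule hilbert_iso_tendsto[OF _ K XK x X(2)], fact)+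
  then show ?thesis using sp X(1) LIMSEQ_unique by simp
qed

section \<open>Vectors of minimal norm\<close>

text \<open>By the parallelogram identity, two points of \<open>C\<close> of nearly minimal norm are
  close, because their midpoint is again in \<open>C\<close>. Hence minimising sequences converge
  and the minimiser is unique.\<close>

lemma minimal_norm_exists:
  fixes C :: "'a :: {real_inner, complete_space} set"
  assumes C: "closed C" "convex C" "C \<noteq> {}"
  shows "\<exists>z\<in>C. \<forall>y\<in>C. norm y \<le> norm z \<longrightarrow> y = z"
proof -
  define d where "d = Inf ((\<lambda>x. (norm x)\<^sup>2) ` C)"
  have bdd: "bdd_below ((\<lambda>x. (norm x)\<^sup>2) ` C)" by (rule bdd_belowI2[of _ 0]) simp
  have dle: "d \<le> (norm x)\<^sup>2" if "x \<in> C" for x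
    unfolding d_def using bdd that by (intro cInf_lower) auto
  have par: "(norm (x - y))\<^sup>2 \<le> 2 * (norm x)\<^sup>2 + 2 * (norm y)\<^sup>2 - 4 * d" if "x \<in> C" "y \<in> C" for x y
  proof -
    have "(1/2) *\<^sub>R x + (1/2) *\<^sub>R y \<in> C" using C(2) that by (intro convexD) auto
    then have "d \<le> (norm ((1/2) *\<^sub>R x + (1/2) *\<^sub>R y))\<^sup>2" by (rule dle)
    then show ?thesis
      by (simp add: power2_norm_eq_inner inner_add_left inner_add_right inner_diff_left
          inner_diff_right inner_commute)
  qed
  have "\<exists>x\<in>C. (norm x)\<^sup>2 < d + inverse (real (Suc n))" for n
    using cInf_lessD[of "(\<lambda>x. (norm x)\<^sup>2) ` C" "d + inverse (real (Suc n))"] C(3) by (auto simp: d_def)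
  then obtain X where X: "\<And>n. X n \<in> C" "\<And>n. (norm (X n))\<^sup>2 < d + inverse (real (Suc n))"
    by metis
  have lim: "(\<lambda>n. 4 * inverse (real (Suc n))) \<longlonglongrightarrow> 0"
    by (rule tendsto_mult_right_zero[OF LIMSEQ_inverse_real_of_nat])
  have "Cauchy X"
    unfolding Cauchy_altdef
  proof (intro allI impI)
    fix e :: real assume e: "e > 0"
    obtain N where N: "\<And>n. n \<ge> N \<Longrightarrow> 4 * inverse (real (Suc n)) < e\<^sup>2"
      using order_tendstoD(2)[OF lim, of "e\<^sup>2"] e by (auto simp: eventually_sequentially)
    have "dist (X m) (X n) < e" if "m \<ge> N" "n > m" for m n
    proof -
      have "inverse (real (Suc n)) \<le> inverse (real (Suc m))" using that by (simp add: divide_simps)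
      then have "(norm (X m - X n))\<^sup>2 < e\<^sup>2"
        using par[OF X(1) X(1), of m n] X(2)[of m] X(2)[of n] N[OF that(1)] by linarith
      then show ?thesis using e by (simp add: dist_norm power2_less_imp_less)
    qed
    then show "\<exists>M. \<forall>m\<ge>M. \<forall>n>m. dist (X m) (X n) < e" by blast
  qed
  then obtain z where z: "X \<longlonglongrightarrow> z" using Cauchy_convergent_iff convergent_def by blast
  then have zC: "z \<in> C" using C(1) X(1) closed_sequentially by blast
  have "(norm z)\<^sup>2 \<le> d + 0"
  proof (rule LIMSEQ_le)
    show "(\<lambda>n. (norm (X n))\<^sup>2) \<longlonglongrightarrow> (norm z)\<^sup>2" by (intro tendsto_intros z)
    show "(\<lambda>n. d + inverse (real (Suc n))) \<longlonglongrightarrow> d + 0"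
      by (intro tendsto_intros LIMSEQ_inverse_real_of_nat)
  qed (use X(2) in \<open>auto intro: less_imp_le\<close>)
  moreover have "y = z" if "y \<in> C" "norm y \<le> norm z" "(norm z)\<^sup>2 \<le> d" for y
  proof -
    have "(norm y)\<^sup>2 \<le> (norm z)\<^sup>2" using that(2) by (intro power_mono) auto
    then have "(norm (y - z))\<^sup>2 \<le> 0" using par[OF that(1) zC] that(3) by linarith
    then show ?thesis by simp
  qed
  ultimately show ?thesis using zC by auto
qed

text \<open>The closed convex hull of the orbit stays within distance \<open>r\<close> of
  \<open>x\<close> and so avoids 0. Each \<open>\<pi> g\<close> maps it into itself and preserves
  norms, so it fixes the unique element of least norm.\<close>

theorem invariant_vector_if_close:
  fixes \<pi> :: "'g :: topological_group_add \<Rightarrow> ell2 \<Rightarrow> ell2"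
  assumes rep: "unitary_rep H \<pi>" and x: "x \<in> H" "r < norm x" and close: "\<And>g. norm (\<pi> g x - x) \<le> r"
  shows "\<exists>z\<in>H. z \<noteq> 0 \<and> (\<forall>g. \<pi> g z = z)"
proof -
  have H: "hilbert_subspace H" and iso: "\<And>g. hilbert_iso H H (\<pi> g)"
    and mult: "\<And>g h x. x \<in> H \<Longrightarrow> \<pi> (g + h) x = \<pi> g (\<pi> h x)"
    using rep by (auto simp: unitary_rep_def)
  note iD = hilbert_isoD[OF iso H]
  have Hc: "convex H" "closed H"
    using H hilbert_subspaceD[OF H] by (auto simp: convex_def hilbert_subspace_def)
  define C where "C = closure (convex hull (range (\<lambda>g. \<pi> g x)))"
  have C: "closed C" "convex C" "C \<noteq> {}"
    by (auto simp: C_def convex_closure convex_convex_hull)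
  have orbit: "\<pi> g x \<in> C" for g
    unfolding C_def using hull_subset[of "range (\<lambda>g. \<pi> g x)" convex] closure_subset by blast
  have C_min: "C \<subseteq> P" if "closed P" "convex P" "\<And>g. \<pi> g x \<in> P" for P
    unfolding C_def using that by (intro closure_minimal hull_minimal) auto
  have CH: "C \<subseteq> H" by (rule C_min) (use Hc iD x in auto)
  have "C \<subseteq> cball x r"
    by (rule C_min) (use close in \<open>auto simp: dist_norm norm_minus_commute\<close>)
  then have nz: "0 \<notin> C" using x(2) by (auto simp: dist_norm)
  have inv: "\<pi> g y \<in> C" if "y \<in> C" for g y
  proof -
    let ?P = "{y \<in> H. \<pi> g y \<in> C}"
    have "C \<subseteq> ?P"
    proof (rule C_min)
      show "closed ?P"
        unfolding closed_sequential_limits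
      proof (intro allI impI, elim conjE)
        fix X l assume X: "\<forall>n. X n \<in> ?P" "X \<longlonglongrightarrow> l"
        have l: "l \<in> H" using X hilbert_subspaceD(6)[OF H] by blast
        have "(\<lambda>n. \<pi> g (X n)) \<longlonglongrightarrow> \<pi> g l"
          by (rule hilbert_iso_tendsto[OF iso H _ l X(2)]) (use X(1) in blast)
        moreover have "\<forall>n. \<pi> g (X n) \<in> C" using X by blast
        ultimately have "\<pi> g l \<in> C"
          using closed_sequentially[OF C(1), of "\<lambda>n. \<pi> g (X n)"] by blast
        then show "l \<in> ?P" using l by simp
      qed
      show "convex ?P"
        using C(2) hilbert_subspaceD[OF H]
        by (auto simp: convex_def iD scaleR_scaleC)
      show "\<pi> h x \<in> ?P" for h
        using orbit[of "g + h"] iD(1) x(1) by (simp add: mult)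
    qed
    then show ?thesis using that by blast
  qed
  from minimal_norm_exists[OF C] obtain z
    where z: "z \<in> C" "\<forall>y\<in>C. norm y \<le> norm z \<longrightarrow> y = z" ..
  have zH: "z \<in> H" using z(1) CH by auto
  have "\<pi> g z = z" for g using z(2) inv[OF z(1), of g] iD(6)[OF zH, of g] by simp
  moreover have "z \<noteq> 0" using nz z(1) by auto
  ultimately show ?thesis using zH by (intro bexI[of _ z]) auto
qed

section \<open>A mixing representation for groups without property (T)\<close>

lemma hilbert_iso_comp:
  assumes "hilbert_iso H K S" "hilbert_iso K M T"
  shows "hilbert_iso H M (\<lambda>x. T (S x))"
proof -
  have S: "S x \<in> K" if "x \<in> H" for x
    using assms(1) that unfolding hilbert_iso_def bij_betw_def by blast
  have "bij_betw (T \<circ> S) H M"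
    using assms by (intro bij_betw_trans[of S H K]) (auto simp: hilbert_iso_def)
  then show ?thesis
    using assms S unfolding hilbert_iso_def by (simp add: comp_def)
qed

text \<open>A bounded sequence needs to be tested for weak convergence to 0 only on a set with dense
  span.\<close>

lemma weak_null_closure:
  assumes "\<And>j. norm (X j) \<le> B" "\<And>v. v \<in> A \<Longrightarrow> (\<lambda>j. cinner (X j) v) \<longlonglongrightarrow> 0"
    and w: "w \<in> closed_span A"
  shows "(\<lambda>j. cinner (X j) w) \<longlonglongrightarrow> 0"
proof -
  have sp: "(\<lambda>j. cinner (X j) v) \<longlonglongrightarrow> 0" if "v \<in> ell2.span A" for v
    using that
  proof (induction rule: ell2.span_induct_alt)
    case (step c x y)
    have "(\<lambda>j. cnj c * cinner (X j) x + cinner (X j) y) \<longlonglongrightarrow> cnj c * 0 + 0"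
      by (intro tendsto_intros assms(2) step)
    then show ?case by (simp add: cinner_add_right cinner_scaleC_right)
  qed simp
  have B: "B \<ge> 0" using assms(1)[of 0] norm_ge_zero order_trans by blast
  show ?thesis
  proof (rule LIMSEQ_I)
    fix e :: real assume e: "e > 0"
    have "e / (2 * (B + 1)) > 0" using e B by simp
    then obtain v where v: "v \<in> ell2.span A" "dist v w < e / (2 * (B + 1))"
      using w unfolding closure_approachable by blast
    obtain N where N: "\<And>j. j \<ge> N \<Longrightarrow> norm (cinner (X j) v) < e / 2"
      using LIMSEQ_D[OF sp[OF v(1)], of "e / 2"] e by auto
    have "norm (cinner (X j) w - 0) < e" if "j \<ge> N" for j
    proof -
      have "cinner (X j) w = cinner (X j) v + cinner (X j) (w - v)"
        by (simp add: cinner_diff_right)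
      then have "norm (cinner (X j) w) \<le> norm (cinner (X j) v) + norm (cinner (X j) (w - v))"
        by (metis norm_triangle_ineq)
      also have "norm (cinner (X j) (w - v)) \<le> B * (e / (2 * (B + 1)))"
        using v(2) assms(1)[of j] B
        by (intro order_trans[OF cinner_bound] mult_mono) (auto simp: dist_norm norm_minus_commute)
      also have "\<dots> \<le> e / 2" using B e by (simp add: field_simps)
      finally show ?thesis using N[OF that] by simp
    qed
    then show "\<exists>N. \<forall>j\<ge>N. norm (cinner (X j) w - 0) < e" by blast
  qed
qed

text \<open>The vectors \<open>2\<^bsup>n/2\<^esup> (\<pi> g x\<^sub>n - x\<^sub>n)\<close>, for almost invariant \<open>x\<^sub>n\<close>, are the coordinates of an
  unbounded cocycle \<open>b\<close>.\<close>

lemma unbounded_cocycle: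
  fixes \<pi> :: "'g :: topological_group_add \<Rightarrow> ell2 \<Rightarrow> ell2"
  assumes cnt: "countable (UNIV :: 'g set)"
    and rep: "unitary_rep H \<pi>" and aiv: "almost_invariant_vectors H \<pi>"
    and no_inv: "\<not> (\<exists>x\<in>H. x \<noteq> 0 \<and> (\<forall>g. \<pi> g x = x))"
  shows "\<exists>b :: 'g \<Rightarrow> ell2. (\<forall>g x y. norm (b (g + x) - b (g + y)) = norm (b x - b y)) \<and> b 0 = 0 \<and>
    (\<forall>R. \<exists>g. norm (b g) > R)"
proof -
  have H: "hilbert_subspace H" and iso: "\<And>g. hilbert_iso H H (\<pi> g)"
    and mult: "\<And>g h x. x \<in> H \<Longrightarrow> \<pi> (g + h) x = \<pi> g (\<pi> h x)"
    using rep by (auto simp: unitary_rep_def)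
  note iD = hilbert_isoD[OF iso H]
  \<comment> \<open>The vector \<open>x n\<close> is moved by less than \<open>(1/2)^n\<close> by
    each of the first \<open>n\<close> elements of an enumeration of the group.\<close>
  have "\<forall>n :: nat. \<exists>x. x \<in> H \<and> norm x = 1 \<and>
      (\<forall>k\<in>from_nat_into UNIV ` {..<n}. norm (\<pi> k x - x) < (1/2)^n)"
  proof
    fix n :: nat
    have "compact (from_nat_into UNIV ` {..<n} :: 'g set)" "(1/2 :: real)^n > 0"
      by (auto intro: finite_imp_compact)
    then show "\<exists>x. x \<in> H \<and> norm x = 1 \<and>
        (\<forall>k\<in>from_nat_into UNIV ` {..<n}. norm (\<pi> k x - x) < (1/2)^n)"
      using aiv unfolding almost_invariant_vectors_def Bex_def by blast
  qed
  then obtain x where x: "\<forall>n :: nat. x n \<in> H \<and> norm (x n) = 1 \<and>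
      (\<forall>k\<in>from_nat_into UNIV ` {..<n}. norm (\<pi> k (x n) - x n) < (1/2)^n)"
    by (rule choice[THEN exE])
  then have xH: "x n \<in> H" and x1: "norm (x n) = 1" for n by auto
  \<comment> \<open>The weight is a compromise: for each fixed \<open>g\<close> the squared norms
    are at most \<open>(1/2)^n\<close> from some index on and thus summable, yet the weight grows,
    so a bounded sum forces \<open>x n\<close> to be nearly fixed by the whole group at
    once.\<close>
  define w where "w n g = of_real (sqrt (2^n)) *\<^sub>C (\<pi> g (x n) - x n)" for n g
  have w_diff: "(norm (w n g - w n h))\<^sup>2 = 2^n * (norm (\<pi> g (x n) - \<pi> h (x n)))\<^sup>2" for n g h
  proof -
    have "w n g - w n h = of_real (sqrt (2^n)) *\<^sub>C (\<pi> g (x n) - \<pi> h (x n))"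
      unfolding w_def by (simp add: ell2.scale_right_diff_distrib[symmetric])
    then show ?thesis by (simp add: norm_scaleC power_mult_distrib)
  qed
  have w_norm: "(norm (w n g))\<^sup>2 = 2^n * (norm (\<pi> g (x n) - x n))\<^sup>2" for n g
    by (simp add: w_def norm_scaleC power_mult_distrib)
  have "summable (\<lambda>n. (norm (w n g))\<^sup>2)" for g
  proof (rule summable_comparison_test)
    obtain m where m: "from_nat_into UNIV m = g" using from_nat_into_surj[OF cnt] by blast
    have "(norm (w n g))\<^sup>2 \<le> (1/2)^n" if "n \<ge> Suc m" for n
    proof -
      have "norm (\<pi> g (x n) - x n) < (1/2)^n" using x m that by auto
      then have "(norm (\<pi> g (x n) - x n))\<^sup>2 \<le> ((1/2)^n)\<^sup>2" by (intro power_mono) auto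
      then have "(norm (w n g))\<^sup>2 \<le> 2^n * ((1/2)^n)\<^sup>2" unfolding w_norm by (intro mult_left_mono) auto
      also have "\<dots> = (1/2)^n" by (simp add: power2_eq_square flip: power_mult_distrib mult.assoc)
      finally show ?thesis .
    qed
    then show "\<exists>N. \<forall>n\<ge>N. norm ((norm (w n g))\<^sup>2) \<le> (1/2)^n" by (intro exI[of _ "Suc m"]) auto
    show "summable (\<lambda>n. (1/2 :: real)^n)" by (rule summable_geometric) simp
  qed
  from ell2_direct_sum[OF this] obtain b where b: "\<forall>g h. (\<lambda>n. cinner (w n g) (w n h)) sums cinner (b g) (b h)" ..
  have b_norm: "(\<lambda>n. (norm (w n g))\<^sup>2) sums (norm (b g))\<^sup>2" for g
    using sums_Re[OF b[rule_format, of g g]] by (simp add: Re_cinner_self)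
  have b_diff: "(\<lambda>n. (norm (w n g - w n h))\<^sup>2) sums (norm (b g - b h))\<^sup>2" for g h
    unfolding norm_diff_sq
    by (intro sums_diff sums_add sums_mult b_norm sums_Re b[rule_format])
  have equi: "norm (b (g + h) - b (g + k)) = norm (b h - b k)" for g h k
  proof -
    have "norm (\<pi> (g + h) (x n) - \<pi> (g + k) (x n)) = norm (\<pi> h (x n) - \<pi> k (x n))" for n
    proof -
      have "\<pi> (g + h) (x n) - \<pi> (g + k) (x n) = \<pi> g (\<pi> h (x n) - \<pi> k (x n))"
        by (simp add: mult iD xH)
      also have "norm \<dots> = norm (\<pi> h (x n) - \<pi> k (x n))"
        by (intro iD(6) hilbert_subspaceD(4)[OF H] iD(1) xH)
      finally show ?thesis .
    qed
    then have "(norm (b (g + h) - b (g + k)))\<^sup>2 = (norm (b h - b k))\<^sup>2"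
      using b_diff[of "g + h" "g + k"] b_diff[of h k] unfolding w_diff by (simp add: sums_unique2)
    then show ?thesis by simp
  qed
  have b0: "b 0 = 0"
  proof -
    have "w n 0 = 0" for n using hilbert_iso_rep_zero[of H \<pi>, OF iso H mult xH] by (simp add: w_def)
    then have "(\<lambda>n. 0) sums (norm (b 0))\<^sup>2" using b_norm[of 0] by simp
    then have "(norm (b 0))\<^sup>2 = 0" by (rule sums_unique2) (rule sums_zero)
    then show ?thesis by simp
  qed
  have "\<exists>g. norm (b g) > R" for R
  proof (rule ccontr)
    assume "\<not> ?thesis"
    then have R: "norm (b g) \<le> R" for g by (simp add: not_less)
    \<comment> \<open>This \<open>n\<close> makes every displacement of the unit vector
      \<open>x n\<close> at most 1/2, and a displacement bounded below its norm produces an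
      invariant vector.\<close>
    obtain n where n: "4 * R\<^sup>2 < 2^n" using real_arch_pow[of 2 "4 * R\<^sup>2"] by auto
    have "norm (\<pi> g (x n) - x n) \<le> 1/2" for g
    proof -
      have "2^n * (norm (\<pi> g (x n) - x n))\<^sup>2 \<le> (norm (b g))\<^sup>2"
        using sum_le_suminf[OF sums_summable[OF b_norm[of g]], of "{n}"] sums_unique[OF b_norm[of g]]
        by (simp add: w_norm)
      also have "\<dots> \<le> R\<^sup>2" using R by (intro power_mono) auto
      also have "\<dots> \<le> 2^n * (1/2)\<^sup>2" using n by (simp add: power_divide)
      finally have "(norm (\<pi> g (x n) - x n))\<^sup>2 \<le> (1/2)\<^sup>2" by simp
      then show ?thesis by (rule power2_le_imp_le) simp
    qed
    then have "\<exists>z\<in>H. z \<noteq> 0 \<and> (\<forall>g. \<pi> g z = z)"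
      by (rule invariant_vector_if_close[OF rep xH[of n], of "1/2", rotated]) (simp add: x1)
    then show False using no_inv by blast
  qed
  with equi b0 show ?thesis by blast
qed

section \<open>From invariant kernels to representations\<close>

definition shift_rep :: "(nat \<times> 'g :: group_add \<Rightarrow> ell2) \<Rightarrow> ('g \<Rightarrow> ell2 \<Rightarrow> ell2) \<Rightarrow> bool" where
  "shift_rep V \<sigma> \<longleftrightarrow>
     (\<forall>g. hilbert_iso (closed_span (range V)) (closed_span (range V)) (\<sigma> g)) \<and>
     (\<forall>g h. \<forall>x\<in>closed_span (range V). \<sigma> (g + h) x = \<sigma> g (\<sigma> h x)) \<and>
     (\<forall>g k h. \<sigma> g (V (k, h)) = V (k, g + h))"

text \<open>Translating the group index permutes the family \<open>V\<close> without changing its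
  Gram matrix, so it extends to a unitary operator of the closed span. The group law holds on the
  family and passes to the closed span by density.\<close>

lemma shift_rep_exists:
  fixes V :: "nat \<times> 'g :: group_add \<Rightarrow> ell2"
  assumes inv: "\<And>g k x l y. cinner (V (k, g + x)) (V (l, g + y)) = cinner (V (k, x)) (V (l, y))"
  shows "\<exists>\<sigma>. shift_rep V \<sigma>"
proof -
  let ?K = "closed_span (range V)"
  have range: "range (\<lambda>p. V (fst p, g + snd p)) = range V" for g
  proof
    show "range V \<subseteq> range (\<lambda>p. V (fst p, g + snd p))"
    proof safe
      fix k h
      have "V (k, h) = V (fst (k, - g + h), g + snd (k, - g + h))" by (simp add: add.assoc[symmetric])
      then show "V (k, h) \<in> range (\<lambda>p. V (fst p, g + snd p))" by blast
    qed
  qed auto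
  have "\<forall>g. \<exists>T. hilbert_iso ?K ?K T \<and> (\<forall>p. T (V p) = V (fst p, g + snd p))"
    using gram_extension[of V "\<lambda>p. V (fst p, _ + snd p)"] inv unfolding range by fastforce
  then obtain \<sigma> where \<sigma>: "\<forall>g. hilbert_iso ?K ?K (\<sigma> g) \<and> (\<forall>p. \<sigma> g (V p) = V (fst p, g + snd p))"
    by (rule choice[THEN exE])
  have "\<sigma> (g + h) x = \<sigma> g (\<sigma> h x)" if "x \<in> ?K" for g h x
  proof (rule hilbert_iso_eq_on_closure[OF _ hilbert_iso_comp[of _ ?K "\<sigma> h" _ "\<sigma> g"] _ that])
    show "\<sigma> (g + h) v = \<sigma> g (\<sigma> h v)" if "v \<in> range V" for v
      using that \<sigma> by (auto simp: add.assoc)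
  qed (use \<sigma> in blast)+
  with \<sigma> show ?thesis unfolding shift_rep_def by (intro exI[of _ \<sigma>]) auto
qed

theorem mixing_representation:
  fixes \<pi> :: "'g :: topological_group_add \<Rightarrow> ell2 \<Rightarrow> ell2"
  assumes cnt: "countable (UNIV :: 'g set)"
    and rep: "unitary_rep H \<pi>" and aiv: "almost_invariant_vectors H \<pi>"
    and no_inv: "\<not> (\<exists>x\<in>H. x \<noteq> 0 \<and> (\<forall>g. \<pi> g x = x))"
  shows "\<exists>(V :: nat \<times> 'g \<Rightarrow> ell2) \<sigma> a. shift_rep V \<sigma> \<and> (\<forall>p. norm (V p) = 1) \<and>
    (\<forall>g. (\<lambda>k. norm (V (k, 0) - V (k, g))) \<longlonglongrightarrow> 0) \<and>
    (\<forall>x\<in>closed_span (range V). \<forall>y\<in>closed_span (range V).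
      (\<lambda>j :: nat. cinner (\<sigma> (a j) x) y) \<longlonglongrightarrow> 0)"
proof -
  obtain b :: "'g \<Rightarrow> ell2" where "(\<forall>g x y. norm (b (g + x) - b (g + y)) = norm (b x - b y)) \<and> b 0 = 0 \<and>
    (\<forall>R. \<exists>g. norm (b g) > R)"
    using unbounded_cocycle[OF assms] ..
  then have equi: "norm (b (g + x) - b (g + y)) = norm (b x - b y)" and b0: "b 0 = 0"
    and unb: "\<exists>g. norm (b g) > R" for g x y R by auto
  \<comment> \<open>The scales of the Gaussian kernels; \<open>Suc\<close> because the index starts
    at 0.\<close>
  define k' where "k' k = 1 / real (Suc k)" for k
  have k'pos: "k' k > 0" for k by (simp add: k'_def)
  have "\<forall>k. \<exists>W. \<forall>x y. cinner (W x) (W y) = of_real (exp (- (k' k * (norm (b x - b y))\<^sup>2)))"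
  proof
    fix k
    obtain W where W: "\<forall>x y. cinner (W x) (W y)
        = of_real (exp (- (norm (sqrt (k' k) *\<^sub>R b x - sqrt (k' k) *\<^sub>R b y))\<^sup>2))"
      using ell2_gauss_kernel[of "\<lambda>x. sqrt (k' k) *\<^sub>R b x"] ..
    have "(norm (sqrt (k' k) *\<^sub>R b x - sqrt (k' k) *\<^sub>R b y))\<^sup>2 = k' k * (norm (b x - b y))\<^sup>2" for x y
      using k'pos[of k] by (simp add: scaleR_diff_right[symmetric] power_mult_distrib)
    with W show "\<exists>W. \<forall>x y. cinner (W x) (W y) = of_real (exp (- (k' k * (norm (b x - b y))\<^sup>2)))"
      by auto
  qed
  then obtain W where W: "\<forall>k. \<forall>x y. cinner (W k x) (W k y)
      = of_real (exp (- (k' k * (norm (b x - b y))\<^sup>2)))"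
    by (rule choice[THEN exE])
  \<comment> \<open>The vectors of the kernel with index \<open>k\<close> are placed in the summand
    \<open>k\<close>, so vectors with different indices are orthogonal.\<close>
  define u where "u j p = (if j = fst p then W j (snd p) else 0)" for j :: nat and p :: "nat \<times> 'g"
  have "summable (\<lambda>j. (norm (u j p))\<^sup>2)" for p
    by (rule summable_finite[of "{fst p}"]) (auto simp: u_def)
  from ell2_direct_sum[OF this] obtain V where V': "\<forall>p q. (\<lambda>j. cinner (u j p) (u j q)) sums cinner (V p) (V q)" ..
  have V: "cinner (V (k, x)) (V (l, y))
      = (if k = l then of_real (exp (- (k' k * (norm (b x - b y))\<^sup>2))) else 0)" for k x l y
  proof -
    have "(\<lambda>j. cinner (u j (k, x)) (u j (l, y)))
        = (\<lambda>j. if j = k then (if k = l then cinner (W j x) (W j y) else 0) else 0)"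
      by (auto simp: u_def fun_eq_iff)
    then have "(\<lambda>j. cinner (u j (k, x)) (u j (l, y))) sums (if k = l then cinner (W k x) (W k y) else 0)"
      using sums_single[of k "\<lambda>j. if k = l then cinner (W j x) (W j y) else 0"] by simp
    then have "cinner (V (k, x)) (V (l, y)) = (if k = l then cinner (W k x) (W k y) else 0)"
      by (rule sums_unique2[OF V'[rule_format]])
    then show ?thesis using W by simp
  qed
  let ?K = "closed_span (range V)"
  have K: "hilbert_subspace ?K" by (intro closure_subspace_ell2 ell2.subspace_span)
  have "cinner (V (k, g + x)) (V (l, g + y)) = cinner (V (k, x)) (V (l, y))" for g k x l y
    by (simp add: V equi)
  then have "\<exists>\<sigma>. shift_rep V \<sigma>" by (rule shift_rep_exists)
  then obtain \<sigma> where \<sigma>: "shift_rep V \<sigma>" ..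
  then have iso: "hilbert_iso ?K ?K (\<sigma> g)" and mult: "x \<in> ?K \<Longrightarrow> \<sigma> (g + h) x = \<sigma> g (\<sigma> h x)"
    and \<sigma>V: "\<sigma> g (V (k, h)) = V (k, g + h)" for g h k x
    by (auto simp: shift_rep_def)
  note sD = hilbert_isoD[OF iso K]
  have norm1: "norm (V p) = 1" for p
  proof -
    have "(norm (V p))\<^sup>2 = 1"
      using arg_cong[OF V[of "fst p" "snd p" "fst p" "snd p"], of Re] by (simp add: Re_cinner_self)
    then show ?thesis using norm_ge_zero[of "V p"] unfolding power2_eq_1_iff by linarith
  qed
  have VK: "V p \<in> ?K" for p using ell2.span_base[of "V p" "range V"] closure_subset by blast
  \<comment> \<open>For fixed \<open>g\<close> the kernel
    \<open>exp (- (k' k * (norm (b g))\<^sup>2))\<close> tends to 1 as the scale \<open>k' k\<close>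
    tends to 0.\<close>
  have ai: "(\<lambda>k. norm (V (k, 0) - V (k, g))) \<longlonglongrightarrow> 0" for g
  proof -
    have "(norm (V (k, 0) - V (k, g)))\<^sup>2 = 2 - 2 * exp (- (k' k * (norm (b g))\<^sup>2))" for k
      by (simp add: norm_diff_sq norm1 V b0)
    moreover have "(\<lambda>k. 2 - 2 * exp (- (k' k * (norm (b g))\<^sup>2))) \<longlonglongrightarrow> 2 - 2 * exp (- (0 * (norm (b g))\<^sup>2))"
      unfolding k'_def by (intro tendsto_intros LIMSEQ_Suc[OF lim_1_over_n])
    ultimately have "(\<lambda>k. (norm (V (k, 0) - V (k, g)))\<^sup>2) \<longlonglongrightarrow> 0" by simp
    then show ?thesis by simp
  qed
  have "\<forall>j :: nat. \<exists>g. norm (b g) > real j" using unb by blast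
  then obtain a where "\<forall>j :: nat. norm (b (a j)) > real j" by (rule choice[THEN exE])
  then have a: "\<And>j :: nat. norm (b (a j)) > real j" by blast
  have gen: "(\<lambda>j. cinner (\<sigma> (a j) (V p)) (V q)) \<longlonglongrightarrow> 0" for p q
  proof -
    obtain k x l y where pq: "p = (k, x)" "q = (l, y)" by (cases p, cases q)
    define c where "c = norm (b x) + norm (b y)"
    \<comment> \<open>Equivariance bounds the distance from \<open>b (a j)\<close> to
      \<open>b (a j + x)\<close> by \<open>norm (b x)\<close> independently of \<open>j\<close>, so
      \<open>b (a j + x)\<close> also leaves every bounded set.\<close>
    have big: "real j - c \<le> norm (b (a j + x) - b y)" for j
    proof -
      have "norm (b (a j)) \<le> norm (b (a j + 0) - b (a j + x)) + norm (b (a j + x) - b y) + norm (b y)"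
        using norm_triangle_ineq[of "b (a j) - b (a j + x)" "b (a j + x)"]
          norm_triangle_ineq[of "b (a j + x) - b y" "b y"] by simp
      then show ?thesis using a[of j] unfolding equi by (simp add: b0 c_def)
    qed
    have "filterlim (\<lambda>j. real j - c) at_top sequentially"
      by (intro filterlim_tendsto_add_at_top[of "\<lambda>_. - c" "- c", simplified] filterlim_real_sequentially)
    then have "filterlim (\<lambda>j. norm (b (a j + x) - b y)) at_top sequentially"
      by (rule filterlim_at_top_mono) (simp add: big)
    then have "filterlim (\<lambda>j. (norm (b (a j + x) - b y))\<^sup>2) at_top sequentially"
      by (intro filterlim_pow_at_top) auto
    then have "filterlim (\<lambda>j. k' k * (norm (b (a j + x) - b y))\<^sup>2) at_top sequentially"
      by (intro filterlim_tendsto_pos_mult_at_top[OF tendsto_const k'pos])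
    then have "(\<lambda>j. exp (- (k' k * (norm (b (a j + x) - b y))\<^sup>2))) \<longlonglongrightarrow> 0"
      by (intro filterlim_compose[OF exp_at_bot] filterlim_uminus_at_bot[THEN iffD2]) simp
    then have "(\<lambda>j. complex_of_real (exp (- (k' k * (norm (b (a j + x) - b y))\<^sup>2)))) \<longlonglongrightarrow> of_real 0"
      by (rule tendsto_of_real)
    then show ?thesis by (cases "k = l") (simp_all add: pq \<sigma>V V)
  qed
  have gen2: "(\<lambda>j. cinner (\<sigma> (a j) (V p)) y) \<longlonglongrightarrow> 0" if "y \<in> ?K" for p y
    by (rule weak_null_closure[OF _ _ that, of _ 1]) (auto simp: sD VK norm1 intro: gen)
  \<comment> \<open>The density argument treats the right argument of the inner product only;
    passing to the adjoint \<open>\<sigma> (- g)\<close> brings the left argument into that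
    position.\<close>
  have adj: "cinner (\<sigma> g x) y = cnj (cinner (\<sigma> (- g) y) x)" if "x \<in> ?K" "y \<in> ?K" for g x y
  proof -
    have "\<sigma> g (\<sigma> (- g) y) = y"
      using mult[OF that(2), of g "- g"] hilbert_iso_rep_zero[OF iso K mult that(2)] by simp
    then have "cinner (\<sigma> g x) y = cinner (\<sigma> g x) (\<sigma> g (\<sigma> (- g) y))" by simp
    also have "\<dots> = cinner x (\<sigma> (- g) y)" by (intro sD that)
    finally show ?thesis by (subst (asm) (2) cinner_commute)
  qed
  have "(\<lambda>j. cinner (\<sigma> (a j) x) y) \<longlonglongrightarrow> 0" if "x \<in> ?K" "y \<in> ?K" for x y
  proof -
    have "(\<lambda>j. cinner (\<sigma> (- a j) y) v) \<longlonglongrightarrow> 0" if v: "v \<in> range V" for v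
    proof -
      obtain p where p: "v = V p" using v by blast
      have "(\<lambda>j. cnj (cinner (\<sigma> (a j) (V p)) y)) \<longlonglongrightarrow> cnj 0"
        by (intro tendsto_cnj gen2 \<open>y \<in> ?K\<close>)
      then show ?thesis using adj[OF VK \<open>y \<in> ?K\<close>] by (simp add: p)
    qed
    then have "(\<lambda>j. cinner (\<sigma> (- a j) y) x) \<longlonglongrightarrow> 0"
      by (rule weak_null_closure[OF eq_refl[OF sD(6)[OF \<open>y \<in> ?K\<close>]] _ \<open>x \<in> ?K\<close>])
    then have "(\<lambda>j. cnj (cinner (\<sigma> (- a j) y) x)) \<longlonglongrightarrow> cnj 0" by (rule tendsto_cnj)
    then show ?thesis using adj[OF that] by simp
  qed
  with \<sigma> norm1 ai show ?thesis by (intro exI[of _ V] exI[of _ \<sigma>] exI[of _ a]) auto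
qed

section \<open>Actions of countable discrete groups\<close>

text \<open>If \<open>P\<close> failed at \<open>g\<close>, the singleton of \<open>g\<close> would
  be null. By translation all singletons would be null, and with them the whole countable
  group.\<close>

lemma haar_AE_countable:
  fixes \<mu> :: "'g :: {topological_group_add, t2_space, second_countable_topology} measure"
  assumes haar: "left_haar_measure \<mu>" and cnt: "countable (UNIV :: 'g set)" and P: "AE g in \<mu>. P g"
  shows "P g"
proof (rule ccontr)
  assume "\<not> P g"
  then have ne: "AE h in \<mu>. h \<noteq> g" using P by (auto elim: AE_mp)
  have "AE h in \<mu>. h \<noteq> k" for k
    using haar_AE_translate[OF haar ne, of "g + - k"] by eventually_elim (auto simp: add.assoc)
  then have "AE h in \<mu>. \<forall>k\<in>UNIV. h \<noteq> k" by (subst AE_ball_countable[OF cnt]) simp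
  then show False using haar_AE_ex[OF haar] by blast
qed

context pmp_action
begin

text \<open>On a set of more than half the measure \<open>\<xi>\<close> is uniformly close to finitely many vectors; this
  set meets its translate by \<open>a j\<close>, so some matrix coefficient between these vectors stays large.\<close>

lemma no_mixing_invariant_section:
  fixes \<sigma> :: "'g \<Rightarrow> ell2 \<Rightarrow> ell2" and a :: "nat \<Rightarrow> 'g"
  assumes K: "hilbert_subspace K" and iso: "\<And>g. hilbert_iso K K (\<sigma> g)"
    and mixing: "\<And>x y. x \<in> K \<Longrightarrow> y \<in> K \<Longrightarrow> (\<lambda>j. cinner (\<sigma> (a j) x) y) \<longlonglongrightarrow> 0"
    and nz: "emeasure \<nu> (space \<nu>) \<noteq> 0"
    and meas: "\<And>d. d \<in> K \<Longrightarrow> (\<lambda>y. norm (\<xi> y - d)) \<in> borel_measurable \<nu>"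
    and \<xi>K: "\<And>y. y \<in> space \<nu> \<Longrightarrow> \<xi> y \<in> K" and unit: "AE y in \<nu>. norm (\<xi> y) = 1"
    and inv: "\<And>g. AE y in \<nu>. \<xi> y = \<sigma> g (\<xi> (act (- g) y))"
  shows False
proof -
  note sD = hilbert_isoD[OF iso K]
  \<comment> \<open>With radius 1/8, replacing the two vectors in an inner product equal to 1 by net
    points costs at most 1/8 and 9/64, which leaves a coefficient above 1/2.\<close>
  obtain D where D: "countable D" "D \<subseteq> K" "\<And>x. x \<in> K \<Longrightarrow> \<exists>d\<in>D. norm (x - d) < 1 / 8"
    by (rule ell2_countable_net[of "1/8" K]) (simp, rule that)
  have "D \<noteq> {}" using D(3)[of 0] hilbert_subspaceD(1)[OF K] by auto
  define d where "d = from_nat_into D"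
  have dK: "d i \<in> K" for i using from_nat_into[OF \<open>D \<noteq> {}\<close>, of i] D(2) by (auto simp: d_def)
  define A where "A N = {y \<in> space \<nu>. \<exists>i\<le>N. norm (\<xi> y - d i) < 1 / 8}" for N :: nat
  have [measurable]: "(\<lambda>y. norm (\<xi> y - d i)) \<in> borel_measurable \<nu>" for i by (rule meas[OF dK])
  have A: "A N \<in> sets \<nu>" for N unfolding A_def by measurable
  have "(\<Union>N. A N) = space \<nu>"
  proof
    show "space \<nu> \<subseteq> (\<Union>N. A N)"
    proof
      fix y assume y: "y \<in> space \<nu>"
      obtain x where x: "x \<in> D" "norm (\<xi> y - x) < 1 / 8" using D(3)[OF \<xi>K[OF y]] by blast
      obtain i where "d i = x" using from_nat_into_surj[OF D(1) x(1)] by (auto simp: d_def)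
      then have "y \<in> A i" using x y by (auto simp: A_def)
      then show "y \<in> (\<Union>N. A N)" by blast
    qed
  qed (auto simp: A_def)
  moreover have "incseq A" unfolding A_def incseq_def by (auto intro: order_trans)
  ultimately have lim: "(\<lambda>N. measure \<nu> (A N)) \<longlonglongrightarrow> measure \<nu> (space \<nu>)"
    using finite_Lim_measure_incseq[of A] A by auto
  have M: "measure \<nu> (space \<nu>) > 0"
    using nz by (simp add: zero_less_measure_iff emeasure_eq_measure)
  obtain N where N: "measure \<nu> (A N) > measure \<nu> (space \<nu>) / 2"
    using order_tendstoD(1)[OF lim, of "measure \<nu> (space \<nu>) / 2"] M
    by (auto simp: eventually_sequentially)
  have large: "\<exists>i\<le>N. \<exists>l\<le>N. cmod (cinner (\<sigma> g (d l)) (d i)) > 1 / 2" for g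
  proof -
    let ?B = "act (- g) -` A N \<inter> space \<nu>"
    have B: "?B \<in> sets \<nu>" by (rule measurable_sets[OF act_meas A])
    have "measure \<nu> ?B = measure (distr \<nu> \<nu> (act (- g))) (A N)"
      by (rule measure_distr[OF act_meas A, symmetric])
    then have mB: "measure \<nu> ?B = measure \<nu> (A N)" by (simp add: distr_act)
    \<comment> \<open>Both sets have more than half of the total measure, so they cannot be almost
      disjoint.\<close>
    have "\<not> (AE y in \<nu>. y \<notin> A N \<inter> ?B)"
    proof
      assume "AE y in \<nu>. y \<notin> A N \<inter> ?B"
      then have "measure \<nu> (A N \<union> ?B) = measure \<nu> (A N) + measure \<nu> ?B"
        by (intro measure_Un_AE) (use A B in \<open>auto simp: fmeasurable_eq_sets\<close>)
      also have "\<dots> > measure \<nu> (space \<nu>)" using mB N by simp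
      finally show False using bounded_measure[of "A N \<union> ?B"] by simp
    qed
    moreover have "AE y in \<nu>. y \<notin> A N \<inter> ?B" if neg: "\<And>y. y \<in> A N \<inter> ?B \<Longrightarrow> norm (\<xi> y) = 1 \<Longrightarrow>
        \<xi> y = \<sigma> g (\<xi> (act (- g) y)) \<Longrightarrow> False"
      using unit inv[of g] by eventually_elim (use neg in blast)
    ultimately obtain y where y: "y \<in> A N" "y \<in> ?B" "norm (\<xi> y) = 1" "\<xi> y = \<sigma> g (\<xi> (act (- g) y))"
      by blast
    let ?z = "\<xi> (act (- g) y)"
    obtain i where i: "i \<le> N" "norm (\<xi> y - d i) < 1 / 8" using y(1) by (auto simp: A_def)
    obtain l where l: "l \<le> N" "norm (?z - d l) < 1 / 8" using y(2) by (auto simp: A_def)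
    have zK: "?z \<in> K" using y(2) by (auto intro!: \<xi>K act_in_space)
    have nz1: "norm ?z = 1" using y(3,4) sD(6)[OF zK, of g] by simp
    have "norm (d l) \<le> norm ?z + norm (?z - d l)"
      using norm_triangle_ineq4[of ?z "?z - d l"] by simp
    then have dl: "norm (d l) \<le> 9 / 8" using nz1 l by simp
    have "1 = cinner (\<sigma> g ?z) (\<xi> y)" using y(3,4) cinner_self[of "\<xi> y"] by simp
    also have "\<dots> = cinner (\<sigma> g (?z - d l)) (\<xi> y) + cinner (\<sigma> g (d l)) (\<xi> y - d i)
        + cinner (\<sigma> g (d l)) (d i)"
      by (simp add: sD zK dK cinner_diff_left cinner_diff_right)
    finally have "1 \<le> cmod (cinner (\<sigma> g (?z - d l)) (\<xi> y)) + cmod (cinner (\<sigma> g (d l)) (\<xi> y - d i))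
        + cmod (cinner (\<sigma> g (d l)) (d i))"
      by (metis norm_one norm_triangle_ineq norm_triangle_mono order_refl)
    moreover have "cmod (cinner (\<sigma> g (?z - d l)) (\<xi> y)) \<le> 1 / 8"
      using cinner_bound[of "\<sigma> g (?z - d l)" "\<xi> y"] y(3) l(2)
        sD(6)[OF hilbert_subspaceD(4)[OF K zK dK[of l]], of g] by simp
    moreover have "cmod (cinner (\<sigma> g (d l)) (\<xi> y - d i)) \<le> (9/8) * (1/8)"
      using i(2) dl sD(6)[OF dK[of l], of g] by (intro order_trans[OF cinner_bound] mult_mono) auto
    ultimately have "cmod (cinner (\<sigma> g (d l)) (d i)) > 1 / 2" by simp
    with i l show ?thesis by blast
  qed
  \<comment> \<open>The bound \<open>N\<close> was fixed before the group element was chosen, so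
    only finitely many coefficients have to become small and one \<open>j\<close> serves them
    all.\<close>
  have "eventually (\<lambda>j. \<forall>i\<in>{..N}. \<forall>l\<in>{..N}. cmod (cinner (\<sigma> (a j) (d l)) (d i)) < 1 / 2) sequentially"
    by (intro eventually_ball_finite ballI order_tendstoD(2)[OF tendsto_norm_zero[OF mixing]] dK) auto
  then obtain j where "\<forall>i\<in>{..N}. \<forall>l\<in>{..N}. cmod (cinner (\<sigma> (a j) (d l)) (d i)) < 1 / 2"
    by (auto simp: eventually_sequentially)
  with large[of "a j"] show False by (meson atMost_iff order_less_asym)
qed

theorem discrete_action_property_T_imp_kazhdan:
  assumes cnt: "countable (UNIV :: 'g set)" and disc: "\<And>S :: 'g set. open S"
    and nz: "emeasure \<nu> (space \<nu>) \<noteq> 0" and T: "action_property_T \<nu> \<mu> act"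
  shows "kazhdan_property_T TYPE('g)"
  unfolding kazhdan_property_T_def
proof (intro allI impI, rule ccontr, elim conjE)
  fix H and \<pi> :: "'g \<Rightarrow> ell2 \<Rightarrow> ell2"
  assume "unitary_rep H \<pi>" "almost_invariant_vectors H \<pi>" "\<not> (\<exists>x\<in>H. x \<noteq> 0 \<and> (\<forall>g. \<pi> g x = x))"
  from mixing_representation[OF cnt this] obtain V :: "nat \<times> 'g \<Rightarrow> ell2" and \<sigma> a
    where mix: "shift_rep V \<sigma>" "\<forall>p. norm (V p) = 1" "\<forall>g. (\<lambda>k. norm (V (k, 0) - V (k, g))) \<longlonglongrightarrow> 0"
      "\<forall>x\<in>closed_span (range V). \<forall>y\<in>closed_span (range V).
        (\<lambda>j :: nat. cinner (\<sigma> (a j) x) y) \<longlonglongrightarrow> 0"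
    by (elim exE conjE)
  define K where "K = closed_span (range V)"
  have K: "hilbert_subspace K" unfolding K_def by (intro closure_subspace_ell2 ell2.subspace_span)
  have iso: "hilbert_iso K K (\<sigma> g)" and mult: "x \<in> K \<Longrightarrow> \<sigma> (g + h) x = \<sigma> g (\<sigma> h x)"
    and \<sigma>V: "\<sigma> g (V (k, h)) = V (k, g + h)" for g h k x
    using mix(1) by (auto simp: shift_rep_def K_def)
  have VK: "V p \<in> K" for p
    unfolding K_def using ell2.span_base[of "V p" "range V"] closure_subset by blast
  define e where "e = (from_nat_into UNIV :: nat \<Rightarrow> nat \<times> 'g)"
  have "countable (UNIV :: (nat \<times> 'g) set)"
    using countable_SIGMA[of "UNIV :: nat set" "\<lambda>_. UNIV :: 'g set"] cnt by simp
  then have e: "range e = UNIV" unfolding e_def by (intro range_from_nat_into) auto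
  have rV: "range (\<lambda>n. V (e n)) = range V" using e by (metis image_image)
  let ?H = "\<lambda>_ :: 'y. K" and ?s = "\<lambda>n (_ :: 'y). V (e n)"
  have field: "borel_hilbert_field \<nu> ?H ?s"
    unfolding borel_hilbert_field_def using K VK rV by (auto simp: K_def)
  interpret f: hilbert_field \<nu> ?H ?s by standard (rule field)
  \<comment> \<open>All sets are open, so every function on the group is Borel; this gives the joint
    measurability of the coefficients of \<open>\<sigma>\<close>.\<close>
  have measG: "f \<in> borel_measurable borel" for f :: "'g \<Rightarrow> complex"
    by (rule borel_measurableI) (simp add: disc)
  have rep: "action_rep \<nu> act ?H ?s (\<lambda>_ g. \<sigma> g)"
    unfolding action_rep_def
  proof (intro conjI allI ballI field iso)
    show "(\<lambda>(y, g). cinner (\<sigma> g (V (e n))) (V (e m))) \<in> borel_measurable (\<nu> \<Otimes>\<^sub>M borel)" for m n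
      using measurable_compose[OF measurable_snd measG] by (simp add: split_beta')
    show "\<exists>U. conull \<nu> U \<and> (\<forall>y g h. y \<in> U \<and> act (- g) y \<in> U \<and> act (- (g + h)) y \<in> U \<longrightarrow>
        (\<forall>v\<in>K. \<sigma> (g + h) v = \<sigma> g (\<sigma> h v)))"
      using mult by (intro exI[of _ "space \<nu>"]) (auto simp: conull_def)
  qed
  have us: "borel_unit_section \<nu> ?H ?s (\<lambda>_. V (k, 0))" for k
    using mix(2) VK by (simp add: borel_unit_section_def)
  \<comment> \<open>For the constant sections \<open>V (k, 0)\<close> the displacement at
    \<open>g\<close> is the distance from \<open>V (k, 0)\<close> to \<open>V (k, g)\<close>, which
    tends to 0 for every \<open>g\<close>.\<close>
  have lim: "AE (y, g) in \<nu> \<Otimes>\<^sub>M \<mu>. (\<lambda>k. norm (V (k, 0) - \<sigma> g (V (k, 0)))) \<longlonglongrightarrow> 0"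
    using mix(3) by (simp add: \<sigma>V)
  have "\<exists>\<xi>. (\<forall>k. borel_unit_section \<nu> ?H ?s (\<xi> k)) \<and>
      (AE (y, g) in \<nu> \<Otimes>\<^sub>M \<mu>. (\<lambda>k. norm (\<xi> k y - \<sigma> g (\<xi> k (act (- g) y)))) \<longlonglongrightarrow> 0)"
    by (intro exI[of _ "\<lambda>k _. V (k, 0)"] conjI allI us lim)
  then have "\<exists>\<xi>. borel_unit_section \<nu> ?H ?s \<xi> \<and>
      (AE (y, g) in \<nu> \<Otimes>\<^sub>M \<mu>. \<xi> y = \<sigma> g (\<xi> (act (- g) y)))"
    by (rule T[unfolded action_property_T_def, THEN spec, THEN spec, THEN spec, THEN mp, OF rep, THEN mp])
  then obtain \<xi> where \<xi>: "borel_unit_section \<nu> ?H ?s \<xi>"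
    "AE (y, g) in \<nu> \<Otimes>\<^sub>M \<mu>. \<xi> y = \<sigma> g (\<xi> (act (- g) y))" by (elim exE conjE)
  have "AE g in \<mu>. AE y in \<nu>. \<xi> y = \<sigma> g (\<xi> (act (- g) y))"
    by (rule AE_pair_swap[OF _ sigma_mu \<xi>(2)]) unfold_locales
  then have inv: "AE y in \<nu>. \<xi> y = \<sigma> g (\<xi> (act (- g) y))" for g
    by (rule haar_AE_countable[OF haar cnt])
  have \<xi>m: "f.msection \<xi>" using \<xi>(1) by (auto simp: f.msection_def borel_unit_section_def)
  show False
  proof (rule no_mixing_invariant_section[OF K iso _ nz _ _ _ inv])
    show "(\<lambda>j. cinner (\<sigma> (a j) x) y) \<longlonglongrightarrow> 0" if "x \<in> K" "y \<in> K" for x y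
      using mix(4) that by (simp add: K_def)
    show "(\<lambda>y. norm (\<xi> y - d)) \<in> borel_measurable \<nu>" if "d \<in> K" for d
      by (intro f.msection_norm f.msection_diff \<xi>m) (use that in \<open>simp add: f.msection_def\<close>)
  qed (use \<xi>(1) in \<open>auto simp: borel_unit_section_def\<close>)
qed

end

theorem corollary5p16:
  fixes act :: "'g :: {topological_group_add, t2_space, second_countable_topology} \<Rightarrow> 'y \<Rightarrow> 'y"
    and \<mu> :: "'g measure" and \<nu> :: "'y measure"
  assumes "locally_compact_space (euclidean :: 'g topology)"
    and "left_haar_measure \<mu>"
    and "borel_G_space \<nu> act"
    and "finite_measure \<nu>" and "emeasure \<nu> (space \<nu>) \<noteq> 0"
    and "invariant_measure \<nu> act"
    and "ergodic_action \<nu> act"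
  shows "(kazhdan_property_T TYPE('g) \<longrightarrow> action_property_T \<nu> \<mu> act) \<and>
         (countable (UNIV :: 'g set) \<and> (euclidean :: 'g topology) = discrete_topology UNIV \<and>
            action_property_T \<nu> \<mu> act \<longrightarrow> kazhdan_property_T TYPE('g))"
proof (intro conjI impI, goal_cases)
  case 1
  have "pmp_action act \<mu> \<nu>" using assms by (simp add: pmp_action_def)
  then show ?case by (rule kazhdan_imp_action_property_T[OF _ assms(5,7) 1])
next
  case 2
  interpret pmp_action act \<mu> \<nu> using assms by (simp add: pmp_action_def)
  have "open S" for S :: "'g set"
    using 2 openin_discrete_topology[of UNIV S] by (simp add: open_openin)
  then show ?case using 2 assms(5) by (intro discrete_action_property_T_imp_kazhdan) auto
qed

end
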